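(* Let $(d_n)_{n\ge1}$ be a sequence of positive integers with $d_n\to\infty$ as $n\to\infty$. For each $n$, let $\boldsymbol{X}_{n,1},\ldots,\boldsymbol{X}_{n,n}$ be mutually independent random vectors, each uniformly distributed on $\mathbb{S}^{d_n}=\{\boldsymbol{x}\in\mathbb{R}^{d_n+1}:\boldsymbol{x}^\top\boldsymbol{x}=1\}$. For a real sequence of weights $(v_{k,d_n})_{k\ge1}$, let $\psi_n$ and $T_n$ be as defined in the context. Assume: (i) for every $n\ge1$, $$\sigma_n^2:=2\,\mathrm{E}\big[\psi_n^2(\boldsymbol{X}_{n,1}^\top\boldsymbol{X}_{n,2})\big]=2\sum_{k=1}^\infty v_{k,d_n}^4 d_{k,d_n}<\infty;$$ (ii) as $n\to\infty$, $$\sigma_n^{-4}\sum_{k=1}^\infty v_{k,d_n}^8 d_{k,d_n}=o(1)\quad\text{and}\quad \sigma_n^{-4}\,\mathrm{E}\big[\psi_n^4(\boldsymbol{X}_{n,1}^\top\boldsymbol{X}_{n,2})\big]=O(1).$$ Then $\sigma_n^{-1}T_n$ converges weakly to $\mathcal{N}(0,1)$ as $n\to\infty$.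
   Context: $C_k^{(\lambda)}$ denotes the Gegenbauer polynomial of degree $k$ and index $\lambda$ (orthogonal on $[-1,1]$ with respect to the weight $(1-x^2)^{\lambda-1/2}$). For $d\ge2$, $\psi_n:[-1,1]\to\mathbb{R}$ is defined (almost everywhere, as an $L^2$ series) by $\psi_n(x)=\sum_{k=1}^\infty\big(1+\frac{2k}{d_n-1}\big)v_{k,d_n}^2C_k^{(d_n-1)/2}(x)$ when $d_n\ge2$, and $\psi_n(x)=\sum_{k=1}^\infty 2v_{k,1}^2\cos(k\cos^{-1}(x))$ when $d_n=1$. The statistic is $T_n:=\frac{2}{n}\sum_{1\le i<j\le n}\psi_n(\boldsymbol{X}_{n,i}^\top\boldsymbol{X}_{n,j})$. For integers $k\ge1$, $d\ge1$, $d_{k,d}:=\binom{d+k-2}{d-1}+\binom{d+k-1}{d-1}$ (the dimension of the space of spherical harmonics of degree $k$ on $\mathbb{S}^d$); for $d\ge2$ it equals $\big(1+\frac{2k}{d-1}\big)\frac{\Gamma(d-1+k)}{\Gamma(d-1)k!}$. *)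

theory Defs
  imports "HOL-Probability.Probability"
begin

fun gegenbauer :: "nat \<Rightarrow> real \<Rightarrow> real \<Rightarrow> real" where
  "gegenbauer 0 lam x = 1"
| "gegenbauer (Suc 0) lam x = 2 * lam * x"
| "gegenbauer (Suc (Suc n)) lam x =
     (2 * x * (real n + 1 + lam) * gegenbauer (Suc n) lam x
      - (real n + 2 * lam) * gegenbauer n lam x) / (real n + 2)"

text \<open>Dimension of the space of degree-k spherical harmonics on S^d.\<close>
definition dim_harm :: "nat \<Rightarrow> nat \<Rightarrow> real" where
  "dim_harm k d = real (((d + k - 2) choose (d - 1)) + ((d + k - 1) choose (d - 1)))"

definition eucl_space :: "nat \<Rightarrow> (nat \<Rightarrow> real) measure" where
  "eucl_space d = PiM {..d} (\<lambda>_. lborel)"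

definition inner_d :: "nat \<Rightarrow> (nat \<Rightarrow> real) \<Rightarrow> (nat \<Rightarrow> real) \<Rightarrow> real" where
  "inner_d d x y = (\<Sum>i\<le>d. x i * y i)"

definition unit_ball_d :: "nat \<Rightarrow> (nat \<Rightarrow> real) set" where
  "unit_ball_d d = {x \<in> space (eucl_space d). inner_d d x x \<le> 1}"

definition normalize_d :: "nat \<Rightarrow> (nat \<Rightarrow> real) \<Rightarrow> (nat \<Rightarrow> real)" where
  "normalize_d d x = (\<lambda>i\<in>{..d}. x i / sqrt (inner_d d x x))"

text \<open>Uniform distribution (normalised surface measure) on S^d in R^(d+1), defined as
  the cone measure: the image of the uniform distribution on the unit ball under
  radial projection x \<mapsto> x / |x|.\<close>
definition uniform_sphere :: "nat \<Rightarrow> (nat \<Rightarrow> real) measure" where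
  "uniform_sphere d =
     distr (uniform_measure (eucl_space d) (unit_ball_d d)) (eucl_space d) (normalize_d d)"

definition psi_partial :: "(nat \<Rightarrow> nat \<Rightarrow> real) \<Rightarrow> nat \<Rightarrow> nat \<Rightarrow> real \<Rightarrow> real" where
  "psi_partial v d N x =
     (if d \<ge> 2 then (\<Sum>k=1..N. (1 + 2 * real k / (real d - 1)) * (v k d)\<^sup>2
                                * gegenbauer k ((real d - 1) / 2) x)
      else (\<Sum>k=1..N. 2 * (v k 1)\<^sup>2 * cos (real k * arccos x)))"

text \<open>Gegenbauer weight (1-x^2)^(lambda - 1/2) with lambda = (d-1)/2 (Chebyshev weight for d = 1).\<close>
definition geg_weight :: "nat \<Rightarrow> real \<Rightarrow> real" where
  "geg_weight d x = (1 - x\<^sup>2) powr ((real d - 2) / 2)"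

text \<open>psi is (a representative of) the L^2([-1,1], weight) limit of the partial sums.\<close>
definition is_psi :: "(nat \<Rightarrow> nat \<Rightarrow> real) \<Rightarrow> nat \<Rightarrow> (real \<Rightarrow> real) \<Rightarrow> bool" where
  "is_psi v d f \<longleftrightarrow> f \<in> borel_measurable borel \<and>
     (\<lambda>N. \<integral>\<^sup>+ x\<in>{-1..1}. ennreal ((psi_partial v d N x - f x)\<^sup>2 * geg_weight d x) \<partial>lborel)
       \<longlonglongrightarrow> 0"

definition T_stat :: "nat \<Rightarrow> nat \<Rightarrow> (real \<Rightarrow> real) \<Rightarrow> (nat \<Rightarrow> 'a \<Rightarrow> nat \<Rightarrow> real) \<Rightarrow> 'a \<Rightarrow> real" where
  "T_stat n d f X \<omega> =
     2 / real n * (\<Sum>(i, j) \<in> {(i, j). 1 \<le> i \<and> i < j \<and> j \<le> n}. f (inner_d d (X i \<omega>) (X j \<omega>)))"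

end

theory Submission
  imports Defs "HOL-Computational_Algebra.Polynomial"
begin

text \<open>
  The statistic is a degenerate U-statistic, and the proof has two independent halves.

  Probabilistic half: for a symmetric centred kernel \<open>k\<close> with unit conditional variance, the characteristic
  function \<open>\<phi>\<^sub>j\<close> of the statistic built from the first \<open>j\<close> points satisfies
  \<open>\<phi>\<^sub>j\<^sub>+\<^sub>1 \<approx> exp (- t\<^sup>2 j / n\<^sup>2) \<phi>\<^sub>j\<close>, obtained by integrating out the last point. The error is governed by
  the fourth moment of \<open>k\<close> and by the off-diagonal part of the conditional variance, a sum of values of the
  iterated kernel \<open>G(x, y) = E[k(x, Z) k(y, Z)]\<close>. As the conditional variance has a deterministic diagonal,
  the errors can simply be added up; no stopping argument is needed.

  Spherical half: normalising a Gaussian vector gives the uniform distribution on the sphere, independently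
  of the radius, so \<open>E[(x \<bullet> Z)\<^sup>m]\<close> is a constant multiple of \<open>|x|\<^sup>m\<close>. Polarising this, \<open>E[p(x \<bullet> Z) q(y \<bullet> Z)]\<close> is a
  polynomial in \<open>x \<bullet> y\<close> of degree at most \<open>min (deg p) (deg q)\<close>. Together with the one-dimensional
  orthogonality of the Gegenbauer polynomials this forces the reproducing property of the zonal functions,
  which turns \<open>E[G\<^sup>2]\<close> into the eighth-power sum of the weights.
\<close>

section \<open>A central limit theorem for degenerate U-statistics\<close>

text \<open>Passing from j to j + 1 points multiplies the characteristic function by a real factor
  in (0, 1], so an error made once is never amplified, and an error of order o(1/n) per step
  suffices. The cubic Taylor remainder is traded for second and fourth moments by an inequality with
  a free parameter; its choice as n^(-1/2) yields an overall rate n^(-1/2).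

  The function psi_n is only an L^2 class, and this shapes the spherical half: pointwise statements
  concern either polynomials or the iterated kernel. The latter is an inner product of two L^2
  functions, so its series converges at every pair of unit vectors even where the series of psi_n
  need not.

  The uniform law is given as a cone measure. Writing the radial Gaussian density as an integral of
  indicators of balls separates radius and direction by the scaling of volume alone, without polar
  coordinates or rotations. The law of x . Z is then found from its moments, which obey the same
  two-step recursion as those of the Gegenbauer weight. Self-adjointness of convolution together
  with the degree bound replaces any theory of spherical harmonics.\<close>

lemma integral_Cauchy_Schwarz:
  fixes f g :: "'a \<Rightarrow> real"
  assumes [measurable]: "f \<in> borel_measurable M" "g \<in> borel_measurable M"
    and f: "integrable M (\<lambda>x. (f x)\<^sup>2)" and g: "integrable M (\<lambda>x. (g x)\<^sup>2)"
  shows "integrable M (\<lambda>x. f x * g x)"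
    and "\<bar>\<integral>x. f x * g x \<partial>M\<bar> \<le> sqrt (\<integral>x. (f x)\<^sup>2 \<partial>M) * sqrt (\<integral>x. (g x)\<^sup>2 \<partial>M)"
proof -
  show fg: "integrable M (\<lambda>x. f x * g x)"
  proof (rule Bochner_Integration.integrable_bound)
    show "integrable M (\<lambda>x. (f x)\<^sup>2 + (g x)\<^sup>2)" using f g by simp
    have "\<bar>a * b\<bar> \<le> a\<^sup>2 + b\<^sup>2" for a b :: real
      using sum_squares_bound[of a b] sum_squares_bound[of "-a" b] sum_power2_ge_zero[of a b]
      by (auto simp add: abs_if)
    then show "AE x in M. norm (f x * g x) \<le> norm ((f x)\<^sup>2 + (g x)\<^sup>2)" by simp
  qed measurable
  define A B I where "A = (\<integral>x. (f x)\<^sup>2 \<partial>M)" "B = (\<integral>x. (g x)\<^sup>2 \<partial>M)" "I = (\<integral>x. f x * g x \<partial>M)"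
  note defs = this
  have A0: "A \<ge> 0" and B0: "B \<ge> 0" by (simp_all add: defs)
  have quad: "0 \<le> s\<^sup>2 * A + 2 * s * I + B" for s
  proof -
    have "0 \<le> (\<integral>x. (s * f x + g x)\<^sup>2 \<partial>M)" by simp
    also have "\<dots> = (\<integral>x. s\<^sup>2 * (f x)\<^sup>2 + 2 * s * (f x * g x) + (g x)\<^sup>2 \<partial>M)"
      by (intro Bochner_Integration.integral_cong refl) (simp add: power2_eq_square algebra_simps)
    also have "\<dots> = s\<^sup>2 * A + 2 * s * I + B" using f g fg by (simp add: defs)
    finally show ?thesis .
  qed
  have "I\<^sup>2 \<le> A * B"
  proof (cases "A = 0")
    case True
    have "I = 0"
    proof (rule ccontr)
      assume "I \<noteq> 0"
      \<comment> \<open>For A = 0 the quadratic is affine in s, and this s gives it the value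
        -1.\<close>
      then show False using quad[of "- (B + 1) / (2 * I)"] True by (simp add: field_simps)
    qed
    then show ?thesis using True by simp
  next
    case False
    with A0 have A: "A > 0" by simp
    \<comment> \<open>The quadratic is evaluated at its minimiser s = - I / A.\<close>
    have "0 \<le> A * ((- I / A)\<^sup>2 * A + 2 * (- I / A) * I + B)" by (intro mult_nonneg_nonneg quad less_imp_le[OF A])
    also have "\<dots> = A * B - I\<^sup>2" using A by (simp add: field_simps power2_eq_square)
    finally show ?thesis by simp
  qed
  then have "sqrt (I\<^sup>2) \<le> sqrt (A * B)" by (rule real_sqrt_le_mono)
  then show "\<bar>\<integral>x. f x * g x \<partial>M\<bar> \<le> sqrt (\<integral>x. (f x)\<^sup>2 \<partial>M) * sqrt (\<integral>x. (g x)\<^sup>2 \<partial>M)"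
    by (simp add: real_sqrt_mult defs)
qed

lemma (in prob_space) integrable_power_le_4:
  fixes f :: "'a \<Rightarrow> real"
  assumes [measurable]: "f \<in> borel_measurable M" and "integrable M (\<lambda>x. f x ^ 4)" "p \<le> 4"
  shows "integrable M (\<lambda>x. f x ^ p)"
proof (rule Bochner_Integration.integrable_bound)
  show "integrable M (\<lambda>x. 1 + f x ^ 4)" using assms by simp
  have "\<bar>t\<bar> ^ p \<le> 1 + t ^ 4" for t :: real
  proof (cases "\<bar>t\<bar> \<le> 1")
    case True
    then have "\<bar>t\<bar> ^ p \<le> 1" by (simp add: power_le_one)
    then show ?thesis by (smt (verit) zero_le_even_power even_numeral)
  next
    case False
    then have "\<bar>t\<bar> ^ p \<le> \<bar>t\<bar> ^ 4" using assms(3) by (intro power_increasing) auto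
    then show ?thesis by simp
  qed
  then show "AE x in M. norm (f x ^ p) \<le> norm (1 + f x ^ 4)"
    by (intro AE_I2) (auto simp: power_abs intro: order_trans)
qed auto

lemma (in pair_prob_space) integrable_pair_mult:
  fixes f g :: "_ \<Rightarrow> real"
  assumes f: "integrable M1 f" and g: "integrable M2 g"
  shows "integrable (M1 \<Otimes>\<^sub>M M2) (\<lambda>(x, y). f x * g y)"
proof (rule Fubini_integrable)
  have [measurable]: "f \<in> borel_measurable M1" "g \<in> borel_measurable M2" using assms by auto
  show "(\<lambda>(x, y). f x * g y) \<in> borel_measurable (M1 \<Otimes>\<^sub>M M2)" by measurable
  show "integrable M1 (\<lambda>x. \<integral>y. norm (case (x, y) of (x, y) \<Rightarrow> f x * g y) \<partial>M2)"
    using f by (simp add: abs_mult)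
  show "AE x in M1. integrable M2 (\<lambda>y. case (x, y) of (x, y) \<Rightarrow> f x * g y)"
    using g by simp
qed

text \<open>Coordinate j is drawn from M independently of the j coordinates before it; every
  recursion in the sample size integrates out this last coordinate.\<close>

lemma (in prob_space)
  fixes f :: "(nat \<Rightarrow> 'a) \<Rightarrow> 'b :: {banach, second_countable_topology}"
  assumes f: "f \<in> borel_measurable (PiM {..<Suc j} (\<lambda>_. M))"
  shows integrable_PiM_Suc: "integrable (PiM {..<Suc j} (\<lambda>_. M)) f \<longleftrightarrow>
      integrable (M \<Otimes>\<^sub>M PiM {..<j} (\<lambda>_. M)) (\<lambda>(z, w). f (w(j := z)))"
    and integral_PiM_Suc: "integral\<^sup>L (PiM {..<Suc j} (\<lambda>_. M)) f =
      integral\<^sup>L (M \<Otimes>\<^sub>M PiM {..<j} (\<lambda>_. M)) (\<lambda>(z, w). f (w(j := z)))"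
proof -
  let ?P = "\<lambda>j. PiM {..<j} (\<lambda>_. M)"
  have eq: "?P (Suc j) = distr (M \<Otimes>\<^sub>M ?P j) (?P (Suc j)) (\<lambda>(z, w). w(j := z))"
    using distr_pair_PiM_eq_PiM[of "{..<j}" "\<lambda>_. M" j] prob_space_axioms by (simp add: lessThan_Suc)
  have [measurable]: "(\<lambda>(z, w). w(j := z)) \<in> measurable (M \<Otimes>\<^sub>M ?P j) (?P (Suc j))"
    unfolding lessThan_Suc by measurable
  show "integrable (?P (Suc j)) f \<longleftrightarrow> integrable (M \<Otimes>\<^sub>M ?P j) (\<lambda>(z, w). f (w(j := z)))"
    using f by (subst eq) (auto simp: integrable_distr_eq split_def)
  show "integral\<^sup>L (?P (Suc j)) f = integral\<^sup>L (M \<Otimes>\<^sub>M ?P j) (\<lambda>(z, w). f (w(j := z)))"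
    using f by (subst eq) (auto simp: integral_distr split_def)
qed

text \<open>Splitting off the last summand from a sum S of j terms gives E S^4 + 6 j (E g^2)^2 + E
  g^4, since the terms with a single factor g or S have mean zero; the bound follows from 3 j^2 + 6
  j \<le> 3 (j + 1)^2. Integrability of the fourth power is carried through the induction because
  Fubini needs it at the next step.\<close>

lemma (in prob_space) iid_sum_moments:
  fixes g :: "'a \<Rightarrow> real"
  assumes [measurable]: "g \<in> borel_measurable M"
    and g4: "integrable M (\<lambda>x. g x ^ 4)" and g0: "expectation g = 0"
  defines "P \<equiv> \<lambda>j. PiM {..<j} (\<lambda>_::nat. M)"
  shows "integrable (P j) (\<lambda>w. (\<Sum>i<j. g (w i)) ^ 4) \<and>
    (\<integral>w. (\<Sum>i<j. g (w i))\<^sup>2 \<partial>P j) = j * expectation (\<lambda>x. (g x)\<^sup>2) \<and>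
    (\<integral>w. (\<Sum>i<j. g (w i)) ^ 4 \<partial>P j) \<le>
      j * expectation (\<lambda>x. g x ^ 4) + 3 * (real j)\<^sup>2 * (expectation (\<lambda>x. (g x)\<^sup>2))\<^sup>2"
proof (induction j)
  case 0
  interpret P: prob_space "P 0" unfolding P_def by (intro prob_space_PiM) unfold_locales
  show ?case by simp
next
  case (Suc j)
  interpret P: prob_space "P j" unfolding P_def by (intro prob_space_PiM) unfold_locales
  interpret MP: pair_prob_space M "P j" ..
  define S where "S = (\<lambda>w. \<Sum>i<j. g (w i))"
  have S_meas [measurable]: "S \<in> borel_measurable (P j)" unfolding S_def P_def by measurable
  have gp: "integrable M (\<lambda>x. g x ^ p)" if "p \<le> 4" for p
    by (rule integrable_power_le_4[OF assms(1) g4 that])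
  have S4: "integrable (P j) (\<lambda>x. S x ^ 4)" using Suc.IH by (simp add: S_def)
  have Sp: "integrable (P j) (\<lambda>x. S x ^ p)" if "p \<le> 4" for p
    by (rule P.integrable_power_le_4[OF S_meas S4 that])
  have gi: "integrable M g" "integrable M (\<lambda>x. (g x)\<^sup>2)" using gp[of 1] gp[of 2] by auto
  have Si: "integrable (P j) S" "integrable (P j) (\<lambda>x. (S x)\<^sup>2)" "integrable (P j) (\<lambda>x. S x ^ 3)"
      "integrable (P j) (\<lambda>x. S x ^ 4)"
    using Sp[of 1] Sp[of 2] Sp[of 3] Sp[of 4] by auto
  have prod: "integrable (M \<Otimes>\<^sub>M P j) (\<lambda>(z, w). g z ^ p * S w ^ q)" if "p \<le> 4" "q \<le> 4" for p q
    using MP.integrable_pair_mult[OF gp[OF that(1)] Sp[OF that(2)]] .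
  have sum_upd: "(\<Sum>i<Suc j. g ((w(j := z)) i)) = S w + g z" for w z
    by (simp add: S_def)
  have meas: "(\<lambda>w. (\<Sum>i<Suc j. g (w i)) ^ p) \<in> borel_measurable (P (Suc j))" for p
    unfolding P_def by measurable
  \<comment> \<open>Zero exponents are kept so that each summand has the shape
    \<open>t ^ p * s ^ q\<close> covered by \<open>prod\<close>.\<close>
  have 4: "(s + t) ^ 4 = t ^ 0 * s ^ 4 + 4 * (t ^ 1 * s ^ 3) + 6 * (t ^ 2 * s ^ 2) + 4 * (t ^ 3 * s ^ 1)
      + t ^ 4 * s ^ 0" for s t :: real
    by algebra
  have 2: "(s + t) ^ 2 = t ^ 0 * s ^ 2 + 2 * (t ^ 1 * s ^ 1) + t ^ 2 * s ^ 0" for s t :: real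
    by algebra
  have i4: "integrable (M \<Otimes>\<^sub>M P j) (\<lambda>(z, w). (S w + g z) ^ 4)"
    unfolding 4 split_def
    by (intro Bochner_Integration.integrable_add integrable_mult_right prod[unfolded split_def]) simp_all
  have i2: "integrable (M \<Otimes>\<^sub>M P j) (\<lambda>(z, w). (S w + g z) ^ 2)"
    unfolding 2 split_def
    by (intro Bochner_Integration.integrable_add integrable_mult_right prod[unfolded split_def]) simp_all
  have inner4: "expectation (\<lambda>z. (s + g z) ^ 4) = s ^ 4 + 6 * s\<^sup>2 * expectation (\<lambda>x. (g x)\<^sup>2)
      + 4 * s * expectation (\<lambda>x. g x ^ 3) + expectation (\<lambda>x. g x ^ 4)" for s
    unfolding 4 using gi gp[of 3] g4 g0 by (simp add: prob_space mult.commute mult.left_commute)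
  have inner2: "expectation (\<lambda>z. (s + g z) ^ 2) = s\<^sup>2 + expectation (\<lambda>x. (g x)\<^sup>2)" for s
    unfolding 2 using gi gp[of 3] g4 g0 by (simp add: prob_space)
  have S0: "(\<integral>w. S w \<partial>P j) = 0"
  proof -
    have "(\<integral>w. S w \<partial>P j) = (\<Sum>i<j. \<integral>w. g (w i) \<partial>P j)"
      unfolding S_def
    proof (rule Bochner_Integration.integral_sum)
      fix i assume "i \<in> {..<j}"
      then have "distr (P j) M (\<lambda>w. w i) = M"
        unfolding P_def by (intro distr_PiM_component) (auto intro: prob_space_axioms)
      moreover have "(\<lambda>w. w i) \<in> measurable (P j) M"
        unfolding P_def using \<open>i \<in> {..<j}\<close> by measurable
      ultimately show "integrable (P j) (\<lambda>w. g (w i))"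
        using integrable_distr_eq[of "\<lambda>w. w i" "P j" M g] gi by simp
    qed
    also have "\<dots> = 0"
    proof (rule sum.neutral, rule ballI)
      fix i assume "i \<in> {..<j}"
      then have "distr (P j) M (\<lambda>w. w i) = M"
        unfolding P_def by (intro distr_PiM_component) (auto intro: prob_space_axioms)
      moreover have "(\<lambda>w. w i) \<in> measurable (P j) M"
        unfolding P_def using \<open>i \<in> {..<j}\<close> by measurable
      ultimately show "(\<integral>w. g (w i) \<partial>P j) = 0"
        using integral_distr[of "\<lambda>w. w i" "P j" M g] g0 by simp
    qed
    finally show ?thesis .
  qed
  have "(\<integral>w. (\<Sum>i<Suc j. g (w i)) ^ 2 \<partial>P (Suc j)) = (\<integral>w. (\<integral>z. (S w + g z) ^ 2 \<partial>M) \<partial>P j)"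
    using integral_PiM_Suc[OF meas[of 2, unfolded P_def]] MP.integral_snd[OF i2]
    unfolding sum_upd P_def by simp
  also have "\<dots> = (\<integral>w. (S w)\<^sup>2 \<partial>P j) + expectation (\<lambda>x. (g x)\<^sup>2)"
    unfolding inner2 using Si by (simp add: P.prob_space)
  also have "\<dots> = real (Suc j) * expectation (\<lambda>x. (g x)\<^sup>2)"
    using Suc by (simp add: S_def algebra_simps)
  finally have A: "(\<integral>w. (\<Sum>i<Suc j. g (w i)) ^ 2 \<partial>P (Suc j)) = real (Suc j) * expectation (\<lambda>x. (g x)\<^sup>2)" .
  have S2: "(\<integral>w. (S w)\<^sup>2 \<partial>P j) = j * expectation (\<lambda>x. (g x)\<^sup>2)"
    using Suc.IH by (simp add: S_def)
  have "(\<integral>w. (\<Sum>i<Suc j. g (w i)) ^ 4 \<partial>P (Suc j)) = (\<integral>w. (\<integral>z. (S w + g z) ^ 4 \<partial>M) \<partial>P j)"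
    using integral_PiM_Suc[OF meas[of 4, unfolded P_def]] MP.integral_snd[OF i4]
    unfolding sum_upd P_def by simp
  also have "\<dots> = (\<integral>w. S w ^ 4 \<partial>P j) + 6 * real j * (expectation (\<lambda>x. (g x)\<^sup>2))\<^sup>2 + expectation (\<lambda>x. g x ^ 4)"
    unfolding inner4 using Si S0 S2 by (simp add: P.prob_space power2_eq_square)
  also have "\<dots> \<le> real (Suc j) * expectation (\<lambda>x. g x ^ 4) + 3 * (real (Suc j))\<^sup>2 * (expectation (\<lambda>x. (g x)\<^sup>2))\<^sup>2"
  proof -
    let ?e = "(expectation (\<lambda>x. (g x)\<^sup>2))\<^sup>2"
    have "3 * (real (Suc j))\<^sup>2 * ?e = 3 * (real j)\<^sup>2 * ?e + 6 * real j * ?e + 3 * ?e"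
      by (simp add: power2_eq_square algebra_simps)
    moreover have "(\<integral>w. S w ^ 4 \<partial>P j) \<le> j * expectation (\<lambda>x. g x ^ 4) + 3 * (real j)\<^sup>2 * ?e"
      using Suc by (simp add: S_def)
    moreover have "?e \<ge> 0" by simp
    moreover have "real (Suc j) * expectation (\<lambda>x. g x ^ 4) = j * expectation (\<lambda>x. g x ^ 4) + expectation (\<lambda>x. g x ^ 4)"
      by (simp add: algebra_simps)
    ultimately show ?thesis by linarith
  qed
  finally have B: "(\<integral>w. (\<Sum>i<Suc j. g (w i)) ^ 4 \<partial>P (Suc j)) \<le>
      real (Suc j) * expectation (\<lambda>x. g x ^ 4) + 3 * (real (Suc j))\<^sup>2 * (expectation (\<lambda>x. (g x)\<^sup>2))\<^sup>2" .
  have "integrable (P (Suc j)) (\<lambda>w. (\<Sum>i<Suc j. g (w i)) ^ 4)"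
    using integrable_PiM_Suc[OF meas[of 4, unfolded P_def]] i4 unfolding sum_upd P_def by simp
  with A B show ?case by blast
qed

lemma square_of_sum_lessThan:
  fixes a :: "nat \<Rightarrow> real"
  shows "(\<Sum>i<j. a i)\<^sup>2 = (\<Sum>i<j. (a i)\<^sup>2) + 2 * (\<Sum>i'<j. \<Sum>i<i'. a i * a i')"
  by (induction j) (auto simp: power2_eq_square algebra_simps sum_distrib_left)

text \<open>The moment conditions hold at every point x and not merely on average. In particular
  \<open>k_var\<close> makes the diagonal of the conditional variance the constant j, so that only
  its off-diagonal part, measured by \<open>k_corr\<close>, fluctuates.\<close>

locale degenerate_kernel = prob_space M for M :: "'a measure" +
  fixes k :: "'a \<Rightarrow> 'a \<Rightarrow> real" and C \<delta> :: real
  assumes k_pair_meas: "(\<lambda>(x, y). k x y) \<in> borel_measurable (M \<Otimes>\<^sub>M M)"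
    and k_sym: "x \<in> space M \<Longrightarrow> y \<in> space M \<Longrightarrow> k x y = k y x"
    and k_int4: "x \<in> space M \<Longrightarrow> integrable M (\<lambda>z. k x z ^ 4)"
    and k_mean: "x \<in> space M \<Longrightarrow> expectation (k x) = 0"
    and k_var: "x \<in> space M \<Longrightarrow> expectation (\<lambda>z. (k x z)\<^sup>2) = 1"
    and k_fourth: "x \<in> space M \<Longrightarrow> expectation (\<lambda>z. k x z ^ 4) \<le> C"
    and k_corr: "x \<in> space M \<Longrightarrow> expectation (\<lambda>y. (expectation (\<lambda>z. k x z * k y z))\<^sup>2) \<le> \<delta>\<^sup>2"
    and delta_nonneg: "0 \<le> \<delta>"
begin

definition G :: "'a \<Rightarrow> 'a \<Rightarrow> real" where
  "G x y = expectation (\<lambda>z. k x z * k y z)"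

abbreviation P :: "nat \<Rightarrow> (nat \<Rightarrow> 'a) measure" where
  "P j \<equiv> PiM {..<j} (\<lambda>_. M)"

lemma k_meas [measurable (raw)]:
  assumes "f \<in> measurable N M" "g \<in> measurable N M"
  shows "(\<lambda>w. k (f w) (g w)) \<in> borel_measurable N"
  using measurable_compose[OF measurable_Pair[OF assms] k_pair_meas] by simp

lemma k_int:
  assumes "x \<in> space M" "p \<le> 4"
  shows "integrable M (\<lambda>z. k x z ^ p)"
proof (rule integrable_power_le_4[OF _ k_int4 assms(2)])
  show "k x \<in> borel_measurable M" using assms(1) by measurable
qed fact

lemma C_nonneg: "0 \<le> C"
proof -
  obtain x where x: "x \<in> space M" using not_empty by blast
  have "0 \<le> expectation (\<lambda>z. k x z ^ 4)" by (rule integral_nonneg_AE) simp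
  with k_fourth[OF x] show ?thesis by linarith
qed

lemma
  assumes x [measurable]: "x \<in> space M" and y [measurable]: "y \<in> space M"
  shows k_mult_int: "integrable M (\<lambda>z. k x z * k y z)"
    and abs_G_le: "\<bar>G x y\<bar> \<le> 1"
proof -
  note CS = integral_Cauchy_Schwarz[of "k x" M "k y", OF _ _ k_int[OF x, of 2] k_int[OF y, of 2]]
  show "integrable M (\<lambda>z. k x z * k y z)" by (rule CS(1)) measurable
  have "\<bar>G x y\<bar> \<le> sqrt (expectation (\<lambda>z. (k x z)\<^sup>2)) * sqrt (expectation (\<lambda>z. (k y z)\<^sup>2))"
    unfolding G_def by (rule CS(2)) measurable
  then show "\<bar>G x y\<bar> \<le> 1" using k_var x y by simp
qed

lemma G_sym: "G x y = G y x"
  by (simp add: G_def mult.commute)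

lemma G_meas [measurable (raw)]:
  assumes [measurable]: "f \<in> measurable N M" "g \<in> measurable N M"
  shows "(\<lambda>w. G (f w) (g w)) \<in> borel_measurable N"
  unfolding G_def by measurable

lemma k2_pair_int: "integrable (M \<Otimes>\<^sub>M M) (\<lambda>(y, z). (k y z)\<^sup>2)"
proof -
  interpret MM: pair_prob_space M M ..
  show ?thesis
  proof (rule MM.Fubini_integrable)
    show "(\<lambda>(y, z). (k y z)\<^sup>2) \<in> borel_measurable (M \<Otimes>\<^sub>M M)" by measurable
    have "integrable M (\<lambda>x. \<integral>y. norm (case (x, y) of (y, z) \<Rightarrow> (k y z)\<^sup>2) \<partial>M) \<longleftrightarrow> integrable M (\<lambda>x. 1::real)"
      by (rule Bochner_Integration.integrable_cong) (auto simp: k_var)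
    then show "integrable M (\<lambda>x. \<integral>y. norm (case (x, y) of (y, z) \<Rightarrow> (k y z)\<^sup>2) \<partial>M)" by simp
    show "AE x in M. integrable M (\<lambda>y. case (x, y) of (y, z) \<Rightarrow> (k y z)\<^sup>2)"
      using k_int[of _ 2] by auto
  qed
qed

text \<open>Fubini moves the integral over y onto k(y, z), which by symmetry has mean zero in its
  first argument too.\<close>

lemma G_mean:
  assumes x: "x \<in> space M"
  shows "expectation (G x) = 0"
proof -
  interpret MM: pair_prob_space M M ..
  have i: "integrable (M \<Otimes>\<^sub>M M) (\<lambda>(y, z). k x z * k y z)"
  proof (rule Bochner_Integration.integrable_bound)
    have "integrable (M \<Otimes>\<^sub>M M) (\<lambda>(y, z). 1 * (k x z)\<^sup>2)"
      using MM.integrable_pair_mult[of "\<lambda>_. 1" "\<lambda>z. (k x z)\<^sup>2"] k_int[OF x, of 2] by simp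
    from Bochner_Integration.integrable_add[OF this k2_pair_int]
    show "integrable (M \<Otimes>\<^sub>M M) (\<lambda>(y, z). (k x z)\<^sup>2 + (k y z)\<^sup>2)" by (simp add: split_def)
    show "(\<lambda>(y, z). k x z * k y z) \<in> borel_measurable (M \<Otimes>\<^sub>M M)" using x by measurable
    have "\<bar>a * b\<bar> \<le> a\<^sup>2 + b\<^sup>2" for a b :: real
      using sum_squares_bound[of a b] sum_squares_bound[of "-a" b] sum_power2_ge_zero[of a b]
      by (auto simp add: abs_if)
    then show "AE p in M \<Otimes>\<^sub>M M. norm (case p of (y, z) \<Rightarrow> k x z * k y z) \<le>
        norm (case p of (y, z) \<Rightarrow> (k x z)\<^sup>2 + (k y z)\<^sup>2)"
      by (auto simp: split_def)
  qed
  have "expectation (G x) = (\<integral>z. (\<integral>y. k x z * k y z \<partial>M) \<partial>M)"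
    unfolding G_def using MM.integral_fst[OF i] MM.integral_snd[OF i] by simp
  also have "\<dots> = (\<integral>z. 0 \<partial>M)"
  proof (rule Bochner_Integration.integral_cong[OF refl])
    fix z assume z: "z \<in> space M"
    have "(\<integral>y. k y z \<partial>M) = (\<integral>y. k z y \<partial>M)"
      using z by (intro Bochner_Integration.integral_cong) (auto intro: k_sym)
    then show "(\<integral>y. k x z * k y z \<partial>M) = 0" using k_mean[OF z] by simp
  qed
  finally show ?thesis by simp
qed

section \<open>The fluctuating part of the conditional variance\<close>

lemma in_space_P: "w \<in> space (P j) \<Longrightarrow> i < j \<Longrightarrow> w i \<in> space M"
  by (auto simp: space_PiM)

text \<open>Half of the off-diagonal part of the conditional second moment of the next increment,
  which is j + 2 \<open>R\<close>.\<close>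

definition R :: "nat \<Rightarrow> (nat \<Rightarrow> 'a) \<Rightarrow> real" where
  "R j w = (\<Sum>i'<j. \<Sum>i<i'. G (w i) (w i'))"

lemma R_meas: "R j \<in> borel_measurable (P j)"
  unfolding R_def by measurable

lemma abs_R_le:
  assumes "w \<in> space (P j)"
  shows "\<bar>R j w\<bar> \<le> (real j)\<^sup>2"
proof -
  have "\<bar>R j w\<bar> \<le> (\<Sum>i'<j. \<Sum>i<i'. \<bar>G (w i) (w i')\<bar>)"
    unfolding R_def by (intro order_trans[OF sum_abs] sum_mono order_refl)
  also have "\<dots> \<le> (\<Sum>i'<j. \<Sum>i<i'. 1)"
    using in_space_P[OF assms] by (intro sum_mono abs_G_le) auto
  also have "\<dots> \<le> (\<Sum>i'<j. real j)" by (intro sum_mono) auto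
  finally show ?thesis by (simp add: power2_eq_square)
qed

lemma R_square_le:
  assumes "w \<in> space (P j)"
  shows "(R j w)\<^sup>2 \<le> real j ^ 4"
  using power_mono[OF abs_R_le[OF assms] abs_ge_zero, of 2] by simp

text \<open>\<open>R\<close> is itself a degenerate U-statistic, with kernel \<open>G\<close>: a new
  point adds a term Q that is centred given the old points, so the cross term vanishes. For a fixed
  new point Q is a sum of j i.i.d. centred terms and has second moment at most j \<delta>^2; then
  j^2 + j \<le> (j + 1)^2.\<close>

lemma R_second_moment: "(\<integral>w. (R j w)\<^sup>2 \<partial>P j) \<le> (real j)\<^sup>2 * \<delta>\<^sup>2"
proof (induction j)
  case 0
  interpret P: prob_space "P 0" by (intro prob_space_PiM) unfold_locales
  show ?case by (simp add: R_def)
next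
  case (Suc j)
  interpret P: prob_space "P j" by (intro prob_space_PiM) unfold_locales
  interpret MP: pair_prob_space M "P j" ..
  note R_meas[measurable]
  define Q where "Q = (\<lambda>w z. \<Sum>i<j. G (w i) z)"
  have Q_meas [measurable]: "(\<lambda>(z, w). Q w z) \<in> borel_measurable (M \<Otimes>\<^sub>M P j)"
    unfolding Q_def by measurable
  have Q_le: "\<bar>Q w z\<bar> \<le> real j" if "w \<in> space (P j)" "z \<in> space M" for w z
  proof -
    have "\<bar>Q w z\<bar> \<le> (\<Sum>i<j. \<bar>G (w i) z\<bar>)" unfolding Q_def by (rule sum_abs)
    also have "\<dots> \<le> (\<Sum>i<j. 1)" using in_space_P[OF that(1)] that(2) by (intro sum_mono abs_G_le) auto
    finally show ?thesis by simp
  qed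
  have R_upd: "R (Suc j) (w(j := z)) = R j w + Q w z" for w z
    by (simp add: R_def Q_def)
  have iRR: "integrable (M \<Otimes>\<^sub>M P j) (\<lambda>(z, w). (R j w)\<^sup>2)"
    by (rule MP.integrable_const_bound[where B="real j ^ 4"])
       (auto simp: space_pair_measure R_square_le intro!: AE_I2)
  have iRQ: "integrable (M \<Otimes>\<^sub>M P j) (\<lambda>(z, w). R j w * Q w z)"
    by (rule MP.integrable_const_bound[where B="(real j)\<^sup>2 * real j"])
       (auto simp: space_pair_measure abs_mult intro!: AE_I2 mult_mono abs_R_le Q_le)
  have iQQ: "integrable (M \<Otimes>\<^sub>M P j) (\<lambda>(z, w). (Q w z)\<^sup>2)"
    by (rule MP.integrable_const_bound[where B="(real j)\<^sup>2"])
       (auto simp: space_pair_measure abs_le_square_iff[symmetric] Q_le intro!: AE_I2)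
  have eRQ: "(\<integral>p. (case p of (z, w) \<Rightarrow> R j w * Q w z) \<partial>(M \<Otimes>\<^sub>M P j)) = 0"
  proof -
    have "(\<integral>p. (case p of (z, w) \<Rightarrow> R j w * Q w z) \<partial>(M \<Otimes>\<^sub>M P j)) = (\<integral>w. (\<integral>z. R j w * Q w z \<partial>M) \<partial>P j)"
      using MP.integral_snd[OF iRQ] by simp
    also have "\<dots> = (\<integral>w. 0 \<partial>P j)"
    proof (rule Bochner_Integration.integral_cong[OF refl])
      fix w assume w: "w \<in> space (P j)"
      have "(\<integral>z. Q w z \<partial>M) = (\<Sum>i<j. \<integral>z. G (w i) z \<partial>M)"
        unfolding Q_def
      proof (rule Bochner_Integration.integral_sum)
        fix i assume "i \<in> {..<j}"
        then have [measurable]: "w i \<in> space M" using in_space_P[OF w] by simp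
        show "integrable M (G (w i))"
          by (rule integrable_const_bound[where B=1])
             (auto intro!: AE_I2 abs_G_le \<open>w i \<in> space M\<close>)
      qed
      also have "\<dots> = 0" using in_space_P[OF w] by (auto intro!: sum.neutral G_mean)
      finally show "(\<integral>z. R j w * Q w z \<partial>M) = 0" by simp
    qed
    finally show ?thesis by simp
  qed
  have eQQ: "(\<integral>p. (case p of (z, w) \<Rightarrow> (Q w z)\<^sup>2) \<partial>(M \<Otimes>\<^sub>M P j)) \<le> j * \<delta>\<^sup>2"
  proof -
    have "(\<integral>p. (case p of (z, w) \<Rightarrow> (Q w z)\<^sup>2) \<partial>(M \<Otimes>\<^sub>M P j)) = (\<integral>z. (\<integral>w. (Q w z)\<^sup>2 \<partial>P j) \<partial>M)"
      using MP.integral_fst[OF iQQ] by simp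
    also have "\<dots> \<le> (\<integral>z. j * \<delta>\<^sup>2 \<partial>M)"
    proof (rule integral_mono)
      show "integrable M (\<lambda>z. \<integral>w. (Q w z)\<^sup>2 \<partial>P j)" using MP.integrable_fst[OF iQQ] .
      fix z assume z: "z \<in> space M"
      have Gz: "(\<lambda>x. G x z) = G z" by (auto simp: G_sym)
      have "G z x ^ 4 \<le> 1" if "x \<in> space M" for x
        using power_le_one[of "\<bar>G z x\<bar>" 4] abs_G_le[OF z that] by simp
      then have "integrable M (\<lambda>x. G z x ^ 4)"
        using z by (intro integrable_const_bound[where B=1]) (auto intro!: AE_I2)
      then have "(\<integral>w. (\<Sum>i<j. G z (w i))\<^sup>2 \<partial>P j) = j * expectation (\<lambda>x. (G z x)\<^sup>2)"
        using iid_sum_moments[of "G z" j] G_mean[OF z] z by auto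
      also have "(\<lambda>w. \<Sum>i<j. G z (w i)) = (\<lambda>w. Q w z)" by (auto simp: Q_def G_sym)
      then have "(\<integral>w. (\<Sum>i<j. G z (w i))\<^sup>2 \<partial>P j) = (\<integral>w. (Q w z)\<^sup>2 \<partial>P j)" by (simp add: fun_eq_iff)
      finally show "(\<integral>w. (Q w z)\<^sup>2 \<partial>P j) \<le> j * \<delta>\<^sup>2"
        using k_corr[OF z] by (simp add: G_def mult_left_mono)
    qed simp
    finally show ?thesis by (simp add: prob_space)
  qed
  have "(\<lambda>w. (R (Suc j) w)\<^sup>2) \<in> borel_measurable (P (Suc j))" by measurable
  then have "(\<integral>w. (R (Suc j) w)\<^sup>2 \<partial>P (Suc j)) =
      (\<integral>p. (case p of (z, w) \<Rightarrow> (R j w + Q w z)\<^sup>2) \<partial>(M \<Otimes>\<^sub>M P j))"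
    by (subst integral_PiM_Suc) (simp_all add: R_upd)
  also have "\<dots> = (\<integral>p. (case p of (z, w) \<Rightarrow> (R j w)\<^sup>2) + 2 * (case p of (z, w) \<Rightarrow> R j w * Q w z)
        + (case p of (z, w) \<Rightarrow> (Q w z)\<^sup>2) \<partial>(M \<Otimes>\<^sub>M P j))"
    by (intro Bochner_Integration.integral_cong) (auto simp: power2_sum)
  also have "\<dots> = (\<integral>p. (case p of (z, w) \<Rightarrow> (R j w)\<^sup>2) \<partial>(M \<Otimes>\<^sub>M P j)) +
      (\<integral>p. (case p of (z, w) \<Rightarrow> (Q w z)\<^sup>2) \<partial>(M \<Otimes>\<^sub>M P j))"
    using iRR iRQ iQQ eRQ by simp
  also have "(\<integral>p. (case p of (z, w) \<Rightarrow> (R j w)\<^sup>2) \<partial>(M \<Otimes>\<^sub>M P j)) = (\<integral>w. (R j w)\<^sup>2 \<partial>P j)"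
    using MP.integral_snd[OF iRR] by (simp add: prob_space)
  also have "(\<integral>w. (R j w)\<^sup>2 \<partial>P j) + (\<integral>p. (case p of (z, w) \<Rightarrow> (Q w z)\<^sup>2) \<partial>(M \<Otimes>\<^sub>M P j))
      \<le> (real j)\<^sup>2 * \<delta>\<^sup>2 + j * \<delta>\<^sup>2"
    using Suc eQQ by simp
  also have "\<dots> \<le> (real (Suc j))\<^sup>2 * \<delta>\<^sup>2"
    unfolding distrib_right[symmetric] by (intro mult_right_mono) (auto simp: power2_eq_square algebra_simps)
  finally show ?case .
qed

text \<open>Nonnegativity of the variance of |R| bounds its mean by the root of the second
  moment.\<close>

lemma R_first_moment: "(\<integral>w. \<bar>R j w\<bar> \<partial>P j) \<le> real j * \<delta>"
proof -
  interpret P: prob_space "P j" by (intro prob_space_PiM) unfold_locales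
  note R_meas[measurable]
  have i1: "integrable (P j) (R j)"
    by (rule P.integrable_const_bound[where B="(real j)\<^sup>2"]) (auto simp: abs_R_le intro!: AE_I2)
  have i2: "integrable (P j) (\<lambda>w. (R j w)\<^sup>2)"
    by (rule P.integrable_const_bound[where B="real j ^ 4"])
       (auto simp: R_square_le intro!: AE_I2)
  have "0 \<le> P.variance (\<lambda>w. \<bar>R j w\<bar>)" by simp
  also have "\<dots> = (\<integral>w. (R j w)\<^sup>2 \<partial>P j) - (\<integral>w. \<bar>R j w\<bar> \<partial>P j)\<^sup>2"
    using i1 i2 by (subst P.variance_eq) auto
  finally have "(\<integral>w. \<bar>R j w\<bar> \<partial>P j)\<^sup>2 \<le> (real j * \<delta>)\<^sup>2"
    using R_second_moment[of j] by (simp add: power_mult_distrib)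
  then show ?thesis using delta_nonneg by (simp add: abs_le_square_iff[symmetric])
qed

section \<open>Characteristic functions when a point is added to the sample\<close>

definition F :: "nat \<Rightarrow> (nat \<Rightarrow> 'a) \<Rightarrow> real" where
  "F j w = (\<Sum>i'<j. \<Sum>i<i'. k (w i) (w i'))"

definition phi :: "real \<Rightarrow> nat \<Rightarrow> complex" where
  "phi s j = (\<integral>w. iexp (s * F j w) \<partial>P j)"

text \<open>Increment of \<open>F\<close> when the point z joins the sample w.\<close>

definition Y :: "nat \<Rightarrow> (nat \<Rightarrow> 'a) \<Rightarrow> 'a \<Rightarrow> real" where
  "Y j w z = (\<Sum>i<j. k (w i) z)"

lemma F_meas [measurable]: "F j \<in> borel_measurable (P j)"
  unfolding F_def by measurable

lemma Y_meas [measurable]: "(\<lambda>(z, w). Y j w z) \<in> borel_measurable (M \<Otimes>\<^sub>M P j)"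
  unfolding Y_def by measurable

lemma F_upd: "F (Suc j) (w(j := z)) = F j w + Y j w z"
  by (simp add: F_def Y_def)

text \<open>With z fixed and the sample random, symmetry of the kernel makes the increment a sum of
  the i.i.d. centred variables k(z, w_i) of variance 1.\<close>

lemma Y_moments:
  assumes z: "z \<in> space M"
  shows "integrable (P j) (\<lambda>w. Y j w z ^ 4)"
    and "(\<integral>w. (Y j w z)\<^sup>2 \<partial>P j) = j"
    and "(\<integral>w. Y j w z ^ 4 \<partial>P j) \<le> j * C + 3 * (real j)\<^sup>2"
proof -
  have eq: "Y j w z = (\<Sum>i<j. k z (w i))" if "w \<in> space (P j)" for w
    unfolding Y_def using in_space_P[OF that] z by (intro sum.cong refl k_sym) auto
  have [measurable]: "k z \<in> borel_measurable M" using z by measurable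
  note m = iid_sum_moments[of "k z" j, OF _ k_int4[OF z] k_mean[OF z]]
  show "integrable (P j) (\<lambda>w. Y j w z ^ 4)"
    using m by (subst Bochner_Integration.integrable_cong[OF refl]) (auto simp: eq)
  show "(\<integral>w. (Y j w z)\<^sup>2 \<partial>P j) = j"
    using m k_var[OF z] by (subst Bochner_Integration.integral_cong[OF refl]) (auto simp: eq)
  have "(\<integral>w. Y j w z ^ 4 \<partial>P j) = (\<integral>w. (\<Sum>i<j. k z (w i)) ^ 4 \<partial>P j)"
    by (intro Bochner_Integration.integral_cong) (auto simp: eq)
  also have "\<dots> \<le> j * expectation (\<lambda>x. k z x ^ 4) + 3 * (real j)\<^sup>2"
    using m k_var[OF z] by simp
  also have "\<dots> \<le> j * C + 3 * (real j)\<^sup>2"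
    using k_fourth[OF z] by (simp add: mult_left_mono)
  finally show "(\<integral>w. Y j w z ^ 4 \<partial>P j) \<le> j * C + 3 * (real j)\<^sup>2" .
qed

lemma Y_pair_moments:
  shows "p \<le> 4 \<Longrightarrow> integrable (M \<Otimes>\<^sub>M P j) (\<lambda>(z, w). Y j w z ^ p)"
    and "(\<integral>w. (\<integral>z. (Y j w z)\<^sup>2 \<partial>M) \<partial>P j) = j"
    and "(\<integral>w. (\<integral>z. Y j w z ^ 4 \<partial>M) \<partial>P j) \<le> j * C + 3 * (real j)\<^sup>2"
proof -
  interpret P: prob_space "P j" by (intro prob_space_PiM) unfold_locales
  interpret MP: pair_prob_space M "P j" ..
  have i4: "integrable (M \<Otimes>\<^sub>M P j) (\<lambda>(z, w). Y j w z ^ 4)"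
  proof (rule MP.Fubini_integrable)
    show "integrable M (\<lambda>z. \<integral>w. norm (case (z, w) of (z, w) \<Rightarrow> Y j w z ^ 4) \<partial>P j)"
    proof (rule integrable_const_bound)
      show "AE z in M. norm (\<integral>w. norm (case (z, w) of (z, w) \<Rightarrow> Y j w z ^ 4) \<partial>P j) \<le> j * C + 3 * (real j)\<^sup>2"
        using Y_moments(3) by (auto intro!: AE_I2)
    qed measurable
    show "AE z in M. integrable (P j) (\<lambda>w. case (z, w) of (z, w) \<Rightarrow> Y j w z ^ 4)"
      using Y_moments(1) by auto
  qed measurable
  have ip: "integrable (M \<Otimes>\<^sub>M P j) (\<lambda>(z, w). Y j w z ^ p)" if "p \<le> 4" for p
    using MP.integrable_power_le_4[of "\<lambda>(z, w). Y j w z" p] i4 that by (simp add: split_def)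
  then show "p \<le> 4 \<Longrightarrow> integrable (M \<Otimes>\<^sub>M P j) (\<lambda>(z, w). Y j w z ^ p)" .
  have i2: "integrable (M \<Otimes>\<^sub>M P j) (\<lambda>(z, w). (Y j w z)\<^sup>2)" using ip[of 2] by simp
  have "(\<integral>w. (\<integral>z. (Y j w z)\<^sup>2 \<partial>M) \<partial>P j) = (\<integral>z. (\<integral>w. (Y j w z)\<^sup>2 \<partial>P j) \<partial>M)"
    using MP.integral_fst[OF i2] MP.integral_snd[OF i2] by simp
  also have "\<dots> = (\<integral>z. real j \<partial>M)"
    by (intro Bochner_Integration.integral_cong Y_moments refl)
  finally show "(\<integral>w. (\<integral>z. (Y j w z)\<^sup>2 \<partial>M) \<partial>P j) = j" by (simp add: prob_space)
  have "(\<integral>w. (\<integral>z. Y j w z ^ 4 \<partial>M) \<partial>P j) = (\<integral>z. (\<integral>w. Y j w z ^ 4 \<partial>P j) \<partial>M)"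
    using MP.integral_fst[OF i4] MP.integral_snd[OF i4] by simp
  also have "\<dots> \<le> (\<integral>z. j * C + 3 * (real j)\<^sup>2 \<partial>M)"
    using MP.integrable_fst[OF i4] by (intro integral_mono Y_moments) auto
  finally show "(\<integral>w. (\<integral>z. Y j w z ^ 4 \<partial>M) \<partial>P j) \<le> j * C + 3 * (real j)\<^sup>2"
    by (simp add: prob_space)
qed

text \<open>The opposite conditioning: the sample is fixed and the new point is random. The squares
  contribute exactly 1 each and the products of distinct terms add up to \<open>R\<close>. The
  fourth moment is only shown to be finite; its size is controlled after averaging over the
  sample.\<close>

lemma Y_cond_moments:
  assumes w: "w \<in> space (P j)"
  shows "Y j w \<in> borel_measurable M"
    and "integrable M (\<lambda>z. Y j w z ^ 4)"
    and "expectation (Y j w) = 0"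
    and "expectation (\<lambda>z. (Y j w z)\<^sup>2) = j + 2 * R j w"
proof -
  have wi: "w i \<in> space M" if "i < j" for i using in_space_P[OF w that] .
  have ki [measurable]: "k (w i) \<in> borel_measurable M" if "i < j" for i using wi[OF that] by measurable
  show Ym: "Y j w \<in> borel_measurable M"
    unfolding Y_def using ki by (intro borel_measurable_sum) auto
  show "expectation (Y j w) = 0"
    unfolding Y_def using k_int[of _ 1] wi k_mean
    by (subst Bochner_Integration.integral_sum) auto
  have "expectation (\<lambda>z. (Y j w z)\<^sup>2) =
      expectation (\<lambda>z. (\<Sum>i<j. (k (w i) z)\<^sup>2) + 2 * (\<Sum>i'<j. \<Sum>i<i'. k (w i) z * k (w i') z))"
    unfolding Y_def square_of_sum_lessThan ..
  also have "\<dots> = expectation (\<lambda>z. \<Sum>i<j. (k (w i) z)\<^sup>2)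
      + 2 * expectation (\<lambda>z. \<Sum>i'<j. \<Sum>i<i'. k (w i) z * k (w i') z)"
    using k_int[of _ 2] wi
    by (subst Bochner_Integration.integral_add) (auto intro!: Bochner_Integration.integrable_sum k_mult_int)
  also have "expectation (\<lambda>z. \<Sum>i<j. (k (w i) z)\<^sup>2) = (\<Sum>i<j. 1)"
    using k_int[of _ 2] wi by (subst Bochner_Integration.integral_sum) (auto simp: k_var)
  also have "expectation (\<lambda>z. \<Sum>i'<j. \<Sum>i<i'. k (w i) z * k (w i') z) = R j w"
    unfolding R_def G_def using wi
    by (subst Bochner_Integration.integral_sum,
        auto intro!: Bochner_Integration.integrable_sum k_mult_int sum.cong Bochner_Integration.integral_sum)
  finally show "expectation (\<lambda>z. (Y j w z)\<^sup>2) = j + 2 * R j w" by simp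
  show "integrable M (\<lambda>z. Y j w z ^ 4)"
  proof -
    have "integrable M (\<lambda>z. (\<Sum>i<m. k (w i) z) ^ 4)" if "m \<le> j" for m
      using that
    proof (induction m)
      case (Suc m)
      have km [measurable]: "i < Suc m \<Longrightarrow> k (w i) \<in> borel_measurable M" for i
        using ki Suc.prems by auto
      show ?case
      proof (rule Bochner_Integration.integrable_bound)
        show "integrable M (\<lambda>z. 8 * (\<Sum>i<m. k (w i) z) ^ 4 + 8 * k (w m) z ^ 4)"
          using Suc k_int4 wi by auto
        \<comment> \<open>Two applications of (a + b)^2 \<le> 2 (a^2 + b^2).\<close>
        have "(a + b) ^ 4 \<le> 8 * a ^ 4 + 8 * b ^ 4" for a b :: real
        proof -
          have "(a + b)\<^sup>2 \<le> 2 * (a\<^sup>2 + b\<^sup>2)" using sum_squares_bound[of a b] by (simp add: power2_sum)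
          then have "((a + b)\<^sup>2)\<^sup>2 \<le> (2 * (a\<^sup>2 + b\<^sup>2))\<^sup>2" by (intro power_mono) auto
          also have "\<dots> \<le> 4 * (2 * ((a\<^sup>2)\<^sup>2 + (b\<^sup>2)\<^sup>2))"
            using sum_squares_bound[of "a\<^sup>2" "b\<^sup>2"] by (simp add: power2_sum power_mult_distrib)
          finally show ?thesis by simp
        qed
        then show "AE z in M. norm ((\<Sum>i<Suc m. k (w i) z) ^ 4) \<le>
            norm (8 * (\<Sum>i<m. k (w i) z) ^ 4 + 8 * k (w m) z ^ 4)"
          by (intro AE_I2) auto
        show "(\<lambda>z. (\<Sum>i<Suc m. k (w i) z) ^ 4) \<in> borel_measurable M"
          using km by (intro borel_measurable_power borel_measurable_sum) auto
      qed
    qed simp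
    then show ?thesis by (simp add: Y_def)
  qed
qed

text \<open>The left side is the shape of the Taylor remainder of a characteristic function. With a
  = |s y|, expanding (e a - a^2)^2 \<ge> 0 gives 2 a^3 \<le> e a^2 + a^4 / e, so that only second
  and fourth moments remain; e is chosen later to balance the two.\<close>

lemma min_cubic_le:
  fixes e s y :: real
  assumes "e > 0"
  shows "s\<^sup>2 * min (6 * y\<^sup>2) (\<bar>s\<bar> * \<bar>y\<bar> ^ 3) \<le> (e * s\<^sup>2 * y\<^sup>2 + s ^ 4 * y ^ 4 / e) / 2"
proof -
  define a where "a = \<bar>s * y\<bar>"
  have "0 \<le> (e * a - a\<^sup>2)\<^sup>2" by simp
  then have "2 * e * a ^ 3 \<le> e\<^sup>2 * a\<^sup>2 + a ^ 4"
    by (simp add: power2_eq_square power3_eq_cube power4_eq_xxxx algebra_simps)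
  then have "a ^ 3 \<le> (e * a\<^sup>2 + a ^ 4 / e) / 2"
    using assms by (simp add: field_simps power2_eq_square)
  moreover have "s\<^sup>2 * min (6 * y\<^sup>2) (\<bar>s\<bar> * \<bar>y\<bar> ^ 3) \<le> s\<^sup>2 * (\<bar>s\<bar> * \<bar>y\<bar> ^ 3)"
    by (intro mult_left_mono) auto
  moreover have "s\<^sup>2 * (\<bar>s\<bar> * \<bar>y\<bar> ^ 3) = a ^ 3"
    unfolding a_def abs_mult power_mult_distrib by (simp add: power2_eq_square power3_eq_cube)
  moreover have "a\<^sup>2 = s\<^sup>2 * y\<^sup>2" "a ^ 4 = s ^ 4 * y ^ 4"
    by (simp_all add: a_def power_mult_distrib)
  ultimately show ?thesis by (simp add: mult.assoc)
qed

text \<open>Three replacements, one per error: the characteristic function of a centred variable by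
  its second-order Taylor polynomial, the conditional variance j + 2 \<open>R\<close> by j, and 1 -
  x by exp (- x) for x = s^2 j / 2. The denominator 12 joins the 6 of the Taylor remainder with the
  2 of \<open>min_cubic_le\<close>.\<close>

lemma cond_char_approx:
  assumes w: "w \<in> space (P j)" and e: "e > 0"
  shows "cmod ((\<integral>z. iexp (s * Y j w z) \<partial>M) - of_real (exp (- (s\<^sup>2 * j / 2)))) \<le>
    s\<^sup>2 * \<bar>R j w\<bar> + (e * s\<^sup>2 * (\<integral>z. (Y j w z)\<^sup>2 \<partial>M) + s ^ 4 / e * (\<integral>z. Y j w z ^ 4 \<partial>M)) / 12
      + (s\<^sup>2 * j / 2)\<^sup>2 / 2"
proof -
  note m = Y_cond_moments[OF w]
  note [measurable] = m(1)
  have ip: "integrable M (\<lambda>z. Y j w z ^ p)" if "p \<le> 4" for p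
    by (rule integrable_power_le_4[OF m(1,2) that])
  define D where "D = distr M borel (Y j w)"
  interpret D: real_distribution D unfolding D_def by (rule real_distribution_distr) fact
  have mean: "(\<integral>x. x \<partial>D) = 0" unfolding D_def by (subst integral_distr) (auto simp: m)
  have 1: "integrable D (\<lambda>x. x)" unfolding D_def using ip[of 1] by (subst integrable_distr_eq) auto
  have 2: "integrable D (\<lambda>x. x\<^sup>2)" unfolding D_def using ip[of 2] by (subst integrable_distr_eq) auto
  have var: "D.variance (\<lambda>x. x) = j + 2 * R j w"
    unfolding mean using m(4) unfolding D_def by (subst integral_distr) auto
  have chr: "char D s = (\<integral>z. iexp (s * Y j w z) \<partial>M)"
    unfolding char_def D_def by (subst integral_distr) auto
  have "cmod (char D s - (1 - s\<^sup>2 * (j + 2 * R j w) / 2)) \<le>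
      (s\<^sup>2 / 6) * D.expectation (\<lambda>x. min (6 * x\<^sup>2) (\<bar>s\<bar> * \<bar>x\<bar> ^ 3))"
    using D.char_approx3[OF 1 mean 2 var, of s] by simp
  also have "\<dots> = (1 / 6) * D.expectation (\<lambda>x. s\<^sup>2 * min (6 * x\<^sup>2) (\<bar>s\<bar> * \<bar>x\<bar> ^ 3))"
    by simp
  also have "\<dots> = (1 / 6) * expectation (\<lambda>z. s\<^sup>2 * min (6 * (Y j w z)\<^sup>2) (\<bar>s\<bar> * \<bar>Y j w z\<bar> ^ 3))"
    unfolding D_def by (subst integral_distr) auto
  also have "\<dots> \<le> (1 / 6) * expectation (\<lambda>z. (e * s\<^sup>2 * (Y j w z)\<^sup>2 + s ^ 4 * Y j w z ^ 4 / e) / 2)"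
  proof (intro mult_left_mono integral_mono min_cubic_le e)
    show i: "integrable M (\<lambda>z. (e * s\<^sup>2 * (Y j w z)\<^sup>2 + s ^ 4 * Y j w z ^ 4 / e) / 2)"
      using ip[of 2] ip[of 4] by auto
    show "integrable M (\<lambda>z. s\<^sup>2 * min (6 * (Y j w z)\<^sup>2) (\<bar>s\<bar> * \<bar>Y j w z\<bar> ^ 3))"
    proof (rule Bochner_Integration.integrable_bound[OF i])
      show "AE z in M. norm (s\<^sup>2 * min (6 * (Y j w z)\<^sup>2) (\<bar>s\<bar> * \<bar>Y j w z\<bar> ^ 3)) \<le>
          norm ((e * s\<^sup>2 * (Y j w z)\<^sup>2 + s ^ 4 * Y j w z ^ 4 / e) / 2)"
        by (intro AE_I2) (use min_cubic_le[OF e] in \<open>auto intro!: order_trans[OF _ abs_ge_self]\<close>)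
    qed measurable
  qed auto
  also have "\<dots> = (e * s\<^sup>2 * (\<integral>z. (Y j w z)\<^sup>2 \<partial>M) + s ^ 4 / e * (\<integral>z. Y j w z ^ 4 \<partial>M)) / 12"
    using ip[of 2] ip[of 4] by simp
  finally have A: "cmod (char D s - of_real (1 - s\<^sup>2 * (j + 2 * R j w) / 2)) \<le> \<dots>" by simp
  have "\<bar>(1 - s\<^sup>2 * (j + 2 * R j w) / 2) - (1 - s\<^sup>2 * j / 2)\<bar> = \<bar>- (s\<^sup>2 * R j w)\<bar>"
    by (intro arg_cong[of _ _ abs]) (simp add: field_simps)
  then have B: "cmod (of_real (1 - s\<^sup>2 * (j + 2 * R j w) / 2) - of_real (1 - s\<^sup>2 * j / 2)) \<le> s\<^sup>2 * \<bar>R j w\<bar>"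
    unfolding of_real_diff[symmetric] norm_of_real by (simp add: abs_mult)
  have Cc: "cmod (of_real (1 - s\<^sup>2 * j / 2) - of_real (exp (- (s\<^sup>2 * j / 2)))) \<le> (s\<^sup>2 * j / 2)\<^sup>2 / 2"
  proof -
    define x where "x = s\<^sup>2 * j / 2"
    have x0: "x \<ge> 0" by (simp add: x_def)
    have "exp (- x) \<ge> 1 - x" using exp_ge_add_one_self[of "-x"] by simp
    moreover have "exp (- x) \<le> 1 - x + x\<^sup>2 / 2"
    proof -
      show ?thesis
      proof (cases "x = 0")
        case False
        \<comment> \<open>Taylor's formula with second-order remainder at an intermediate t < 0,
          where exp t \<le> 1.\<close>
        obtain t where t: "-x < t" "t < 0"
            "exp (- x) = (\<Sum>m<2. exp 0 / fact m * (- x) ^ m) + exp t / fact 2 * (- x) ^ 2"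
          using Maclaurin_minus[of "-x" 2 "\<lambda>_. exp" exp] False x0 by (auto simp: DERIV_exp)
        have "exp t \<le> 1" using t by simp
        then have "exp t / fact 2 * (- x) ^ 2 \<le> 1 / fact 2 * (- x) ^ 2"
          by (intro mult_right_mono divide_right_mono) auto
        with t show ?thesis by (simp add: numeral_2_eq_2)
      qed simp
    qed
    ultimately have "\<bar>(1 - x) - exp (- x)\<bar> \<le> x\<^sup>2 / 2" by simp
    then show ?thesis unfolding x_def of_real_diff[symmetric] norm_of_real .
  qed
  have tri: "cmod (a - d) \<le> cmod (a - b) + cmod (b - c) + cmod (c - d)" for a b c d :: complex
    using norm_triangle_ineq[of "a - b" "b - c"] norm_triangle_ineq[of "a - c" "c - d"] by simp
  have "cmod (char D s - of_real (exp (- (s\<^sup>2 * j / 2)))) \<le> 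
      cmod (char D s - of_real (1 - s\<^sup>2 * (j + 2 * R j w) / 2))
      + cmod (of_real (1 - s\<^sup>2 * (j + 2 * R j w) / 2) - of_real (1 - s\<^sup>2 * j / 2))
      + cmod (of_real (1 - s\<^sup>2 * j / 2) - of_real (exp (- (s\<^sup>2 * j / 2))))"
    by (rule tri)
  also have "\<dots> \<le> (e * s\<^sup>2 * (\<integral>z. (Y j w z)\<^sup>2 \<partial>M) + s ^ 4 / e * (\<integral>z. Y j w z ^ 4 \<partial>M)) / 12
      + s\<^sup>2 * \<bar>R j w\<bar> + (s\<^sup>2 * j / 2)\<^sup>2 / 2"
    by (intro add_mono A B Cc)
  finally show ?thesis unfolding chr by simp
qed

text \<open>The phase of the first j points has modulus 1 and does not involve the new point.
  Integrating the new point out therefore leaves the conditional characteristic function as a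
  factor, and its distance from a constant is averaged over the sample.\<close>

lemma phi_step:
  assumes e: "e > 0"
  shows "cmod (phi s (Suc j) - of_real (exp (- (s\<^sup>2 * j / 2))) * phi s j) \<le>
    s\<^sup>2 * (j * \<delta>) + (e * s\<^sup>2 * j + s ^ 4 / e * (j * C + 3 * (real j)\<^sup>2)) / 12 + (s\<^sup>2 * j / 2)\<^sup>2 / 2"
proof -
  interpret P: prob_space "P j" by (intro prob_space_PiM) unfold_locales
  interpret MP: pair_prob_space M "P j" ..
  note R_meas[measurable]
  define A where "A = (\<lambda>w. \<integral>z. iexp (s * Y j w z) \<partial>M)"
  define a where "a = complex_of_real (exp (- (s\<^sup>2 * j / 2)))"
  have iF: "integrable (M \<Otimes>\<^sub>M P j) (\<lambda>(z, w). iexp (s * F j w) * iexp (s * Y j w z))"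
    by (rule MP.integrable_const_bound[where B=1]) (auto simp: norm_mult)
  have i1: "integrable (P j) (\<lambda>w. iexp (s * F j w))"
    by (rule P.integrable_const_bound[where B=1]) auto
  have iA: "integrable (P j) (\<lambda>w. iexp (s * F j w) * A w)"
    using MP.integrable_snd[OF iF] by (simp add: A_def)
  have "phi s (Suc j) = (\<integral>p. (case p of (z, w) \<Rightarrow> iexp (s * F j w) * iexp (s * Y j w z)) \<partial>(M \<Otimes>\<^sub>M P j))"
    unfolding phi_def
    by (subst integral_PiM_Suc) (auto simp: F_upd distrib_left exp_add[symmetric])
  also have "\<dots> = (\<integral>w. iexp (s * F j w) * A w \<partial>P j)"
    using MP.integral_snd[OF iF] by (simp add: A_def)
  finally have "phi s (Suc j) - a * phi s j = (\<integral>w. iexp (s * F j w) * A w \<partial>P j) - (\<integral>w. iexp (s * F j w) * a \<partial>P j)"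
    unfolding phi_def by (simp add: mult.commute)
  also have "\<dots> = (\<integral>w. iexp (s * F j w) * (A w - a) \<partial>P j)"
    using i1 iA unfolding right_diff_distrib by (subst Bochner_Integration.integral_diff) auto
  finally have "phi s (Suc j) - a * phi s j = \<dots>" .
  then have "cmod (phi s (Suc j) - a * phi s j) \<le> (\<integral>w. cmod (iexp (s * F j w) * (A w - a)) \<partial>P j)"
    by (simp only: integral_norm_bound)
  also have "\<dots> \<le> (\<integral>w. s\<^sup>2 * \<bar>R j w\<bar> + (e * s\<^sup>2 * (\<integral>z. (Y j w z)\<^sup>2 \<partial>M) + s ^ 4 / e * (\<integral>z. Y j w z ^ 4 \<partial>M)) / 12
      + (s\<^sup>2 * j / 2)\<^sup>2 / 2 \<partial>P j)"
  proof (rule integral_mono)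
    have "integrable (P j) (\<lambda>w. iexp (s * F j w) * A w - iexp (s * F j w) * a)"
      using i1 iA by simp
    then show "integrable (P j) (\<lambda>w. cmod (iexp (s * F j w) * (A w - a)))"
      by (intro integrable_norm) (simp add: right_diff_distrib)
    have "integrable (P j) (R j)"
      by (rule P.integrable_const_bound[where B="(real j)\<^sup>2"]) (auto simp: abs_R_le intro!: AE_I2)
    moreover have "integrable (P j) (\<lambda>w. \<integral>z. (Y j w z)\<^sup>2 \<partial>M)"
      using MP.integrable_snd[OF Y_pair_moments(1)[of 2]] by simp
    moreover have "integrable (P j) (\<lambda>w. \<integral>z. Y j w z ^ 4 \<partial>M)"
      using MP.integrable_snd[OF Y_pair_moments(1)[of 4]] by simp
    ultimately show "integrable (P j) (\<lambda>w. s\<^sup>2 * \<bar>R j w\<bar> + (e * s\<^sup>2 * (\<integral>z. (Y j w z)\<^sup>2 \<partial>M) + s ^ 4 / e * (\<integral>z. Y j w z ^ 4 \<partial>M)) / 12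
      + (s\<^sup>2 * j / 2)\<^sup>2 / 2)"
      by (intro Bochner_Integration.integrable_add integrable_mult_right integrable_divide) auto
    show "cmod (iexp (s * F j w) * (A w - a)) \<le> s\<^sup>2 * \<bar>R j w\<bar> + (e * s\<^sup>2 * (\<integral>z. (Y j w z)\<^sup>2 \<partial>M)
      + s ^ 4 / e * (\<integral>z. Y j w z ^ 4 \<partial>M)) / 12 + (s\<^sup>2 * j / 2)\<^sup>2 / 2"
      if "w \<in> space (P j)" for w
      using cond_char_approx[OF that e, of s] by (simp add: norm_mult A_def a_def)
  qed
  also have "\<dots> = s\<^sup>2 * (\<integral>w. \<bar>R j w\<bar> \<partial>P j) + (e * s\<^sup>2 * (\<integral>w. (\<integral>z. (Y j w z)\<^sup>2 \<partial>M) \<partial>P j)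
      + s ^ 4 / e * (\<integral>w. (\<integral>z. Y j w z ^ 4 \<partial>M) \<partial>P j)) / 12 + (s\<^sup>2 * j / 2)\<^sup>2 / 2"
  proof -
    have 1: "integrable (P j) (\<lambda>w. s\<^sup>2 * \<bar>R j w\<bar>)"
      by (rule P.integrable_const_bound[where B="s\<^sup>2 * (real j)\<^sup>2"])
         (auto simp: abs_R_le abs_mult intro!: AE_I2 mult_left_mono)
    have 2: "integrable (P j) (\<lambda>w. e * s\<^sup>2 * (\<integral>z. (Y j w z)\<^sup>2 \<partial>M))"
      using MP.integrable_snd[OF Y_pair_moments(1)[of 2]] by simp
    have 3: "integrable (P j) (\<lambda>w. s ^ 4 / e * (\<integral>z. Y j w z ^ 4 \<partial>M))"
      using MP.integrable_snd[OF Y_pair_moments(1)[of 4]] by simp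
    have 4: "integrable (P j) (\<lambda>w. (e * s\<^sup>2 * (\<integral>z. (Y j w z)\<^sup>2 \<partial>M) + s ^ 4 / e * (\<integral>z. Y j w z ^ 4 \<partial>M)) / 12)"
      using Bochner_Integration.integrable_add[OF 2 3] by (rule integrable_divide)
    show ?thesis
      unfolding Bochner_Integration.integral_add[OF Bochner_Integration.integrable_add[OF 1 4] P.integrable_const]
        Bochner_Integration.integral_add[OF 1 4]
      by (simp add: Bochner_Integration.integral_add[OF 2 3] P.prob_space del: times_divide_eq_left)
  qed
  also have "\<dots> \<le> s\<^sup>2 * (j * \<delta>) + (e * s\<^sup>2 * j + s ^ 4 / e * (j * C + 3 * (real j)\<^sup>2)) / 12 + (s\<^sup>2 * j / 2)\<^sup>2 / 2"
    unfolding Y_pair_moments(2) using e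
    by (intro add_mono mult_left_mono divide_right_mono R_first_moment Y_pair_moments(3) order_refl) auto
  finally show ?thesis unfolding a_def .
qed

text \<open>The factors exp (- s^2 j / 2) are at most 1, so earlier errors do not grow; their
  product over j < m has the exponent - s^2 m (m - 1) / 4.\<close>

lemma phi_telescope:
  assumes "\<And>j. j < n \<Longrightarrow> cmod (phi s (Suc j) - of_real (exp (- (s\<^sup>2 * j / 2))) * phi s j) \<le> b" "m \<le> n"
  shows "cmod (phi s m - of_real (exp (- (s\<^sup>2 * (real m * (real m - 1)) / 4)))) \<le> m * b"
  using assms(2)
proof (induction m)
  case 0
  interpret P: prob_space "P 0" by (intro prob_space_PiM) unfold_locales
  show ?case using P.prob_space by (simp add: phi_def F_def)
next
  case (Suc m)
  let ?a = "complex_of_real (exp (- (s\<^sup>2 * m / 2)))"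
  let ?E = "\<lambda>m. complex_of_real (exp (- (s\<^sup>2 * (real m * (real m - 1)) / 4)))"
  have E: "?E (Suc m) = ?a * ?E m"
    unfolding of_real_mult[symmetric] exp_add[symmetric]
    by (intro arg_cong[of _ _ "\<lambda>x. complex_of_real (exp x)"]) (simp add: field_simps)
  have "phi s (Suc m) - ?E (Suc m) = (phi s (Suc m) - ?a * phi s m) + ?a * (phi s m - ?E m)"
    unfolding E by (simp add: algebra_simps)
  then have "cmod (phi s (Suc m) - ?E (Suc m)) \<le> cmod (phi s (Suc m) - ?a * phi s m) + cmod (?a * (phi s m - ?E m))"
    by (simp only: norm_triangle_ineq)
  also have "cmod (phi s (Suc m) - ?a * phi s m) \<le> b" using Suc.prems by (intro assms(1)) simp
  also have "cmod (?a * (phi s m - ?E m)) \<le> 1 * (m * b)"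
    unfolding norm_mult using Suc by (intro mult_mono) auto
  finally show ?case by (simp add: algebra_simps)
qed

text \<open>The n (n - 1) / 2 pairs are uncorrelated with unit variance, so the factor sqrt 2 / n
  produces variance 1 - 1 / n, which is the variance seen in the Gaussian term.\<close>

theorem char_degenerate_U_statistic:
  assumes n: "n \<ge> 1"
  shows "cmod ((\<integral>w. iexp (t * (sqrt 2 / n * (\<Sum>i'<n. \<Sum>i<i'. k (w i) (w i')))) \<partial>P n)
      - of_real (exp (- (t\<^sup>2 * (1 - 1 / n) / 2)))) \<le>
    2 * t\<^sup>2 * \<delta> + (t\<^sup>2 + 2 * t ^ 4 * (C + 3)) / (6 * sqrt n) + t ^ 4 / (2 * real n)"
proof -
  define s where "s = t * sqrt 2 / n"
  \<comment> \<open>This choice balances the two halves of the Taylor bound: summed over n steps,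
    both are of order n^(-1/2).\<close>
  define e where "e = 1 / sqrt n"
  have e: "e > 0" using n by (simp add: e_def)
  have s2: "s\<^sup>2 = 2 * t\<^sup>2 / (real n)\<^sup>2" by (simp add: s_def power_divide power_mult_distrib)
  have s4: "s ^ 4 = 4 * t ^ 4 / real n ^ 4"
  proof -
    have "s ^ 4 = (s\<^sup>2)\<^sup>2" by simp
    then show ?thesis unfolding s2 by (simp add: power_divide power_mult_distrib)
  qed
  \<comment> \<open>A step bound uniform in j < n. The term j C is enlarged to n^2 C so that it
    merges with 3 n^2 into n^2 (C + 3).\<close>
  define b where "b = s\<^sup>2 * (n * \<delta>) + (e * s\<^sup>2 * n + s ^ 4 / e * (real n * real n * C + 3 * (real n)\<^sup>2)) / 12 + (s\<^sup>2 * n / 2)\<^sup>2 / 2"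
  have "cmod (phi s (Suc j) - of_real (exp (- (s\<^sup>2 * j / 2))) * phi s j) \<le> b" if "j < n" for j
  proof -
    have "real j \<le> real n * real n"
      using that n by (metis less_imp_le_nat le_trans mult_le_mono2 mult.right_neutral of_nat_le_iff of_nat_mult)
    then show ?thesis
      unfolding b_def
      by (intro order_trans[OF phi_step[OF e]] order_refl add_mono divide_right_mono mult_mono power_mono)
         (use that e C_nonneg delta_nonneg in auto)
  qed
  from phi_telescope[OF this order_refl]
  have "cmod (phi s n - of_real (exp (- (s\<^sup>2 * (real n * (real n - 1)) / 4)))) \<le> n * b" .
  also have "s\<^sup>2 * (real n * (real n - 1)) / 4 = t\<^sup>2 * (1 - 1 / n) / 2"
    unfolding s2 using n by (simp add: field_simps power2_eq_square)
  also have "n * b = 2 * t\<^sup>2 * \<delta> + (t\<^sup>2 + 2 * t ^ 4 * (C + 3)) / (6 * sqrt n) + t ^ 4 / (2 * real n)"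
  proof -
    define r where "r = sqrt n"
    have r: "r > 0" "real n = r\<^sup>2" using n by (auto simp: r_def)
    show ?thesis
      unfolding b_def s2 s4 e_def r_def[symmetric] unfolding r(2) using r(1)
      by (simp add: field_simps power2_eq_square power4_eq_xxxx)
  qed
  finally show ?thesis
    by (simp add: phi_def F_def s_def mult.assoc)
qed

end

section \<open>Gegenbauer polynomials\<close>

text \<open>The recurrence of \<open>gegenbauer\<close> for formal polynomials, which makes degrees,
  leading coefficients and formal derivatives available.\<close>

fun geg_poly :: "real \<Rightarrow> nat \<Rightarrow> real poly" where
  "geg_poly l 0 = 1"
| "geg_poly l (Suc 0) = [:0, 2 * l:]"
| "geg_poly l (Suc (Suc n)) = smult (1 / (real n + 2))
     (smult (2 * (real n + 1 + l)) ([:0, 1:] * geg_poly l (Suc n)) - smult (real n + 2 * l) (geg_poly l n))"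

lemma poly_geg_poly: "poly (geg_poly l k) x = gegenbauer k l x"
  by (induction k l x rule: gegenbauer.induct) (auto simp: field_simps)

section \<open>Recurrences, derivatives and the differential equation\<close>

lemma geg_poly_rec:
  "smult (2 * (real n + 1 + l)) ([:0, 1:] * geg_poly l (Suc n)) =
     smult (real n + 2) (geg_poly l (Suc (Suc n))) + smult (real n + 2 * l) (geg_poly l n)"
  by (simp add: smult_diff_right)

declare geg_poly.simps(3) [simp del]

lemma poly_geg_rec:
  "(real n + 2) * poly (geg_poly l (Suc (Suc n))) x =
     2 * (real n + 1 + l) * x * poly (geg_poly l (Suc n)) x - (real n + 2 * l) * poly (geg_poly l n) x"
  using arg_cong[OF geg_poly_rec, of "\<lambda>p. poly p x" n l] by (simp del: geg_poly.simps add: algebra_simps)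

lemma poly_geg_deriv_rec:
  "(real n + 2) * poly (pderiv (geg_poly l (Suc (Suc n)))) x =
     2 * (real n + 1 + l) * (poly (geg_poly l (Suc n)) x + x * poly (pderiv (geg_poly l (Suc n))) x)
     - (real n + 2 * l) * poly (pderiv (geg_poly l n)) x"
  using arg_cong[OF geg_poly_rec, of "\<lambda>p. poly (pderiv p) x" n l]
  by (simp del: geg_poly.simps add: pderiv_add pderiv_smult pderiv_diff pderiv_mult pderiv_pCons algebra_simps)

text \<open>Two relations between consecutive polynomials that support each other: the
  differentiated recurrence and the second relation yield the first at the next index, and this
  yields the second there with the help of the recurrence.\<close>

lemma geg_deriv_identities:
  "poly (pderiv (geg_poly l (Suc k))) x = x * poly (pderiv (geg_poly l k)) x + (real k + 2 * l) * poly (geg_poly l k) x \<and>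
   x * poly (pderiv (geg_poly l (Suc k))) x = poly (pderiv (geg_poly l k)) x + (real k + 1) * poly (geg_poly l (Suc k)) x"
proof (induction k)
  case 0
  show ?case by (simp add: pderiv_pCons)
next
  case (Suc k)
  define c0 c1 c2 where "c0 = poly (geg_poly l k) x" "c1 = poly (geg_poly l (Suc k)) x"
    "c2 = poly (geg_poly l (Suc (Suc k))) x"
  define p0 p1 p2 where "p0 = poly (pderiv (geg_poly l k)) x" "p1 = poly (pderiv (geg_poly l (Suc k))) x"
    "p2 = poly (pderiv (geg_poly l (Suc (Suc k)))) x"
  note defs = c0_c1_c2_def p0_p1_p2_def
  define K where "K = real k"
  have K: "K + 2 \<noteq> 0" by (simp add: K_def add_pos_pos less_imp_neq[symmetric])
  have Q: "p1 = x * p0 + (K + 2 * l) * c0" and PP: "x * p1 = p0 + (K + 1) * c1"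
    using Suc unfolding defs K_def by auto
  have r: "(K + 2) * c2 = 2 * (K + 1 + l) * x * c1 - (K + 2 * l) * c0"
    using poly_geg_rec[of k l x] unfolding defs K_def .
  have r': "(K + 2) * p2 = 2 * (K + 1 + l) * (c1 + x * p1) - (K + 2 * l) * p0"
    using poly_geg_deriv_rec[of k l x] unfolding defs K_def .
  have "(K + 2) * p2 = (K + 2) * (x * p1 + (K + 1 + 2 * l) * c1)"
    using r' PP by algebra
  then have Q': "p2 = x * p1 + (K + 1 + 2 * l) * c1" using K by simp
  have "x * p2 = p1 + (K + 2) * c2"
    using r PP Q Q' by algebra
  with Q' show ?case unfolding defs K_def by (simp only: of_nat_Suc) (simp add: algebra_simps)
qed

text \<open>The derivative of C_k is eliminated between the two relations.\<close>

lemma geg_deriv_formula: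
  "(1 - x\<^sup>2) * poly (pderiv (geg_poly l (Suc k))) x =
     (real k + 2 * l) * poly (geg_poly l k) x - (real k + 1) * x * poly (geg_poly l (Suc k)) x"
  using geg_deriv_identities[of l k x] by algebra

text \<open>\<open>geg_deriv_formula\<close> is differentiated as an identity of polynomials, and
  the derivative of C_(k-1) is then removed by the second relation of
  \<open>geg_deriv_identities\<close>.\<close>

lemma geg_ode:
  "(1 - x\<^sup>2) * poly (pderiv (pderiv (geg_poly l k))) x - (1 + 2 * l) * x * poly (pderiv (geg_poly l k)) x =
     - (real k * (real k + 2 * l) * poly (geg_poly l k) x)"
proof (cases k)
  case (Suc m)
  let ?g = "geg_poly l (Suc m)"
  have "[:1, 0, -1:] * pderiv ?g = smult (real m + 2 * l) (geg_poly l m) - smult (real m + 1) ([:0, 1:] * ?g)"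
  proof -
    have "poly ([:1, 0, -1:] * pderiv ?g) = poly (smult (real m + 2 * l) (geg_poly l m) - smult (real m + 1) ([:0, 1:] * ?g))"
    proof
      fix x
      show "poly ([:1, 0, -1:] * pderiv ?g) x = poly (smult (real m + 2 * l) (geg_poly l m) - smult (real m + 1) ([:0, 1:] * ?g)) x"
        using geg_deriv_formula[of x l m] by (simp add: algebra_simps power2_eq_square)
    qed
    then show ?thesis by (simp only: poly_eq_poly_eq_iff)
  qed
  then have "poly (pderiv ([:1, 0, -1:] * pderiv ?g)) x =
      poly (pderiv (smult (real m + 2 * l) (geg_poly l m) - smult (real m + 1) ([:0, 1:] * ?g))) x"
    by simp
  then have "- 2 * x * poly (pderiv ?g) x + (1 - x\<^sup>2) * poly (pderiv (pderiv ?g)) x =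
      (real m + 2 * l) * poly (pderiv (geg_poly l m)) x - (real m + 1) * (poly ?g x + x * poly (pderiv ?g) x)"
    by (simp add: pderiv_smult pderiv_diff pderiv_add pderiv_minus pderiv_mult pderiv_pCons algebra_simps power2_eq_square)
  moreover have "poly (pderiv (geg_poly l m)) x = x * poly (pderiv ?g) x - (real m + 1) * poly ?g x"
    using conjunct2[OF geg_deriv_identities[of l m x]] by linarith
  ultimately have "(1 - x\<^sup>2) * poly (pderiv (pderiv ?g)) x - (1 + 2 * l) * x * poly (pderiv ?g) x =
     - ((real m + 1) * ((real m + 1) + 2 * l) * poly ?g x)"
    by algebra
  then show ?thesis unfolding Suc by (simp only: of_nat_Suc add.commute)
qed (simp add: pderiv_1)

lemma geg_poly_at_1_Suc:
  "(real k + 1) * poly (geg_poly l (Suc k)) 1 = (real k + 2 * l) * poly (geg_poly l k) 1"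
  using geg_deriv_formula[of 1 l k] by simp

text \<open>A positive coefficient at k makes the degree exactly k; later it serves to cancel the
  leading term of an arbitrary polynomial.\<close>

lemma degree_geg_poly:
  assumes "l > 0"
  shows "degree (geg_poly l k) \<le> k \<and> coeff (geg_poly l k) k > 0"
  using assms
proof (induction l k rule: geg_poly.induct)
  case (3 l n)
  have deg: "degree ([:0, 1:] * geg_poly l (Suc n)) \<le> Suc (Suc n)"
    using 3 degree_mult_le[of "[:0, 1:]" "geg_poly l (Suc n)"] by auto
  have "degree (geg_poly l (Suc (Suc n))) \<le> Suc (Suc n)"
    unfolding geg_poly.simps
    by (intro order_trans[OF degree_smult_le] degree_diff_le deg) (use 3 in auto)
  moreover have "coeff (geg_poly l n) (Suc (Suc n)) = 0"
    using 3 by (intro coeff_eq_0) auto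
  then have "2 * (real n + 1 + l) * coeff (geg_poly l (Suc n)) (Suc n) = (real n + 2) * coeff (geg_poly l (Suc (Suc n))) (Suc (Suc n))"
    using arg_cong[OF geg_poly_rec, of "\<lambda>p. coeff p (Suc (Suc n))" n l] by (simp del: geg_poly.simps)
  moreover have "0 < 2 * (real n + 1 + l) * coeff (geg_poly l (Suc n)) (Suc n)"
    using 3 by (intro mult_pos_pos add_nonneg_pos) auto
  ultimately have "0 < (real n + 2) * coeff (geg_poly l (Suc (Suc n))) (Suc (Suc n))" by simp
  then have "0 < coeff (geg_poly l (Suc (Suc n))) (Suc (Suc n))"
    by (simp add: zero_less_mult_iff del: geg_poly.simps)
  with \<open>degree (geg_poly l (Suc (Suc n))) \<le> Suc (Suc n)\<close> show ?case by blast
qed auto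

text \<open>The weight is continuous on the closed interval for \<open>d \<ge> 3\<close>; smaller \<open>d\<close> need not be treated, as \<open>d\<close> tends to
  infinity in the theorem.\<close>

definition geg_mass :: "nat \<Rightarrow> real" where
  "geg_mass d = (\<integral>x. indicator {-1..1} x * geg_weight d x \<partial>lborel)"

definition geg_measure :: "nat \<Rightarrow> real measure" where
  "geg_measure d = density lborel (\<lambda>x. ennreal (indicator {-1..1} x * geg_weight d x / geg_mass d))"

lemma geg_weight_nonneg: "0 \<le> geg_weight d x"
  by (simp add: geg_weight_def)

lemma geg_weight_pos: "\<bar>x\<bar> < 1 \<Longrightarrow> 0 < geg_weight d x"
  using abs_square_less_1[of x] by (simp add: geg_weight_def)

lemma geg_weight_meas [measurable]: "geg_weight d \<in> borel_measurable borel"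
  unfolding geg_weight_def by measurable

lemma continuous_on_geg_weight: "d \<ge> 3 \<Longrightarrow> continuous_on {-1..1} (geg_weight d)"
  unfolding geg_weight_def
  by (intro continuous_on_powr' continuous_intros) (auto simp: abs_square_le_1)

lemma integrable_geg_weight:
  assumes "d \<ge> 3" "continuous_on {-1..1} f"
  shows "integrable lborel (\<lambda>x. indicator {-1..1} x * (f x * geg_weight d x) :: real)"
proof -
  have "set_integrable lborel {-1..1} (\<lambda>x. f x * geg_weight d x)"
    by (intro borel_integrable_atLeastAtMost' continuous_on_mult continuous_on_geg_weight assms)
  then show ?thesis by (simp add: set_integrable_def)
qed

lemma geg_mass_pos:
  assumes "d \<ge> 3"
  shows "0 < geg_mass d"
proof -
  have i: "integrable lborel (\<lambda>x. indicator {-1..1} x * geg_weight d x)"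
    using integrable_geg_weight[OF assms, of "\<lambda>_. 1"] by simp
  have "geg_mass d \<noteq> 0"
  proof
    assume "geg_mass d = 0"
    then have "AE x in lborel. indicator {-1..1} x * geg_weight d x = 0"
      unfolding geg_mass_def using i geg_weight_nonneg
      by (subst (asm) integral_nonneg_eq_0_iff_AE) (auto simp: indicator_def)
    then have "AE x in lborel. x \<notin> {-1<..<1::real}"
    proof eventually_elim
      case (elim x)
      then show ?case using geg_weight_pos[of x d] by (auto simp: indicator_def abs_less_iff split: if_splits)
    qed
    then have "emeasure lborel {-1<..<1::real} = 0"
      by (subst (asm) AE_iff_null_sets[symmetric]) auto
    then show False by simp
  qed
  moreover have "0 \<le> geg_mass d"
    unfolding geg_mass_def using geg_weight_nonneg by (intro integral_nonneg_AE AE_I2) (auto simp: indicator_def)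
  ultimately show ?thesis by simp
qed

lemma sets_geg_measure [measurable_cong, simp]: "sets (geg_measure d) = sets borel"
  by (simp add: geg_measure_def)

lemma space_geg_measure [simp]: "space (geg_measure d) = UNIV"
  by (simp add: geg_measure_def)

lemma geg_density_nonneg: "d \<ge> 3 \<Longrightarrow> 0 \<le> indicator {-1..1} x * geg_weight d x / geg_mass d"
  using geg_mass_pos[of d] geg_weight_nonneg[of d x] by (auto simp: indicator_def)

lemma integral_geg_measure:
  fixes f :: "real \<Rightarrow> real"
  assumes "d \<ge> 3" "f \<in> borel_measurable borel"
  shows "(\<integral>x. f x \<partial>geg_measure d) = (\<integral>x. indicator {-1..1} x * (f x * geg_weight d x) \<partial>lborel) / geg_mass d"
proof -
  have "(\<integral>x. f x \<partial>geg_measure d) = (\<integral>x. indicator {-1..1} x * geg_weight d x / geg_mass d * f x \<partial>lborel)"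
    unfolding geg_measure_def using assms geg_density_nonneg
    by (subst integral_density) auto
  also have "\<dots> = (\<integral>x. indicator {-1..1} x * (f x * geg_weight d x) / geg_mass d \<partial>lborel)"
    by (intro Bochner_Integration.integral_cong) auto
  finally show ?thesis by simp
qed

lemma nn_integral_geg_measure:
  assumes "d \<ge> 3" "f \<in> borel_measurable borel" "\<And>x. 0 \<le> f x"
  shows "(\<integral>\<^sup>+x. ennreal (f x) \<partial>geg_measure d) =
    (\<integral>\<^sup>+x. ennreal (f x * geg_weight d x) * indicator {-1..1} x \<partial>lborel) / ennreal (geg_mass d)"
proof -
  have "(\<integral>\<^sup>+x. ennreal (f x) \<partial>geg_measure d) =
      (\<integral>\<^sup>+x. ennreal (indicator {-1..1} x * geg_weight d x / geg_mass d) * ennreal (f x) \<partial>lborel)"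
    unfolding geg_measure_def using assms by (subst nn_integral_density) auto
  also have "\<dots> = (\<integral>\<^sup>+x. ennreal (f x * geg_weight d x) * indicator {-1..1} x / ennreal (geg_mass d) \<partial>lborel)"
    using assms geg_density_nonneg[OF assms(1)] geg_weight_nonneg geg_mass_pos[OF assms(1)]
    by (intro nn_integral_cong)
       (auto simp: indicator_def ennreal_mult[symmetric] divide_ennreal mult.commute)
  finally show ?thesis
    using assms by (simp add: nn_integral_divide)
qed

lemma prob_space_geg_measure:
  assumes "d \<ge> 3"
  shows "prob_space (geg_measure d)"
proof
  have i: "integrable lborel (\<lambda>x. indicator {-1..1} x * geg_weight d x)"
    using integrable_geg_weight[OF assms, of "\<lambda>_. 1"] by simp
  have "emeasure (geg_measure d) (space (geg_measure d)) =
      (\<integral>\<^sup>+x. ennreal (indicator {-1..1} x * geg_weight d x / geg_mass d) \<partial>lborel)"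
    by (simp add: geg_measure_def emeasure_density)
  also have "\<dots> = ennreal (\<integral>x. indicator {-1..1} x * geg_weight d x / geg_mass d \<partial>lborel)"
    using i geg_density_nonneg[OF assms] by (intro nn_integral_eq_integral) auto
  also have "\<dots> = 1" using geg_mass_pos[OF assms] by (simp add: geg_mass_def)
  finally show "emeasure (geg_measure d) (space (geg_measure d)) = 1" .
qed

lemma real_distribution_geg_measure: "d \<ge> 3 \<Longrightarrow> real_distribution (geg_measure d)"
  using prob_space_geg_measure by (simp add: real_distribution_def real_distribution_axioms_def)

lemma AE_geg_measure: "AE x in geg_measure d. x \<in> {-1..1}"
  unfolding geg_measure_def by (subst AE_density) (auto simp: indicator_def)

lemma integrable_geg_measure_continuous:
  fixes f :: "real \<Rightarrow> real"
  assumes "d \<ge> 3" "continuous_on UNIV f"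
  shows "integrable (geg_measure d) f"
proof -
  interpret prob_space "geg_measure d" using assms by (intro prob_space_geg_measure)
  have "compact (f ` {-1..1})"
    using assms by (intro compact_continuous_image) (auto intro: continuous_on_subset)
  then obtain B where B: "\<And>x. x \<in> {-1..1} \<Longrightarrow> norm (f x) \<le> B"
    using compact_imp_bounded[of "f ` {-1..1}"] unfolding bounded_iff by blast
  show ?thesis
  proof (rule integrable_const_bound)
    show "AE x in geg_measure d. norm (f x) \<le> B" by (rule eventually_mono[OF AE_geg_measure]) (rule B)
    show "f \<in> borel_measurable (geg_measure d)"
      using borel_measurable_continuous_onI[OF assms(2)] by simp
  qed
qed

section \<open>The moment functional of the Gegenbauer weight and orthogonality\<close>

definition Lam :: "nat \<Rightarrow> real poly \<Rightarrow> real" where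
  "Lam d p = (\<integral>x. poly p x \<partial>geg_measure d)"

lemma continuous_on_poly' [continuous_intros]: "continuous_on A (poly (p :: real poly))"
  by (intro continuous_at_imp_continuous_on ballI) auto

lemma borel_measurable_poly [measurable]: "poly (p :: real poly) \<in> borel_measurable borel"
  by (intro borel_measurable_continuous_onI continuous_intros)

lemma integrable_poly_geg: "d \<ge> 3 \<Longrightarrow> integrable (geg_measure d) (poly p)"
  by (intro integrable_geg_measure_continuous continuous_intros)

lemma Lam_add: "d \<ge> 3 \<Longrightarrow> Lam d (p + q) = Lam d p + Lam d q"
  by (simp add: Lam_def integrable_poly_geg)

lemma Lam_diff: "d \<ge> 3 \<Longrightarrow> Lam d (p - q) = Lam d p - Lam d q"
  by (simp add: Lam_def integrable_poly_geg)

lemma Lam_smult: "Lam d (smult c p) = c * Lam d p"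
  by (simp add: Lam_def)

lemma Lam_1: "d \<ge> 3 \<Longrightarrow> Lam d 1 = 1"
  using prob_space.prob_space[OF prob_space_geg_measure[of d]] by (simp add: Lam_def)

text \<open>Multiplied by the weight, the polynomial is the derivative of (1 - x^2)^(d/2) q(x),
  which vanishes at both endpoints.\<close>

lemma Lam_integration_by_parts:
  assumes d: "d \<ge> 3"
  shows "Lam d ([:1, 0, -1:] * pderiv q - smult (real d) ([:0, 1:] * q)) = 0"
proof -
  define W where "W = (\<lambda>x::real. (1 - x\<^sup>2) powr (d / 2))"
  define f where "f = (\<lambda>x. poly ([:1, 0, -1:] * pderiv q - smult (real d) ([:0, 1:] * q)) x * geg_weight d x)"
  have "(f has_integral (W 1 * poly q 1 - W (-1) * poly q (-1))) {-1..1}"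
  proof (rule fundamental_theorem_of_calculus_interior)
    show "continuous_on {-1..1} (\<lambda>x. W x * poly q x)"
      unfolding W_def using d
      by (intro continuous_on_mult continuous_on_powr' continuous_intros) (auto simp: abs_square_le_1)
    fix x :: real assume "x \<in> {-1<..<1}"
    then have x: "1 - x\<^sup>2 > 0" using abs_square_less_1[of x] by (auto simp: abs_less_iff)
    have W: "W x = (1 - x\<^sup>2) * geg_weight d x"
    proof -
      have "(1 - x\<^sup>2) * geg_weight d x = (1 - x\<^sup>2) powr 1 * (1 - x\<^sup>2) powr ((real d - 2) / 2)"
        using x by (simp add: geg_weight_def)
      also have "\<dots> = W x" unfolding W_def powr_add[symmetric] by (simp add: field_simps)
      finally show ?thesis by simp
    qed
    have "(W has_real_derivative (- real d * x * geg_weight d x)) (at x)"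
    proof -
      have "(W has_real_derivative ((d / 2) * (1 - x\<^sup>2) powr (d / 2 - 1) * (- 2 * x))) (at x)"
        unfolding W_def using x
        by (auto intro!: derivative_eq_intros simp: powr_diff field_simps)
      moreover have "(1 - x\<^sup>2) powr (d / 2 - 1) = geg_weight d x"
        by (simp add: geg_weight_def diff_divide_distrib)
      ultimately show ?thesis by (simp add: field_simps)
    qed
    then have "((\<lambda>x. W x * poly q x) has_real_derivative (- real d * x * geg_weight d x * poly q x + W x * poly (pderiv q) x)) (at x)"
      by (auto intro!: derivative_eq_intros poly_DERIV)
    also have "- real d * x * geg_weight d x * poly q x + W x * poly (pderiv q) x = f x"
      unfolding W f_def by (simp add: algebra_simps power2_eq_square)
    finally show "((\<lambda>x. W x * poly q x) has_vector_derivative f x) (at x)"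
      by (simp add: has_real_derivative_iff_has_vector_derivative)
  qed simp
  then have "integral {-1..1} f = 0"
    using d by (auto simp: W_def dest!: integral_unique)
  moreover have "set_integrable lborel {-1..1} f"
    unfolding f_def
    by (intro borel_integrable_atLeastAtMost' continuous_on_mult continuous_on_geg_weight continuous_intros d)
  ultimately have "(LINT x:{-1..1}|lborel. f x) = 0"
    by (simp add: set_borel_integral_eq_integral)
  then show ?thesis
    unfolding Lam_def by (subst integral_geg_measure[OF d]) (auto simp: set_lebesgue_integral_def f_def)
qed


text \<open>As d = 1 + 2 l, the differential equation makes C_k an eigenfunction of (1 - x^2) D^2 -
  d x D. All values of this operator have mean zero by parts, and for k \<ge> 1 the eigenvalue is
  not zero.\<close>

lemma Lam_geg_poly_eq_0:
  assumes d: "d \<ge> 3" and k: "k \<ge> 1" and l: "l = (real d - 1) / 2"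
  shows "Lam d (geg_poly l k) = 0"
proof -
  let ?g = "geg_poly l k"
  have dl: "real d = 1 + 2 * l" using l by (simp add: field_simps)
  have "[:1, 0, -1:] * pderiv (pderiv ?g) - smult (real d) ([:0, 1:] * pderiv ?g) = smult (- (real k * (real k + 2 * l))) ?g"
  proof (rule poly_eq_poly_eq_iff[THEN iffD1], rule ext)
    fix x
    show "poly ([:1, 0, -1:] * pderiv (pderiv ?g) - smult (real d) ([:0, 1:] * pderiv ?g)) x = poly (smult (- (real k * (real k + 2 * l))) ?g) x"
      using geg_ode[of x l k] unfolding dl by (simp add: algebra_simps power2_eq_square)
  qed
  with Lam_integration_by_parts[OF d, of "pderiv ?g"]
  have "- (real k * (real k + 2 * l)) * Lam d ?g = 0" by (simp only: Lam_smult)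
  moreover have "real k * (real k + 2 * l) > 0" using k d by (intro mult_pos_pos add_pos_nonneg) (auto simp: l)
  ultimately show ?thesis by auto
qed

lemma Lam_X_geg_poly:
  assumes d: "d \<ge> 3"
  shows "2 * (real n + 1 + l) * Lam d ([:0, 1:] * geg_poly l (Suc n) * q) =
    (real n + 2) * Lam d (geg_poly l (Suc (Suc n)) * q) + (real n + 2 * l) * Lam d (geg_poly l n * q)"
proof -
  have "Lam d (smult (2 * (real n + 1 + l)) ([:0, 1:] * geg_poly l (Suc n)) * q) =
     Lam d ((smult (real n + 2) (geg_poly l (Suc (Suc n))) + smult (real n + 2 * l) (geg_poly l n)) * q)"
    unfolding geg_poly_rec ..
  then show ?thesis
    by (simp only: mult_smult_left Lam_smult distrib_right Lam_add[OF d])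
qed

text \<open>Induction on the smaller index, for all larger k at once. If i + 1 = j, the recurrence
  expresses x C_k through C_(k+1) and C_(k-1), both of index above i, so x C_k is orthogonal to C_i.
  The recurrence for x C_(j-1) then carries this over to C_j.\<close>

lemma Lam_geg_orthogonal:
  assumes d: "d \<ge> 3" and l: "l = (real d - 1) / 2"
  shows "j < k \<Longrightarrow> Lam d (geg_poly l k * geg_poly l j) = 0"
proof (induction j arbitrary: k rule: less_induct)
  case (less j)
  have lpos: "l > 0" using d by (simp add: l)
  obtain k' where k: "k = Suc k'" using less.prems by (cases k) auto
  have X: "Lam d ([:0, 1:] * geg_poly l k * geg_poly l i) = 0" if "Suc i = j" for i
  proof -
    have "Lam d (geg_poly l (Suc (Suc k')) * geg_poly l i) = 0"
      using that less.prems k by (intro less.IH) auto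
    moreover have "Lam d (geg_poly l k' * geg_poly l i) = 0"
      using that less.prems k by (intro less.IH) auto
    ultimately have "2 * (real k' + 1 + l) * Lam d ([:0, 1:] * geg_poly l k * geg_poly l i) = 0"
      using Lam_X_geg_poly[OF d, of k' l "geg_poly l i"] unfolding k by simp
    then show ?thesis using lpos by (simp add: add_nonneg_eq_0_iff)
  qed
  consider "j = 0" | "j = Suc 0" | n where "j = Suc (Suc n)" by (metis not0_implies_Suc)
  then show ?case
  proof cases
    case 1
    then show ?thesis using Lam_geg_poly_eq_0[OF d _ l] less.prems by simp
  next
    case 2
    have "geg_poly l k * geg_poly l j = smult (2 * l) ([:0, 1:] * geg_poly l k * geg_poly l 0)"
      unfolding 2 by simp
    then show ?thesis using X[of 0] 2 by (simp only: Lam_smult mult_zero_right)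
  next
    case 3
    have "2 * (real n + 1 + l) * Lam d ([:0, 1:] * geg_poly l (Suc n) * geg_poly l k) = 0"
      using X[of "Suc n"] 3 by (simp only: mult_ac)
    moreover have "(real n + 2 * l) * Lam d (geg_poly l n * geg_poly l k) = 0"
      using less.IH[of n k] 3 less.prems by (simp add: mult.commute)
    ultimately have "(real n + 2) * Lam d (geg_poly l (Suc (Suc n)) * geg_poly l k) = 0"
      using Lam_X_geg_poly[OF d, of n l "geg_poly l k"] by linarith
    then show ?thesis unfolding 3
      by (simp only: mult.commute[of "geg_poly l k"]) (simp add: add_nonneg_eq_0_iff del: geg_poly.simps)
  qed
qed

text \<open>The integral X of x C_(k+1) C_k is evaluated twice, by expanding x C_(k+1) and by
  expanding x C_k. This gives the ratio of consecutive squared norms, and C_k(1) has the same ratio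
  up to the change of l / (k + l).\<close>

lemma Lam_geg_norm:
  assumes d: "d \<ge> 3" and l: "l = (real d - 1) / 2"
  shows "Lam d (geg_poly l k * geg_poly l k) = l / (real k + l) * poly (geg_poly l k) 1"
proof (induction k)
  case 0
  show ?case using d by (simp add: Lam_1 l)
next
  case (Suc k)
  have lpos: "l > 0" using d by (simp add: l)
  define h h1 X c c1 where "h = Lam d (geg_poly l k * geg_poly l k)"
    "h1 = Lam d (geg_poly l (Suc k) * geg_poly l (Suc k))"
    "X = Lam d ([:0, 1:] * geg_poly l (Suc k) * geg_poly l k)"
    "c = poly (geg_poly l k) 1" "c1 = poly (geg_poly l (Suc k)) 1"
  note defs = this
  have c: "(real k + 1) * c1 = (real k + 2 * l) * c" unfolding defs by (rule geg_poly_at_1_Suc)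
  have "Lam d (geg_poly l (Suc (Suc k)) * geg_poly l k) = 0"
    by (intro Lam_geg_orthogonal d l) simp
  then have 1: "2 * (real k + 1 + l) * X = (real k + 2 * l) * h"
    using Lam_X_geg_poly[OF d, of k l "geg_poly l k"] unfolding defs by simp
  have 2: "2 * (real k + l) * X = (real k + 1) * h1"
  proof (cases k)
    case 0
    \<comment> \<open>The recurrence has no instance here; instead C_1 = 2 l x C_0 is used
      directly.\<close>
    have "h1 = 2 * l * X" unfolding defs 0
      by (simp add: Lam_smult[symmetric] mult.commute)
    then show ?thesis unfolding 0 by simp
  next
    case (Suc n)
    have "Lam d (geg_poly l n * geg_poly l (Suc k)) = 0"
      using Lam_geg_orthogonal[OF d l, of n "Suc k"] Suc by (simp add: mult.commute del: geg_poly.simps)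
    then have "2 * (real n + 1 + l) * Lam d ([:0, 1:] * geg_poly l (Suc n) * geg_poly l (Suc k)) = (real n + 2) * h1"
      using Lam_X_geg_poly[OF d, of n l "geg_poly l (Suc k)"] unfolding defs Suc by simp
    moreover have "Lam d ([:0, 1:] * geg_poly l (Suc n) * geg_poly l (Suc k)) = X"
      unfolding defs Suc by (simp only: mult_ac)
    ultimately show ?thesis unfolding Suc by (simp add: algebra_simps)
  qed
  have IH: "h * (real k + l) = l * c" using Suc lpos unfolding defs by (simp add: field_simps)
  have "(real k + 1) * (h1 * (real k + 1 + l)) = (real k + 1) * (l * c1)"
    using 1 2 IH c by algebra
  then have "h1 * (real k + 1 + l) = l * c1"
    by (simp add: add_nonneg_eq_0_iff)
  then show ?case using lpos unfolding defs by (simp add: field_simps add_pos_nonneg del: geg_poly.simps)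
qed

text \<open>The density is positive on (-1, 1) and a nonzero polynomial has only finitely many
  roots, so it cannot vanish almost everywhere there.\<close>

lemma Lam_square_eq_0:
  assumes d: "d \<ge> 3" and 0: "Lam d (p * p) = 0"
  shows "p = 0"
proof (rule ccontr)
  assume p: "p \<noteq> 0"
  have "AE x in geg_measure d. (poly p x)\<^sup>2 = 0"
    using 0 integrable_poly_geg[OF d, of "p * p"] unfolding Lam_def
    by (subst (asm) integral_nonneg_eq_0_iff_AE) (auto simp: power2_eq_square)
  then have "AE x in lborel. 0 < ennreal (indicator {-1..1} x * geg_weight d x / geg_mass d) \<longrightarrow> (poly p x)\<^sup>2 = 0"
    unfolding geg_measure_def by (subst (asm) AE_density) auto
  moreover have "AE x in lborel. x \<notin> {x. poly p x = 0}"
    using finite_imp_null_set_lborel[OF poly_roots_finite[OF p]] by (rule AE_not_in)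
  ultimately have "AE x in lborel. x \<notin> {-1<..<1::real}"
  proof eventually_elim
    case (elim x)
    then have "geg_weight d x \<le> 0" if "x \<in> {-1<..<1}"
      using that geg_mass_pos[OF d] by (auto simp: indicator_def zero_less_divide_iff not_less split: if_splits)
    then show ?case using geg_weight_pos[of x d] by (auto simp: abs_less_iff)
  qed
  then have "emeasure lborel {-1<..<1::real} = 0"
    by (subst (asm) AE_iff_null_sets[symmetric]) auto
  then show False by simp
qed

text \<open>For m = degree q a multiple of C_m cancels the leading term of q; induction treats the
  remainder and orthogonality treats C_m.\<close>

lemma Lam_geg_lower_degree:
  assumes d: "d \<ge> 3" and l: "l = (real d - 1) / 2" and "k \<ge> 1"
  shows "degree q < k \<Longrightarrow> Lam d (geg_poly l k * q) = 0"
proof (induction "degree q" arbitrary: q rule: less_induct)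
  case less
  have lpos: "l > 0" using d by (simp add: l)
  define m where "m = degree q"
  define a where "a = coeff q m / coeff (geg_poly l m) m"
  define r where "r = q - smult a (geg_poly l m)"
  have g: "degree (geg_poly l m) \<le> m" "coeff (geg_poly l m) m > 0" using degree_geg_poly[OF lpos, of m] by auto
  have q: "q = r + smult a (geg_poly l m)" by (simp add: r_def)
  have orth: "Lam d (geg_poly l k * geg_poly l m) = 0"
    using Lam_geg_orthogonal[OF d l, of m k] less.prems by (simp add: m_def)
  have "Lam d (geg_poly l k * r) = 0"
  proof (cases "r = 0")
    case False
    have "degree r \<le> m" unfolding r_def using g
      by (intro degree_diff_le order_trans[OF degree_smult_le]) (auto simp: m_def)
    moreover have "coeff r m = 0" unfolding r_def a_def using g by simp
    ultimately have "degree r < m" using False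
      by (metis leading_coeff_0_iff order_le_imp_less_or_eq)
    then show ?thesis using less.hyps[of r] less.prems by (auto simp: m_def)
  qed (simp add: Lam_def)
  then show ?case
    by (subst q) (simp add: distrib_left Lam_add[OF d] Lam_smult orth)
qed

text \<open>Subtracting the multiple of C_k with the same coefficient at k leaves a polynomial r of
  degree below k. Both p and C_k are orthogonal to r, so r is orthogonal to itself.\<close>

lemma geg_poly_unique:
  assumes d: "d \<ge> 3" and l: "l = (real d - 1) / 2"
    and deg: "degree p \<le> k" and orth: "\<And>r. degree r < k \<Longrightarrow> Lam d (p * r) = 0"
  shows "\<exists>c. p = smult c (geg_poly l k)"
proof (cases "k = 0")
  case True
  then obtain c where "p = [:c:]" using deg by (auto elim: degree_eq_zeroE)
  then show ?thesis using True by (intro exI[of _ c]) (simp add: one_pCons)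
next
  case False
  have lpos: "l > 0" using d by (simp add: l)
  have g: "degree (geg_poly l k) \<le> k" "coeff (geg_poly l k) k > 0" using degree_geg_poly[OF lpos, of k] by auto
  define a where "a = coeff p k / coeff (geg_poly l k) k"
  define r where "r = p - smult a (geg_poly l k)"
  have "r = 0"
  proof (rule ccontr)
    assume r: "r \<noteq> 0"
    have "degree r \<le> k" unfolding r_def using g deg
      by (intro degree_diff_le order_trans[OF degree_smult_le]) auto
    moreover have "coeff r k = 0" unfolding r_def a_def using g by simp
    ultimately have dr: "degree r < k" using r by (metis leading_coeff_0_iff order_le_imp_less_or_eq)
    have "Lam d (r * r) = Lam d (p * r) - a * Lam d (geg_poly l k * r)"
      by (subst r_def) (simp add: left_diff_distrib Lam_diff[OF d] Lam_smult)
    also have "\<dots> = 0" using orth[OF dr] Lam_geg_lower_degree[OF d l _ dr] False by simp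
    finally show False using Lam_square_eq_0[OF d] r by blast
  qed
  then show ?thesis unfolding r_def by auto
qed

section \<open>Values at 1 and dimensions of spaces of harmonics\<close>

lemma geg_poly_at_1:
  assumes d: "d \<ge> 3" and l: "l = (real d - 1) / 2"
  shows "poly (geg_poly l k) 1 = real ((d - 2 + k) choose k)"
proof (induction k)
  case (Suc k)
  have "Suc k * ((d - 2 + Suc k) choose Suc k) = (d - 1 + k) * ((d - 2 + k) choose k)"
  proof -
    have "d - 1 + k = Suc (d - 2 + k)" using d by simp
    then show ?thesis using Suc_times_binomial[of k "d - 2 + k"] by (simp only: add_Suc_right)
  qed
  then have "real (Suc k) * real ((d - 2 + Suc k) choose Suc k) = real (d - 1 + k) * real ((d - 2 + k) choose k)"
    by (metis of_nat_mult)
  also have "real (d - 1 + k) = real k + 2 * l" using d by (simp add: l of_nat_diff)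
  also have "(real k + 2 * l) * real ((d - 2 + k) choose k) = real (Suc k) * poly (geg_poly l (Suc k)) 1"
    using geg_poly_at_1_Suc[of k l] Suc by (simp add: add.commute)
  finally show ?case by (simp del: geg_poly.simps)
qed simp

text \<open>Both binomial coefficients are multiples of B = (e + k choose e) = C_k(1) with e = d -
  2: they equal k B / (e + 1) and (e + k + 1) B / (e + 1).\<close>

lemma dim_harm_eq:
  assumes d: "d \<ge> 3" and l: "l = (real d - 1) / 2" and k: "k \<ge> 1"
  shows "dim_harm k d = (real k + l) / l * poly (geg_poly l k) 1"
proof -
  obtain e where e: "d = e + 2" using d by (metis add.commute le_Suc_ex numeral_3_eq_3 Suc_leD numeral_2_eq_2)
  have l2: "l = (real e + 1) / 2" by (simp add: l e)
  define B where "B = real ((e + k) choose e)"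
  have g: "poly (geg_poly l k) 1 = B"
    unfolding geg_poly_at_1[OF d l] B_def by (simp add: e binomial_symmetric[of k])
  have 1: "(real e + 1) * real ((e + k) choose (Suc e)) = real k * B"
  proof -
    obtain k' where k': "k = Suc k'" using k by (cases k) auto
    have "Suc e * ((e + k) choose Suc e) = k * ((e + k) choose e)"
      using Suc_times_binomial_add[of e k'] unfolding k' by (simp only: add_Suc_right)
    then have "real (Suc e) * real ((e + k) choose Suc e) = real k * real ((e + k) choose e)"
      by (simp only: of_nat_mult[symmetric])
    then show ?thesis unfolding B_def by (simp only: of_nat_Suc add.commute)
  qed
  have 2: "(real e + 1) * real ((e + k + 1) choose (Suc e)) = (real e + real k + 1) * B"
  proof -
    have "Suc e * (Suc (e + k) choose Suc e) = Suc (e + k) * ((e + k) choose e)"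
      by (rule Suc_times_binomial)
    then have "real (Suc e) * real (Suc (e + k) choose Suc e) = real (Suc (e + k)) * real ((e + k) choose e)"
      by (simp only: of_nat_mult[symmetric])
    then show ?thesis unfolding B_def by (simp only: of_nat_Suc of_nat_add of_nat_1 Suc_eq_plus1 add_ac)
  qed
  have "(real e + 1) * dim_harm k d = (2 * real k + real e + 1) * B"
    using 1 2 by (simp add: dim_harm_def e distrib_left distrib_right)
  then show ?thesis unfolding g unfolding l2 by (simp add: field_simps)
qed

section \<open>The uniform distribution on the sphere and Gaussian vectors\<close>

lemma space_eucl_space: "space (eucl_space d) = PiE {..d} (\<lambda>_. UNIV)"
  by (simp add: eucl_space_def space_PiM)

lemma component_meas [measurable]: "i \<le> d \<Longrightarrow> (\<lambda>x. x i) \<in> borel_measurable (eucl_space d)"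
  unfolding eucl_space_def by measurable

lemma inner_d_meas [measurable (raw)]:
  assumes [measurable]: "f \<in> measurable N (eucl_space d)" "g \<in> measurable N (eucl_space d)"
  shows "(\<lambda>w. inner_d d (f w) (g w)) \<in> borel_measurable N"
proof -
  have "(\<lambda>w. f w i) \<in> borel_measurable N" "(\<lambda>w. g w i) \<in> borel_measurable N" if "i \<le> d" for i
    using measurable_compose[OF assms(1) component_meas[OF that]]
      measurable_compose[OF assms(2) component_meas[OF that]] by auto
  then show ?thesis unfolding inner_d_def by (intro borel_measurable_sum borel_measurable_times) auto
qed

lemma inner_d_meas_const [measurable (raw)]:
  assumes [measurable]: "g \<in> measurable N (eucl_space d)"
  shows "(\<lambda>w. inner_d d x (g w)) \<in> borel_measurable N"
proof -
  have "(\<lambda>w. g w i) \<in> borel_measurable N" if "i \<le> d" for i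
    using measurable_compose[OF assms(1) component_meas[OF that]] by auto
  then show ?thesis unfolding inner_d_def by (intro borel_measurable_sum borel_measurable_times) auto
qed

lemma measurable_eucl_restrict:
  assumes "\<And>i. i \<le> d \<Longrightarrow> (\<lambda>w. f w i) \<in> borel_measurable N"
  shows "(\<lambda>w. \<lambda>i\<in>{..d}. f w i) \<in> measurable N (eucl_space d)"
  unfolding eucl_space_def using assms by (intro measurable_restrict) auto

lemma normalize_d_meas [measurable]: "normalize_d d \<in> measurable (eucl_space d) (eucl_space d)"
  unfolding normalize_d_def by (intro measurable_eucl_restrict) measurable

lemma inner_d_self_nonneg: "0 \<le> inner_d d x x"
  by (simp add: inner_d_def sum_nonneg)

lemma inner_d_self_eq_0: "inner_d d x x = 0 \<longleftrightarrow> (\<forall>i\<le>d. x i = 0)"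
  by (subst inner_d_def, subst sum_nonneg_eq_0_iff) auto

interpretation lborel_product: product_sigma_finite "\<lambda>_::nat. lborel :: real measure"
  by standard

lemma sigma_finite_eucl_space: "sigma_finite_measure (eucl_space d)"
  unfolding eucl_space_def by (rule lborel_product.sigma_finite) simp

section \<open>Scaling of volume, cones and the Gaussian law\<close>

definition scale_d :: "nat \<Rightarrow> real \<Rightarrow> (nat \<Rightarrow> real) \<Rightarrow> nat \<Rightarrow> real" where
  "scale_d d c x = (\<lambda>i\<in>{..d}. c * x i)"

lemma scale_d_meas [measurable]: "scale_d d c \<in> measurable (eucl_space d) (eucl_space d)"
  unfolding scale_d_def by (intro measurable_eucl_restrict) measurable

lemma inner_scale_d: "inner_d d (scale_d d c x) (scale_d d c x) = c\<^sup>2 * inner_d d x x"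
  by (simp add: inner_d_def scale_d_def sum_distrib_left power2_eq_square mult_ac)

lemma normalize_scale_d:
  assumes "c > 0"
  shows "normalize_d d (scale_d d c x) = normalize_d d x"
  unfolding normalize_d_def inner_scale_d
  using assms by (auto simp: real_sqrt_mult scale_d_def fun_eq_iff)

text \<open>The coordinates scale separately, so the factor c^(d+1) can be read off on boxes, which
  determine the product measure.\<close>

lemma eucl_space_scale:
  assumes c: "c > 0"
  shows "eucl_space d = density (distr (eucl_space d) (eucl_space d) (scale_d d c)) (\<lambda>_. ennreal (c ^ Suc d))"
proof -
  let ?P = "density (distr (eucl_space d) (eucl_space d) (scale_d d c)) (\<lambda>_. ennreal (c ^ Suc d))"
  have "?P = PiM {..d} (\<lambda>_. lborel)"
  proof (rule lborel_product.PiM_eqI)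
    show "sets ?P = sets (PiM {..d} (\<lambda>_. lborel))" by (simp add: eucl_space_def)
    fix A :: "nat \<Rightarrow> real set" assume A: "\<And>i. i \<in> {..d} \<Longrightarrow> A i \<in> sets lborel"
    have AE: "PiE {..d} A \<in> sets (eucl_space d)"
      unfolding eucl_space_def using A by (intro sets_PiM_I_finite) auto
    have pre: "(\<lambda>y. c * y) -` A i \<in> sets borel" if "i \<in> {..d}" for i
      using A[OF that] by (intro measurable_sets_borel[of _ borel]) auto
    have "emeasure ?P (PiE {..d} A) = ennreal (c ^ Suc d) * emeasure (eucl_space d) (scale_d d c -` PiE {..d} A \<inter> space (eucl_space d))"
      using AE by (simp add: emeasure_density_const emeasure_distr)
    also have "scale_d d c -` PiE {..d} A \<inter> space (eucl_space d) = PiE {..d} (\<lambda>i. (\<lambda>y. c * y) -` A i)"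
      by (auto simp: space_eucl_space scale_d_def PiE_iff extensional_def)
    also have "emeasure (eucl_space d) (PiE {..d} (\<lambda>i. (\<lambda>y. c * y) -` A i)) = (\<Prod>i\<le>d. emeasure lborel ((\<lambda>y. c * y) -` A i))"
      unfolding eucl_space_def using pre by (intro lborel_product.emeasure_PiM) auto
    also have "ennreal (c ^ Suc d) * (\<Prod>i\<le>d. emeasure lborel ((\<lambda>y. c * y) -` A i)) =
        (\<Prod>i\<le>d. ennreal c * emeasure lborel ((\<lambda>y. c * y) -` A i))"
      using c by (simp add: prod.distrib ennreal_power[symmetric] ennreal_mult)
    also have "\<dots> = (\<Prod>i\<le>d. emeasure lborel (A i))"
    proof (intro prod.cong refl)
      fix i assume i: "i \<in> {..d}"
      have "emeasure lborel (A i) = emeasure (density (distr lborel borel (\<lambda>x. 0 + c * x)) (\<lambda>_. ennreal \<bar>c\<bar>)) (A i)"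
        using lborel_real_affine[of c 0] c by simp
      also have "\<dots> = ennreal c * emeasure lborel ((\<lambda>y. c * y) -` A i)"
        using A[OF i] c by (simp add: emeasure_density_const emeasure_distr)
      finally show "ennreal c * emeasure lborel ((\<lambda>y. c * y) -` A i) = emeasure lborel (A i)" ..
    qed
    finally show "emeasure ?P (PiE {..d} A) = (\<Prod>i\<in>{..d}. emeasure lborel (A i))" .
  qed simp
  then show ?thesis by (simp add: eucl_space_def)
qed

text \<open>The cone over the directions in A, truncated by s, which is the square of the radius and
  the variable of the layer integral for the Gaussian density.\<close>

definition cone_ball :: "nat \<Rightarrow> real \<Rightarrow> (nat \<Rightarrow> real) set \<Rightarrow> (nat \<Rightarrow> real) set" where
  "cone_ball d s A = {x \<in> space (eucl_space d). inner_d d x x \<le> s \<and> normalize_d d x \<in> A}"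

lemma cone_ball_sets [measurable]:
  assumes [measurable]: "A \<in> sets (eucl_space d)"
  shows "cone_ball d s A \<in> sets (eucl_space d)"
  unfolding cone_ball_def by measurable

text \<open>Volume of a truncated cone relative to truncation at 1. For s \<le> 0 at most the
  origin, a null set, is left, whence the value 0.\<close>

definition radial_growth :: "nat \<Rightarrow> real \<Rightarrow> real" where
  "radial_growth d s = (if s > 0 then sqrt s ^ Suc d else 0)"

lemma emeasure_origin: "emeasure (eucl_space d) {x \<in> space (eucl_space d). inner_d d x x = 0} = 0"
proof -
  have "{x \<in> space (eucl_space d). inner_d d x x = 0} = PiE {..d} (\<lambda>_. {0})"
    by (auto simp: inner_d_self_eq_0 space_eucl_space PiE_iff extensional_def fun_eq_iff)
  also have "emeasure (eucl_space d) \<dots> = (\<Prod>i\<le>d. emeasure lborel {0::real})"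
    unfolding eucl_space_def by (intro lborel_product.emeasure_PiM) auto
  finally show ?thesis by simp
qed

lemma emeasure_cone_ball:
  assumes A: "A \<in> sets (eucl_space d)"
  shows "emeasure (eucl_space d) (cone_ball d s A) = ennreal (radial_growth d s) * emeasure (eucl_space d) (cone_ball d 1 A)"
proof (cases "s > 0")
  case True
  let ?c = "sqrt s"
  have c: "?c > 0" using True by simp
  have "emeasure (eucl_space d) (cone_ball d s A) =
      emeasure (density (distr (eucl_space d) (eucl_space d) (scale_d d ?c)) (\<lambda>_. ennreal (?c ^ Suc d))) (cone_ball d s A)"
    using eucl_space_scale[OF c, of d] by simp
  also have "\<dots> = ennreal (?c ^ Suc d) * emeasure (eucl_space d) (scale_d d ?c -` cone_ball d s A \<inter> space (eucl_space d))"
    using A by (simp add: emeasure_density_const emeasure_distr)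
  also have "scale_d d ?c -` cone_ball d s A \<inter> space (eucl_space d) = cone_ball d 1 A"
    using True measurable_space[OF scale_d_meas[of d ?c]]
    by (auto simp: cone_ball_def inner_scale_d normalize_scale_d)
  finally show ?thesis using True by (simp add: radial_growth_def)
next
  case False
  have "cone_ball d s A \<subseteq> {x \<in> space (eucl_space d). inner_d d x x = 0}"
    using False inner_d_self_nonneg by (force simp: cone_ball_def intro: antisym)
  then have "emeasure (eucl_space d) (cone_ball d s A) \<le> emeasure (eucl_space d) {x \<in> space (eucl_space d). inner_d d x x = 0}"
    by (intro emeasure_mono) measurable
  then show ?thesis using False emeasure_origin[of d] by (simp add: radial_growth_def)
qed

definition gauss_d :: "nat \<Rightarrow> (nat \<Rightarrow> real) measure" where
  "gauss_d d = PiM {..d} (\<lambda>_. density lborel std_normal_density)"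

lemma sets_gauss_d [measurable_cong, simp]: "sets (gauss_d d) = sets (eucl_space d)"
  unfolding gauss_d_def eucl_space_def by (intro sets_PiM_cong) auto

lemma space_gauss_d [simp]: "space (gauss_d d) = space (eucl_space d)"
  by (rule sets_eq_imp_space_eq) simp

lemma prob_space_std_normal: "prob_space (density lborel std_normal_density)"
  by (rule prob_space_normal_density) simp

lemma prob_space_gauss_d: "prob_space (gauss_d d)"
  unfolding gauss_d_def by (intro prob_space_PiM prob_space_std_normal)

lemma gauss_d_density:
  "gauss_d d = density (eucl_space d) (\<lambda>x. ennreal ((1 / sqrt (2 * pi)) ^ Suc d) * ennreal (exp (- (inner_d d x x / 2))))"
proof -
  interpret N: product_sigma_finite "\<lambda>_::nat. density lborel std_normal_density"
    unfolding product_sigma_finite_def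
    using prob_space_std_normal by (auto intro: prob_space_imp_sigma_finite)
  let ?P = "density (eucl_space d) (\<lambda>x. \<Prod>i\<le>d. ennreal (std_normal_density (x i)))"
  have [measurable]: "(\<lambda>x. \<Prod>i\<le>d. ennreal (std_normal_density (x i))) \<in> borel_measurable (eucl_space d)"
    by (intro borel_measurable_prod_ennreal) (use component_meas[of _ d] in measurable)
  have "?P = gauss_d d"
    unfolding gauss_d_def
  proof (rule N.PiM_eqI)
    show "sets ?P = sets (PiM {..d} (\<lambda>_. density lborel std_normal_density))"
      using sets_gauss_d[of d] by (simp add: gauss_d_def)
    fix A :: "nat \<Rightarrow> real set" assume A: "\<And>i. i \<in> {..d} \<Longrightarrow> A i \<in> sets (density lborel std_normal_density)"
    have AE: "PiE {..d} A \<in> sets (eucl_space d)"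
      unfolding eucl_space_def using A by (intro sets_PiM_I_finite) auto
    have "emeasure ?P (PiE {..d} A) = (\<integral>\<^sup>+x. (\<Prod>i\<le>d. ennreal (std_normal_density (x i))) * indicator (PiE {..d} A) x \<partial>eucl_space d)"
      using AE by (subst emeasure_density) auto
    also have "\<dots> = (\<integral>\<^sup>+x. (\<Prod>i\<le>d. ennreal (std_normal_density (x i)) * indicator (A i) (x i)) \<partial>eucl_space d)"
    proof (intro nn_integral_cong)
      fix x assume "x \<in> space (eucl_space d)"
      then have "indicator (PiE {..d} A) x = (\<Prod>i\<le>d. indicator (A i) (x i) :: ennreal)"
        by (auto simp: space_eucl_space indicator_def PiE_iff intro!: prod_zero[symmetric])
      then show "(\<Prod>i\<le>d. ennreal (std_normal_density (x i))) * indicator (PiE {..d} A) x =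
          (\<Prod>i\<le>d. ennreal (std_normal_density (x i)) * indicator (A i) (x i))"
        by (simp add: prod.distrib)
    qed
    also have "\<dots> = (\<Prod>i\<le>d. \<integral>\<^sup>+y. ennreal (std_normal_density y) * indicator (A i) y \<partial>lborel)"
      unfolding eucl_space_def using A by (intro lborel_product.product_nn_integral_prod) auto
    also have "\<dots> = (\<Prod>i\<le>d. emeasure (density lborel std_normal_density) (A i))"
      using A by (intro prod.cong refl) (subst emeasure_density, auto)
    finally show "emeasure ?P (PiE {..d} A) = (\<Prod>i\<in>{..d}. emeasure (density lborel std_normal_density) (A i))" .
  qed simp
  moreover have "(\<Prod>i\<le>d. ennreal (std_normal_density (x i))) = ennreal ((1 / sqrt (2 * pi)) ^ Suc d) * ennreal (exp (- (inner_d d x x / 2)))" for x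
  proof -
    have "(\<Prod>i\<le>d. std_normal_density (x i)) = (\<Prod>i\<le>d. 1 / sqrt (2 * pi)) * (\<Prod>i\<le>d. exp (- ((x i)\<^sup>2 / 2)))"
      unfolding prod.distrib[symmetric] by (intro prod.cong) (auto simp: normal_density_def)
    also have "(\<Prod>i\<le>d. exp (- ((x i)\<^sup>2 / 2))) = exp (- (inner_d d x x / 2))"
      by (simp add: exp_sum[symmetric] inner_d_def sum_negf sum_divide_distrib power2_eq_square)
    also have "(\<Prod>i\<le>d. 1 / sqrt (2 * pi)) = (1 / sqrt (2 * pi)) ^ Suc d" by (simp add: power_divide)
    finally show ?thesis
      by (subst prod_ennreal) (auto simp: ennreal_mult[symmetric])
  qed
  ultimately show ?thesis by simp
qed

text \<open>Layer-cake form of the radial factor of the Gaussian density: it exhibits the Gaussian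
  law as a mixture of uniform laws on balls of squared radius s.\<close>

lemma exp_layer_cake:
  assumes "q \<ge> 0"
  shows "(\<integral>\<^sup>+s. ennreal (exp (- s / 2) / 2) * indicator {q..} s \<partial>lborel) = ennreal (exp (- (q / 2)))"
proof -
  have "(\<integral>\<^sup>+s. ennreal (exp (- s / 2) / 2) * indicator {q..} s \<partial>lborel) = ennreal (0 - (- exp (- q / 2)))"
  proof (rule nn_integral_FTC_atLeast)
    show "((\<lambda>s. - exp (- s / 2)) has_real_derivative exp (- s / 2) / 2) (at s)" for s :: real
      by (auto intro!: derivative_eq_intros)
    show "((\<lambda>s::real. - exp (- s / 2)) \<longlongrightarrow> 0) at_top"
    proof -
      have "((\<lambda>s::real. - exp (- s / 2)) \<longlongrightarrow> - 0) at_top"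
      proof (intro tendsto_minus filterlim_compose[OF exp_at_bot])
        have "\<forall>s\<ge>- 2 * Z. - s / 2 \<le> Z" for Z :: real by auto
        then show "filterlim (\<lambda>s::real. - s / 2) at_bot at_top"
          unfolding filterlim_at_bot eventually_at_top_linorder by blast
      qed
      then show ?thesis by simp
    qed
  qed auto
  then show ?thesis by simp
qed


lemma uniform_sphere_eq_cone_ball:
  assumes A: "A \<in> sets (eucl_space d)"
  shows "emeasure (uniform_sphere d) A = emeasure (eucl_space d) (cone_ball d 1 A) / emeasure (eucl_space d) (unit_ball_d d)"
proof -
  have ub: "unit_ball_d d \<in> sets (eucl_space d)" unfolding unit_ball_d_def by measurable
  have "emeasure (uniform_sphere d) A =
      emeasure (uniform_measure (eucl_space d) (unit_ball_d d)) (normalize_d d -` A \<inter> space (eucl_space d))"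
    unfolding uniform_sphere_def using A by (subst emeasure_distr) auto
  also have "\<dots> = emeasure (eucl_space d) (unit_ball_d d \<inter> (normalize_d d -` A \<inter> space (eucl_space d))) / emeasure (eucl_space d) (unit_ball_d d)"
    using A ub by (intro emeasure_uniform_measure) auto
  also have "unit_ball_d d \<inter> (normalize_d d -` A \<inter> space (eucl_space d)) = cone_ball d 1 A"
    by (auto simp: unit_ball_d_def cone_ball_def)
  finally show ?thesis .
qed

lemma unit_ball_eq_cone_ball: "unit_ball_d d = cone_ball d 1 (space (eucl_space d))"
  using measurable_space[OF normalize_d_meas[of d]] by (auto simp: unit_ball_d_def cone_ball_def)

text \<open>By Tonelli the layers become volumes of cones truncated at min r s, and these scale.
  Hence A enters only through the volume of its cone at truncation 1, while the integral depends on
  r alone.\<close>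

lemma gauss_cone_ball:
  assumes A: "A \<in> sets (eucl_space d)"
  shows "emeasure (gauss_d d) (cone_ball d r A) =
    (\<integral>\<^sup>+s. ennreal ((1 / sqrt (2 * pi)) ^ Suc d) * ennreal (exp (- s / 2) / 2) * ennreal (radial_growth d (min r s)) \<partial>lborel)
      * emeasure (eucl_space d) (cone_ball d 1 A)"
proof -
  let ?K = "ennreal ((1 / sqrt (2 * pi)) ^ Suc d)"
  interpret E: sigma_finite_measure "eucl_space d" by (rule sigma_finite_eucl_space)
  interpret EL: pair_sigma_finite "eucl_space d" lborel ..
  note [measurable] = A cone_ball_sets[OF A]
  have rg [measurable]: "radial_growth d \<in> borel_measurable borel"
    unfolding radial_growth_def by measurable
  have "emeasure (gauss_d d) (cone_ball d r A) =
      (\<integral>\<^sup>+x. ?K * ennreal (exp (- (inner_d d x x / 2))) * indicator (cone_ball d r A) x \<partial>eucl_space d)"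
    unfolding gauss_d_density by (subst emeasure_density) auto
  also have "\<dots> = (\<integral>\<^sup>+x. (\<integral>\<^sup>+s. ?K * ennreal (exp (- s / 2) / 2) * indicator (cone_ball d (min r s) A) x \<partial>lborel) \<partial>eucl_space d)"
  proof (intro nn_integral_cong)
    fix x assume x: "x \<in> space (eucl_space d)"
    have "?K * ennreal (exp (- (inner_d d x x / 2))) * indicator (cone_ball d r A) x =
        (\<integral>\<^sup>+s. ?K * indicator (cone_ball d r A) x * (ennreal (exp (- s / 2) / 2) * indicator {inner_d d x x..} s) \<partial>lborel)"
      by (subst nn_integral_cmult, simp, subst exp_layer_cake[OF inner_d_self_nonneg], simp only: mult_ac)
    also have "\<dots> = (\<integral>\<^sup>+s. ?K * ennreal (exp (- s / 2) / 2) * indicator (cone_ball d (min r s) A) x \<partial>lborel)"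
      by (intro nn_integral_cong) (auto simp: indicator_def cone_ball_def x)
    finally show "?K * ennreal (exp (- (inner_d d x x / 2))) * indicator (cone_ball d r A) x =
        (\<integral>\<^sup>+s. ?K * ennreal (exp (- s / 2) / 2) * indicator (cone_ball d (min r s) A) x \<partial>lborel)" .
  qed
  also have "\<dots> = (\<integral>\<^sup>+s. (\<integral>\<^sup>+x. ?K * ennreal (exp (- s / 2) / 2) * indicator (cone_ball d (min r s) A) x \<partial>eucl_space d) \<partial>lborel)"
  proof (rule EL.Fubini'[symmetric])
    have "{p \<in> space (eucl_space d \<Otimes>\<^sub>M lborel). inner_d d (fst p) (fst p) \<le> min r (snd p) \<and> normalize_d d (fst p) \<in> A} \<in> sets (eucl_space d \<Otimes>\<^sub>M lborel)"
      by measurable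
    also have "{p \<in> space (eucl_space d \<Otimes>\<^sub>M lborel). inner_d d (fst p) (fst p) \<le> min r (snd p) \<and> normalize_d d (fst p) \<in> A}
        = {p \<in> space (eucl_space d \<Otimes>\<^sub>M lborel). fst p \<in> cone_ball d (min r (snd p)) A}"
      by (auto simp: cone_ball_def space_pair_measure)
    finally have [measurable]: "(\<lambda>p. indicator (cone_ball d (min r (snd p)) A) (fst p) :: ennreal) \<in> borel_measurable (eucl_space d \<Otimes>\<^sub>M lborel)"
      by (subst measurable_cong[where g="indicator {p \<in> space (eucl_space d \<Otimes>\<^sub>M lborel). fst p \<in> cone_ball d (min r (snd p)) A}"])
         (auto simp: indicator_def)
    show "(\<lambda>(x, s). ?K * ennreal (exp (- s / 2) / 2) * indicator (cone_ball d (min r s) A) x) \<in> borel_measurable (eucl_space d \<Otimes>\<^sub>M lborel)"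
      unfolding split_def by measurable
  qed
  also have "\<dots> = (\<integral>\<^sup>+s. ?K * ennreal (exp (- s / 2) / 2) * ennreal (radial_growth d (min r s)) * emeasure (eucl_space d) (cone_ball d 1 A) \<partial>lborel)"
  proof (intro nn_integral_cong)
    fix s :: real
    have "(\<integral>\<^sup>+x. ?K * ennreal (exp (- s / 2) / 2) * indicator (cone_ball d (min r s) A) x \<partial>eucl_space d) =
        ?K * ennreal (exp (- s / 2) / 2) * emeasure (eucl_space d) (cone_ball d (min r s) A)"
      using A by (subst nn_integral_cmult) auto
    then show "(\<integral>\<^sup>+x. ?K * ennreal (exp (- s / 2) / 2) * indicator (cone_ball d (min r s) A) x \<partial>eucl_space d) =
        ?K * ennreal (exp (- s / 2) / 2) * ennreal (radial_growth d (min r s)) * emeasure (eucl_space d) (cone_ball d 1 A)"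
      unfolding emeasure_cone_ball[OF A, of "min r s"] by (simp only: mult_ac)
  qed
  also have "\<dots> = (\<integral>\<^sup>+s. ?K * ennreal (exp (- s / 2) / 2) * ennreal (radial_growth d (min r s)) \<partial>lborel) * emeasure (eucl_space d) (cone_ball d 1 A)"
    by (subst nn_integral_multc) auto
  finally show ?thesis .
qed

text \<open>If the unit ball were null, \<open>gauss_cone_ball\<close> would make every ball null
  for the Gaussian law, which has mass 1. Finiteness comes from the enclosing cube.\<close>

lemma emeasure_unit_ball:
  shows "emeasure (eucl_space d) (unit_ball_d d) \<noteq> 0" "emeasure (eucl_space d) (unit_ball_d d) \<noteq> \<infinity>"
proof -
  interpret G: prob_space "gauss_d d" by (rule prob_space_gauss_d)
  show "emeasure (eucl_space d) (unit_ball_d d) \<noteq> 0"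
  proof
    assume 0: "emeasure (eucl_space d) (unit_ball_d d) = 0"
    have "emeasure (gauss_d d) (cone_ball d (real n) (space (eucl_space d))) = 0" for n
      using gauss_cone_ball[OF sets.top, of d "real n"] 0 by (simp add: unit_ball_eq_cone_ball)
    moreover have "(\<Union>n. cone_ball d (real n) (space (eucl_space d))) = space (eucl_space d)"
      using measurable_space[OF normalize_d_meas[of d]] real_arch_simple by (auto simp: cone_ball_def)
    ultimately have "emeasure (gauss_d d) (space (eucl_space d)) = 0"
      using emeasure_UN_eq_0[of "gauss_d d" "\<lambda>n::nat. cone_ball d (real n) (space (eucl_space d))"]
      by (auto intro!: cone_ball_sets)
    then show False using G.emeasure_space_1 by simp
  qed
  have "unit_ball_d d \<subseteq> PiE {..d} (\<lambda>_. {-1..1})"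
  proof
    fix x assume x: "x \<in> unit_ball_d d"
    have "x i \<in> {-1..1}" if i: "i \<le> d" for i
    proof -
      have "x i * x i \<le> inner_d d x x"
        unfolding inner_d_def using i by (intro member_le_sum) auto
      also have "\<dots> \<le> 1" using x by (simp add: unit_ball_d_def)
      finally have "(x i)\<^sup>2 \<le> 1" by (simp add: power2_eq_square)
      then show ?thesis by (simp add: abs_square_le_1 abs_le_iff)
    qed
    then show "x \<in> PiE {..d} (\<lambda>_. {-1..1})" using x by (auto simp: unit_ball_d_def space_eucl_space PiE_iff)
  qed
  then have "emeasure (eucl_space d) (unit_ball_d d) \<le> emeasure (eucl_space d) (PiE {..d} (\<lambda>_. {-1..1}))"
    unfolding eucl_space_def by (intro emeasure_mono sets_PiM_I_finite) auto
  also have "\<dots> = (\<Prod>i\<le>d. emeasure lborel {-1..1::real})"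
    unfolding eucl_space_def by (intro lborel_product.emeasure_PiM) auto
  also have "\<dots> = ennreal (\<Prod>i\<le>d. 2)"
    by (subst prod_ennreal[symmetric]) (auto intro!: prod.cong)
  also have "\<dots> < \<infinity>" by (rule ennreal_less_top[folded infinity_ennreal_def])
  finally show "emeasure (eucl_space d) (unit_ball_d d) \<noteq> \<infinity>" by simp
qed

section \<open>The uniform law as the direction of a Gaussian vector\<close>

lemma sets_uniform_sphere [measurable_cong, simp]: "sets (uniform_sphere d) = sets (eucl_space d)"
  by (simp add: uniform_sphere_def)

lemma space_uniform_sphere [simp]: "space (uniform_sphere d) = space (eucl_space d)"
  by (simp add: uniform_sphere_def)

lemma prob_space_uniform_sphere: "prob_space (uniform_sphere d)"
  unfolding uniform_sphere_def
  by (intro prob_space.prob_space_distr prob_space_uniform_measure emeasure_unit_ball) auto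

text \<open>Division by the volume of the unit ball turns the cone volume into the uniform law, and
  the choice of A as the whole space identifies the radial factor.\<close>

lemma gauss_polar:
  assumes A: "A \<in> sets (eucl_space d)"
  shows "emeasure (gauss_d d) (cone_ball d r A) =
    emeasure (gauss_d d) (cone_ball d r (space (eucl_space d))) * emeasure (uniform_sphere d) A"
proof -
  define b where "b = emeasure (eucl_space d) (unit_ball_d d)"
  have b: "b \<noteq> 0" "b \<noteq> \<infinity>" using emeasure_unit_ball[of d] by (auto simp: b_def)
  have "b * (x / b) = x" for x
    using b mult_divide_eq_ennreal[of b x] by (simp add: ennreal_times_divide mult.commute)
  then show ?thesis
    unfolding gauss_cone_ball[OF A] gauss_cone_ball[OF sets.top] uniform_sphere_eq_cone_ball[OF A]
      unit_ball_eq_cone_ball[symmetric] b_def[symmetric]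
    by (simp add: mult.assoc)
qed

lemma AE_uniform_sphere_unit: "AE z in uniform_sphere d. inner_d d z z = 1"
proof -
  have "AE x in eucl_space d. x \<notin> {x \<in> space (eucl_space d). inner_d d x x = 0}"
    using emeasure_origin[of d] by (intro AE_not_in) (auto simp: null_sets_def)
  then have "AE x in uniform_measure (eucl_space d) (unit_ball_d d). x \<notin> {x \<in> space (eucl_space d). inner_d d x x = 0}"
    by (intro AE_uniform_measureI) (auto simp: unit_ball_eq_cone_ball)
  moreover have "AE x in uniform_measure (eucl_space d) (unit_ball_d d). x \<in> space (eucl_space d)"
    using AE_space[of "uniform_measure (eucl_space d) (unit_ball_d d)"] by simp
  ultimately have "AE x in uniform_measure (eucl_space d) (unit_ball_d d). inner_d d (normalize_d d x) (normalize_d d x) = 1"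
  proof eventually_elim
    case (elim x)
    then have "inner_d d x x > 0" using inner_d_self_nonneg[of d x] by auto
    moreover have "inner_d d (normalize_d d x) (normalize_d d x) = inner_d d x x / (sqrt (inner_d d x x))\<^sup>2"
      by (simp add: inner_d_def normalize_d_def sum_divide_distrib power2_eq_square)
    ultimately show ?case by simp
  qed
  then show ?thesis unfolding uniform_sphere_def by (subst AE_distr_iff) auto
qed

declare component_meas [measurable del] \<comment> \<open>its conclusion unifies with unrelated measurability goals\<close>

text \<open>For fixed B both sides are finite measures in A. They agree on half-lines by
  \<open>gauss_polar\<close>, so they have the same distribution function and coincide.\<close>

lemma gauss_polar_independent:
  assumes A: "A \<in> sets borel" and B: "B \<in> sets (eucl_space d)"
  shows "emeasure (gauss_d d) {u \<in> space (eucl_space d). inner_d d u u \<in> A \<and> normalize_d d u \<in> B} =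
    emeasure (gauss_d d) {u \<in> space (eucl_space d). inner_d d u u \<in> A} * emeasure (uniform_sphere d) B"
proof -
  interpret G: prob_space "gauss_d d" by (rule prob_space_gauss_d)
  interpret U: prob_space "uniform_sphere d" by (rule prob_space_uniform_sphere)
  note [measurable] = A B
  define Q where "Q = (\<lambda>u. inner_d d u u)"
  have Q [measurable]: "Q \<in> borel_measurable (gauss_d d)" unfolding Q_def by measurable
  define S where "S = {u \<in> space (eucl_space d). normalize_d d u \<in> B}"
  have S [measurable]: "S \<in> sets (gauss_d d)" unfolding S_def by measurable
  define N1 where "N1 = distr (density (gauss_d d) (indicator S)) borel Q"
  define N2 where "N2 = density (distr (gauss_d d) borel Q) (\<lambda>_. emeasure (uniform_sphere d) B)"
  have N1: "emeasure N1 A = emeasure (gauss_d d) {u \<in> space (eucl_space d). Q u \<in> A \<and> normalize_d d u \<in> B}"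
    if "A \<in> sets borel" for A
  proof -
    have [measurable]: "A \<in> sets borel" by fact
    have "emeasure N1 A = emeasure (density (gauss_d d) (indicator S)) (Q -` A \<inter> space (gauss_d d))"
      unfolding N1_def by (subst emeasure_distr) (auto simp: that)
    also have "\<dots> = (\<integral>\<^sup>+u. indicator S u * indicator (Q -` A \<inter> space (gauss_d d)) u \<partial>gauss_d d)"
      by (subst emeasure_density) auto
    also have "\<dots> = (\<integral>\<^sup>+u. indicator {u \<in> space (eucl_space d). Q u \<in> A \<and> normalize_d d u \<in> B} u \<partial>gauss_d d)"
      by (intro nn_integral_cong) (auto simp: indicator_def S_def)
    also have "\<dots> = emeasure (gauss_d d) {u \<in> space (eucl_space d). Q u \<in> A \<and> normalize_d d u \<in> B}"
      unfolding Q_def by (intro nn_integral_indicator) measurable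
    finally show ?thesis .
  qed
  have N2: "emeasure N2 A = emeasure (gauss_d d) {u \<in> space (eucl_space d). Q u \<in> A} * emeasure (uniform_sphere d) B"
    if "A \<in> sets borel" for A
  proof -
    have [measurable]: "A \<in> sets borel" by fact
    have "emeasure N2 A = emeasure (uniform_sphere d) B * emeasure (gauss_d d) (Q -` A \<inter> space (gauss_d d))"
      unfolding N2_def by (subst emeasure_density_const) (auto simp: emeasure_distr)
    also have "Q -` A \<inter> space (gauss_d d) = {u \<in> space (eucl_space d). Q u \<in> A}" by auto
    finally show ?thesis by (simp add: mult.commute)
  qed
  have le1: "emeasure (gauss_d d) X < \<infinity>" for X
    using G.emeasure_finite[of X] by (simp add: less_top[symmetric])
  have lt: "emeasure (gauss_d d) X * emeasure (uniform_sphere d) B < \<infinity>" for X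
  proof -
    have "emeasure (uniform_sphere d) B < \<infinity>" using U.emeasure_finite[of B] by (simp add: less_top[symmetric])
    then show ?thesis using le1[of X] by (simp add: ennreal_mult_less_top)
  qed
  have fin: "finite_borel_measure N" if "sets N = sets borel" "emeasure N UNIV \<noteq> \<infinity>" for N :: "real measure"
    using that sets_eq_imp_space_eq[OF that(1)]
    by (intro finite_borel_measure.intro finite_measureI finite_borel_measure_axioms.intro) auto
  have f1: "finite_borel_measure N1"
    using N1[of UNIV] le1 by (intro fin) (auto simp: N1_def less_top)
  have f2: "finite_borel_measure N2"
    using N2[of UNIV] lt by (intro fin) (auto simp: N2_def less_top)
  have "cdf N1 = cdf N2"
  proof
    fix r
    have "emeasure N1 {..r} = emeasure (gauss_d d) (cone_ball d r B)"
      by (subst N1) (auto simp: cone_ball_def Q_def intro!: arg_cong[of _ _ "emeasure (gauss_d d)"])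
    also have "\<dots> = emeasure (gauss_d d) (cone_ball d r (space (eucl_space d))) * emeasure (uniform_sphere d) B"
      by (rule gauss_polar[OF B])
    also have "cone_ball d r (space (eucl_space d)) = {u \<in> space (eucl_space d). Q u \<in> {..r}}"
      using measurable_space[OF normalize_d_meas[of d]] by (auto simp: cone_ball_def Q_def)
    also have "emeasure (gauss_d d) \<dots> * emeasure (uniform_sphere d) B = emeasure N2 {..r}"
      by (subst N2) auto
    finally show "cdf N1 r = cdf N2 r" by (simp add: cdf_def measure_def)
  qed
  then have "N1 = N2" by (rule cdf_unique'[OF f1 f2])
  then show ?thesis using N1[OF A] N2[OF A] by (simp add: Q_def)
qed

lemma nn_integral_gauss_polar:
  assumes f [measurable]: "f \<in> borel_measurable borel" and g [measurable]: "g \<in> borel_measurable (eucl_space d)"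
  shows "(\<integral>\<^sup>+u. f (inner_d d u u) * g (normalize_d d u) \<partial>gauss_d d) =
    (\<integral>\<^sup>+u. f (inner_d d u u) \<partial>gauss_d d) * (\<integral>\<^sup>+z. g z \<partial>uniform_sphere d)"
proof -
  interpret G: prob_space "gauss_d d" by (rule prob_space_gauss_d)
  interpret U: prob_space "uniform_sphere d" by (rule prob_space_uniform_sphere)
  define Q where "Q = (\<lambda>u. inner_d d u u)"
  have Q [measurable]: "Q \<in> borel_measurable (gauss_d d)" unfolding Q_def by measurable
  have N [measurable]: "normalize_d d \<in> measurable (gauss_d d) (uniform_sphere d)" by measurable
  let ?D = "distr (gauss_d d) borel Q"
  interpret D: prob_space ?D by (intro G.prob_space_distr) simp
  have eq: "?D \<Otimes>\<^sub>M uniform_sphere d = distr (gauss_d d) (?D \<Otimes>\<^sub>M uniform_sphere d) (\<lambda>u. (Q u, normalize_d d u))"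
  proof (rule pair_measure_eqI)
    fix A B assume A: "A \<in> sets ?D" and B: "B \<in> sets (uniform_sphere d)"
    have [measurable]: "A \<in> sets borel" "B \<in> sets (uniform_sphere d)" using A B by auto
    have "emeasure (distr (gauss_d d) (?D \<Otimes>\<^sub>M uniform_sphere d) (\<lambda>u. (Q u, normalize_d d u))) (A \<times> B)
        = emeasure (gauss_d d) ((\<lambda>u. (Q u, normalize_d d u)) -` (A \<times> B) \<inter> space (gauss_d d))"
      by (rule emeasure_distr) measurable
    also have "(\<lambda>u. (Q u, normalize_d d u)) -` (A \<times> B) \<inter> space (gauss_d d) =
        {u \<in> space (eucl_space d). inner_d d u u \<in> A \<and> normalize_d d u \<in> B}"
      by (auto simp: Q_def)
    also have "emeasure (gauss_d d) \<dots> = emeasure (gauss_d d) {u \<in> space (eucl_space d). inner_d d u u \<in> A} * emeasure (uniform_sphere d) B"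
      using A B by (intro gauss_polar_independent) auto
    also have "{u \<in> space (eucl_space d). inner_d d u u \<in> A} = Q -` A \<inter> space (gauss_d d)" by (auto simp: Q_def)
    also have "emeasure (gauss_d d) \<dots> = emeasure ?D A"
      by (rule emeasure_distr[symmetric]) auto
    finally show "emeasure ?D A * emeasure (uniform_sphere d) B =
        emeasure (distr (gauss_d d) (?D \<Otimes>\<^sub>M uniform_sphere d) (\<lambda>u. (Q u, normalize_d d u))) (A \<times> B)" ..
  qed (auto intro: D.sigma_finite_measure_axioms U.sigma_finite_measure_axioms)
  have "(\<integral>\<^sup>+u. f (Q u) * g (normalize_d d u) \<partial>gauss_d d) =
      (\<integral>\<^sup>+p. f (fst p) * g (snd p) \<partial>distr (gauss_d d) (?D \<Otimes>\<^sub>M uniform_sphere d) (\<lambda>u. (Q u, normalize_d d u)))"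
    by (subst nn_integral_distr) auto
  also have "\<dots> = (\<integral>\<^sup>+p. f (fst p) * g (snd p) \<partial>(?D \<Otimes>\<^sub>M uniform_sphere d))"
    unfolding eq[symmetric] ..
  also have "\<dots> = (\<integral>\<^sup>+t. \<integral>\<^sup>+z. f t * g z \<partial>uniform_sphere d \<partial>?D)"
    by (subst U.nn_integral_fst[symmetric]) auto
  also have "\<dots> = (\<integral>\<^sup>+t. f t \<partial>?D) * (\<integral>\<^sup>+z. g z \<partial>uniform_sphere d)"
    by (simp add: nn_integral_cmult nn_integral_multc)
  also have "(\<integral>\<^sup>+t. f t \<partial>?D) = (\<integral>\<^sup>+u. f (Q u) \<partial>gauss_d d)"
    by (subst nn_integral_distr) auto
  finally show ?thesis by (simp add: Q_def)
qed


section \<open>Moments of linear forms\<close>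

lemma inner_d_add_left: "inner_d d (\<lambda>i. a * x i + b * y i) z = a * inner_d d x z + b * inner_d d y z"
  by (simp add: inner_d_def sum.distrib sum_distrib_left distrib_right mult.assoc)

lemma inner_d_commute: "inner_d d x y = inner_d d y x"
  by (simp add: inner_d_def mult.commute)

lemma inner_d_minus_left: "inner_d d (\<lambda>i. - x i) z = - inner_d d x z"
  by (simp add: inner_d_def sum_negf)

lemma inner_d_Cauchy_Schwarz: "(inner_d d x y)\<^sup>2 \<le> inner_d d x x * inner_d d y y"
  using Cauchy_Schwarz_ineq_sum[of x y "{..d}"] by (simp add: inner_d_def power2_eq_square)

lemma abs_inner_d_le:
  assumes "inner_d d y y = 1"
  shows "\<bar>inner_d d x y\<bar> \<le> sqrt (inner_d d x x)"
  using inner_d_Cauchy_Schwarz[of d x y] assms by (simp add: real_le_rsqrt)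

text \<open>The characteristic function is a product of one-dimensional normal ones and depends on x
  only through |x|. The form as a scaled standard normal variable includes x = 0.\<close>

lemma distr_gauss_inner:
  "distr (gauss_d d) borel (inner_d d x) = distr std_normal_distribution borel (\<lambda>u. sqrt (inner_d d x x) * u)"
proof -
  interpret G: prob_space "gauss_d d" by (rule prob_space_gauss_d)
  interpret S: real_distribution std_normal_distribution by (rule real_dist_normal_dist)
  interpret N: product_sigma_finite "\<lambda>_::nat. std_normal_distribution"
    unfolding product_sigma_finite_def using S.sigma_finite_measure_axioms by simp
  have r: "real_distribution (distr (gauss_d d) borel (inner_d d x))"
    by (intro G.real_distribution_distr) measurable
  have r': "real_distribution (distr std_normal_distribution borel (\<lambda>u. sqrt (inner_d d x x) * u))"
    by (intro S.real_distribution_distr) measurable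
  have "char (distr (gauss_d d) borel (inner_d d x)) t =
      char (distr std_normal_distribution borel (\<lambda>u. sqrt (inner_d d x x) * u)) t" for t
  proof -
    have "char (distr (gauss_d d) borel (inner_d d x)) t = (\<integral>u. iexp (t * inner_d d x u) \<partial>gauss_d d)"
      unfolding char_def by (subst integral_distr) auto
    also have "\<dots> = (\<integral>u. (\<Prod>i\<le>d. iexp (t * x i * u i)) \<partial>gauss_d d)"
      by (simp add: inner_d_def exp_sum[symmetric] sum_distrib_left mult_ac)
    also have "\<dots> = (\<Prod>i\<le>d. \<integral>y. iexp (t * x i * y) \<partial>std_normal_distribution)"
      unfolding gauss_d_def
      by (intro N.product_integral_prod[of "{..d}" "\<lambda>i y. iexp (t * x i * y)"]) (auto intro!: S.integrable_const_bound[where B=1])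
    also have "\<dots> = (\<Prod>i\<le>d. char std_normal_distribution (t * x i))"
      by (simp add: char_def)
    also have "\<dots> = of_real (\<Prod>i\<le>d. exp (- ((t * x i)\<^sup>2) / 2))"
      by (simp only: char_std_normal_distribution of_real_prod)
    also have "(\<Prod>i\<le>d. exp (- ((t * x i)\<^sup>2) / 2)) = exp (- ((t * sqrt (inner_d d x x))\<^sup>2) / 2)"
      unfolding exp_sum[OF finite_atMost, symmetric]
      by (simp add: power_mult_distrib inner_d_self_nonneg, simp add: inner_d_def sum_negf sum_divide_distrib[symmetric] sum_distrib_left power2_eq_square)
    also have "complex_of_real (exp (- ((t * sqrt (inner_d d x x))\<^sup>2) / 2)) = char std_normal_distribution (t * sqrt (inner_d d x x))"
      by (simp only: char_std_normal_distribution)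
    also have "\<dots> = char (distr std_normal_distribution borel (\<lambda>u. sqrt (inner_d d x x) * u)) t"
      unfolding char_def by (subst integral_distr) (auto simp: mult.assoc)
    finally show ?thesis .
  qed
  then show ?thesis by (intro Levy_uniqueness r r' ext)
qed

text \<open>Neither 0 nor infinite: this permits cancellation in the extended nonnegative
  reals.\<close>

lemma std_normal_half_moment:
  defines "h \<equiv> \<lambda>m. (\<integral>\<^sup>+u. ennreal (max 0 u ^ m) \<partial>std_normal_distribution)"
  shows "h m \<noteq> 0" "h m \<noteq> \<infinity>"
proof -
  show "h m \<noteq> 0"
  proof
    assume "h m = 0"
    then have "AE u in std_normal_distribution. ennreal (max 0 u ^ m) = 0"
      unfolding h_def by (subst (asm) nn_integral_0_iff_AE) auto
    then have "AE u in lborel. ennreal (max 0 u ^ m) = 0"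
      by (subst (asm) AE_density) (auto simp: normal_density_pos)
    then have "AE u in lborel. u \<notin> {0<..<1::real}"
    proof eventually_elim
      case (elim u)
      show ?case
      proof
        assume "u \<in> {0<..<1}"
        then have "0 < max 0 u ^ m" by (intro zero_less_power) auto
        moreover have "max 0 u ^ m \<le> 0" using elim by (simp only: ennreal_eq_0_iff)
        ultimately show False by linarith
      qed
    qed
    then have "emeasure lborel {0<..<1::real} = 0"
      by (subst (asm) AE_iff_null_sets[symmetric]) auto
    then show False by simp
  qed
  have "h m \<le> (\<integral>\<^sup>+u. ennreal (norm (u ^ m)) \<partial>std_normal_distribution)"
    unfolding h_def by (intro nn_integral_mono ennreal_leI) (auto simp: power_abs intro!: power_mono)
  also have "\<dots> < \<infinity>"
  proof -
    have "integrable std_normal_distribution (\<lambda>u. u ^ m)"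
      using integrable_std_normal_moment[of m] by (subst integrable_density) auto
    then show ?thesis unfolding integrable_iff_bounded by simp
  qed
  finally show "h m \<noteq> \<infinity>" by simp
qed

text \<open>Positive parts keep the integrand nonnegative for odd m, so that
  \<open>nn_integral_gauss_polar\<close> applies.\<close>

definition half_moment :: "nat \<Rightarrow> nat \<Rightarrow> (nat \<Rightarrow> real) \<Rightarrow> ennreal" where
  "half_moment d m x = (\<integral>\<^sup>+z. ennreal (max 0 (inner_d d x z) ^ m) \<partial>uniform_sphere d)"

text \<open>For a Gaussian vector U the mean of the m-th power of the positive part of x . U is
  computed twice: its normal law gives |x|^m h, polar independence gives c times the half moment on
  the sphere. Comparison with the unit vector e eliminates h.\<close>

lemma half_moment_homogeneous:
  assumes m: "m \<ge> 1" and e: "inner_d d e e = 1"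
  shows "half_moment d m x = ennreal (sqrt (inner_d d x x) ^ m) * half_moment d m e"
proof -
  define c where "c = (\<integral>\<^sup>+u. ennreal (sqrt (inner_d d u u) ^ m) \<partial>gauss_d d)"
  define h where "h = (\<integral>\<^sup>+u. ennreal (max 0 u ^ m) \<partial>std_normal_distribution)"
  have h: "h \<noteq> 0" "h \<noteq> \<infinity>" using std_normal_half_moment[of m] by (auto simp: h_def)
  have key: "ennreal (sqrt (inner_d d x x) ^ m) * h = c * half_moment d m x" for x
  proof -
    have "ennreal (sqrt (inner_d d x x) ^ m) * h =
        (\<integral>\<^sup>+u. ennreal (max 0 (sqrt (inner_d d x x) * u) ^ m) \<partial>std_normal_distribution)"
      unfolding h_def
    proof (subst nn_integral_cmult[symmetric], simp, intro nn_integral_cong)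
      fix u :: real
      have "sqrt (inner_d d x x) * max 0 u = max 0 (sqrt (inner_d d x x) * u)"
        using inner_d_self_nonneg[of d x] by (auto simp: max_def zero_le_mult_iff mult_le_0_iff)
      then show "ennreal (sqrt (inner_d d x x) ^ m) * ennreal (max 0 u ^ m) = ennreal (max 0 (sqrt (inner_d d x x) * u) ^ m)"
        using inner_d_self_nonneg[of d x] by (simp add: ennreal_mult[symmetric] power_mult_distrib[symmetric])
    qed
    also have "\<dots> = (\<integral>\<^sup>+y. ennreal (max 0 y ^ m) \<partial>distr std_normal_distribution borel (\<lambda>u. sqrt (inner_d d x x) * u))"
      by (subst nn_integral_distr) auto
    also have "\<dots> = (\<integral>\<^sup>+u. ennreal (max 0 (inner_d d x u) ^ m) \<partial>gauss_d d)"
      unfolding distr_gauss_inner[symmetric] by (subst nn_integral_distr) auto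
    also have "\<dots> = (\<integral>\<^sup>+u. ennreal (sqrt (inner_d d u u) ^ m) * ennreal (max 0 (inner_d d x (normalize_d d u)) ^ m) \<partial>gauss_d d)"
    proof (intro nn_integral_cong)
      fix u
      have "max 0 (inner_d d x u) = sqrt (inner_d d u u) * max 0 (inner_d d x (normalize_d d u))"
      proof (cases "inner_d d u u = 0")
        case True
        then have "inner_d d x u = 0" using inner_d_Cauchy_Schwarz[of d x u] by simp
        then show ?thesis using True by simp
      next
        case False
        then have p: "inner_d d u u > 0" using inner_d_self_nonneg[of d u] by simp
        have "inner_d d x (normalize_d d u) = inner_d d x u / sqrt (inner_d d u u)"
          by (simp add: inner_d_def normalize_d_def sum_divide_distrib)
        then show ?thesis
        proof (cases "inner_d d x u \<ge> 0")
          case True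
          with p \<open>inner_d d x (normalize_d d u) = _\<close> show ?thesis by (simp add: max.absorb2)
        next
          case False
          with p have "inner_d d x u / sqrt (inner_d d u u) \<le> 0" by (simp add: divide_nonpos_pos)
          with False \<open>inner_d d x (normalize_d d u) = _\<close> show ?thesis by (simp add: max.absorb1)
        qed
      qed
      then show "ennreal (max 0 (inner_d d x u) ^ m) =
          ennreal (sqrt (inner_d d u u) ^ m) * ennreal (max 0 (inner_d d x (normalize_d d u)) ^ m)"
        using inner_d_self_nonneg[of d u] by (simp add: ennreal_mult[symmetric] power_mult_distrib[symmetric])
    qed
    also have "\<dots> = c * half_moment d m x"
      unfolding c_def half_moment_def
      by (rule nn_integral_gauss_polar[of "\<lambda>t. ennreal (sqrt t ^ m)" "\<lambda>z. ennreal (max 0 (inner_d d x z) ^ m)"]) auto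
    finally show ?thesis .
  qed
  \<comment> \<open>Since h is neither 0 nor infinite, this product forces the same for c, which can
    then be cancelled.\<close>
  have he: "h = c * half_moment d m e" using key[of e] e by simp
  have "c \<noteq> 0" using he h by auto
  moreover have "c \<noteq> \<infinity>"
  proof
    assume "c = \<infinity>"
    with he h have "half_moment d m e = 0" by (auto simp: ennreal_top_mult split: if_splits)
    with he h show False by simp
  qed
  moreover have "c * half_moment d m x = c * (ennreal (sqrt (inner_d d x x) ^ m) * half_moment d m e)"
    using key[of x] unfolding he by (simp add: mult_ac)
  ultimately show ?thesis by (simp add: ennreal_mult_cancel_left)
qed

definition sphere_moment :: "nat \<Rightarrow> nat \<Rightarrow> real" where
  "sphere_moment d m = (\<integral>z. (z 0) ^ m \<partial>uniform_sphere d)"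

definition basis_vec :: "nat \<Rightarrow> nat \<Rightarrow> nat \<Rightarrow> real" where
  "basis_vec d j = (\<lambda>i\<in>{..d}. if i = j then 1 else 0)"

lemma inner_basis_vec:
  assumes "j \<le> d"
  shows "inner_d d (basis_vec d j) z = z j"
proof -
  have "inner_d d (basis_vec d j) z = (\<Sum>i\<le>d. if i = j then z i else 0)"
    unfolding inner_d_def by (intro sum.cong) (auto simp: basis_vec_def)
  then show ?thesis using assms by simp
qed

lemma basis_vec_unit: "j \<le> d \<Longrightarrow> inner_d d (basis_vec d j) (basis_vec d j) = 1"
  by (subst inner_basis_vec) (simp_all add: basis_vec_def)

lemma basis_vec_orth: "j \<le> d \<Longrightarrow> i \<le> d \<Longrightarrow> i \<noteq> j \<Longrightarrow> inner_d d (basis_vec d j) (basis_vec d i) = 0"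
  by (subst inner_basis_vec) (simp_all add: basis_vec_def)

lemma integrable_sphere_bounded:
  fixes f :: "(nat \<Rightarrow> real) \<Rightarrow> real"
  assumes "f \<in> borel_measurable (eucl_space d)" "\<And>z. inner_d d z z = 1 \<Longrightarrow> \<bar>f z\<bar> \<le> B"
  shows "integrable (uniform_sphere d) f"
proof -
  interpret U: prob_space "uniform_sphere d" by (rule prob_space_uniform_sphere)
  show ?thesis
  proof (rule U.integrable_const_bound)
    show "AE z in uniform_sphere d. norm (f z) \<le> B"
      by (rule eventually_mono[OF AE_uniform_sphere_unit]) (simp add: assms(2))
  qed (use assms in simp)
qed

lemma integrable_sphere_inner_powers:
  "integrable (uniform_sphere d) (\<lambda>z. inner_d d x z ^ a * inner_d d y z ^ b)"
proof (rule integrable_sphere_bounded)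
  show "\<bar>inner_d d x z ^ a * inner_d d y z ^ b\<bar> \<le> sqrt (inner_d d x x) ^ a * sqrt (inner_d d y y) ^ b"
    if "inner_d d z z = 1" for z
    unfolding abs_mult power_abs using abs_inner_d_le[OF that]
    by (intro mult_mono power_mono) (auto simp: inner_d_self_nonneg)
qed measurable

text \<open>For m \<ge> 1 the identity t^m = max 0 t ^ m + (-1)^m max 0 (-t) ^ m reduces the signed
  moment to the half moments of x and - x, which are homogeneous.\<close>

lemma sphere_inner_moment:
  "(\<integral>z. inner_d d x z ^ m \<partial>uniform_sphere d) = sphere_moment d m * sqrt (inner_d d x x) ^ m"
proof (cases "m = 0")
  case True
  then show ?thesis by (simp add: sphere_moment_def)
next
  case False
  then have m: "m \<ge> 1" by simp
  define e where "e = basis_vec d 0"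
  have e: "inner_d d e e = 1" by (simp add: e_def basis_vec_unit)
  have bound: "\<bar>max 0 (inner_d d x z) ^ m\<bar> \<le> sqrt (inner_d d x x) ^ m" if "inner_d d z z = 1" for x z
  proof -
    have "\<bar>max 0 (inner_d d x z)\<bar> \<le> sqrt (inner_d d x x)"
      using abs_inner_d_le[OF that, of x] inner_d_self_nonneg[of d x] by linarith
    then show ?thesis unfolding power_abs by (rule power_mono) simp
  qed
  have int: "integrable (uniform_sphere d) (\<lambda>z. max 0 (inner_d d x z) ^ m)" for x
    by (rule integrable_sphere_bounded[where B="sqrt (inner_d d x x) ^ m"]) (measurable, rule bound)
  define j where "j = (\<lambda>x. \<integral>z. max 0 (inner_d d x z) ^ m \<partial>uniform_sphere d)"
  have jh: "half_moment d m x = ennreal (j x)" for x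
    unfolding half_moment_def j_def using int by (intro nn_integral_eq_integral) auto
  have j0: "0 \<le> j x" for x unfolding j_def by (intro integral_nonneg_AE) auto
  have ej: "ennreal (j x) = ennreal (sqrt (inner_d d x x) ^ m * j e)" for x
    using half_moment_homogeneous[OF m e, of x] inner_d_self_nonneg[of d x] j0[of e]
    by (simp add: jh ennreal_mult)
  have jx: "j x = sqrt (inner_d d x x) ^ m * j e" for x
    using ej[of x] j0[of x] j0[of e] inner_d_self_nonneg[of d x] by (simp only: ennreal_inj mult_nonneg_nonneg zero_le_power real_sqrt_ge_zero)
  have mom: "(\<integral>z. inner_d d x z ^ m \<partial>uniform_sphere d) = (1 + (- 1) ^ m) * j e * sqrt (inner_d d x x) ^ m" for x
  proof -
    have z: "(0::real) ^ m = 0" using m by (rule zero_power[OF less_le_trans[OF zero_less_one]])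
    have split: "t ^ m = max 0 t ^ m + (- 1) ^ m * max 0 (- t) ^ m" for t :: real
    proof (cases "t \<ge> 0")
      case True
      then show ?thesis by (simp only: max.absorb2 max.absorb1 neg_le_0_iff_le z mult_zero_right add_0_right)
    next
      case False
      then have "max 0 t = 0" "max 0 (- t) = - t" by auto
      moreover have "(- 1) ^ m * (- t) ^ m = t ^ m"
        unfolding power_mult_distrib[symmetric] by (simp only: mult_minus1 minus_minus)
      ultimately show ?thesis by (simp only: z add_0_left)
    qed
    have "(\<integral>z. inner_d d x z ^ m \<partial>uniform_sphere d) =
        (\<integral>z. max 0 (inner_d d x z) ^ m + (- 1) ^ m * max 0 (inner_d d (\<lambda>i. - x i) z) ^ m \<partial>uniform_sphere d)"
      by (intro Bochner_Integration.integral_cong refl) (subst split, simp only: inner_d_minus_left)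
    also have "\<dots> = j x + (- 1) ^ m * j (\<lambda>i. - x i)"
      unfolding j_def using int[of x] int[of "\<lambda>i. - x i"]
      by (subst Bochner_Integration.integral_add) (simp_all only: integrable_mult_right integral_mult_right_zero)
    also have "\<dots> = (1 + (- 1) ^ m) * j e * sqrt (inner_d d x x) ^ m"
      unfolding jx[of x] jx[of "\<lambda>i. - x i"] by (simp add: inner_d_def algebra_simps)
    finally show ?thesis .
  qed
  have "sphere_moment d m = (1 + (- 1) ^ m) * j e"
    using mom[of e] e by (simp add: sphere_moment_def e_def inner_basis_vec)
  then show ?thesis using mom[of x] by simp
qed

lemma sphere_moment_odd:
  assumes "odd m"
  shows "sphere_moment d m = 0"
proof -
  have "(\<integral>z. inner_d d (\<lambda>i. - basis_vec d 0 i) z ^ m \<partial>uniform_sphere d) = (\<integral>z. inner_d d (basis_vec d 0) z ^ m \<partial>uniform_sphere d)"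
    unfolding sphere_inner_moment by (simp add: inner_d_def)
  then show ?thesis
    using assms by (simp add: inner_d_minus_left inner_basis_vec sphere_moment_def)
qed

section \<open>Bivariate moments on the sphere\<close>

text \<open>For unit vectors x, y with inner product \<rho> the quadratic 1 + 2 \<rho> s + s^2 is |s
  x + y|^2. Each factor \<rho> comes with a factor s, so the coefficient of s^a has degree at most a
  in \<rho>; all degree bounds for convolutions originate here.\<close>

lemma trinomial_coeff_poly:
  "\<exists>P. degree P \<le> a \<and> (\<forall>\<rho>::real. poly P \<rho> = coeff ([:1, 2 * \<rho>, 1:] ^ j) a)"
proof (induction j arbitrary: a)
  case 0
  show ?case by (rule exI[of _ "if a = 0 then 1 else 0"]) (auto simp: coeff_1)
next
  case (Suc j)
  obtain P where P: "\<And>a. degree (P a) \<le> a" "\<And>a (\<rho>::real). poly (P a) \<rho> = coeff ([:1, 2 * \<rho>, 1:] ^ j) a"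
    using Suc by metis
  have co: "coeff ([:1, 2 * \<rho>, 1:] ^ Suc j) a = coeff ([:1, 2 * \<rho>, 1:] ^ j) a
      + (if a \<ge> 1 then 2 * \<rho> * coeff ([:1, 2 * \<rho>, 1:] ^ j) (a - 1) else 0)
      + (if a \<ge> 2 then coeff ([:1, 2 * \<rho>, 1:] ^ j) (a - 2) else 0)" for \<rho> :: real
    by (auto simp: coeff_pCons numeral_2_eq_2 split: nat.splits)
  define R where "R = P a + (if a \<ge> 1 then [:0, 2:] * P (a - 1) else 0) + (if a \<ge> 2 then P (a - 2) else 0)"
  have "degree ([:0, 2:] * P (a - 1)) \<le> a" if "a \<ge> 1"
    using degree_mult_le[of "[:0, 2:]" "P (a - 1)"] P(1)[of "a - 1"] that by simp
  then have "degree R \<le> a"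
    unfolding R_def using P(1)[of a] order_trans[OF P(1)[of "a - 2"], of a] by (intro degree_add_le) auto
  moreover have "poly R \<rho> = coeff ([:1, 2 * \<rho>, 1:] ^ Suc j) a" for \<rho>
    unfolding co R_def by (auto simp: P(2))
  ultimately show ?case by blast
qed

abbreviation unit_d :: "nat \<Rightarrow> (nat \<Rightarrow> real) \<Rightarrow> bool" where
  "unit_d d x \<equiv> inner_d d x x = 1"

text \<open>The moment of order a + b of (s x + y) . Z is a polynomial in s in two ways, by the
  binomial theorem and by homogeneity, and the coefficients of s^a are compared. In odd order the
  moment vanishes, so no odd power of a square root occurs.\<close>

lemma sphere_bimoment:
  assumes x: "unit_d d x" and y: "unit_d d y"
  shows "real ((a + b) choose a) * (\<integral>z. inner_d d x z ^ a * inner_d d y z ^ b \<partial>uniform_sphere d) =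
    sphere_moment d (a + b) * (if even (a + b) then coeff ([:1, 2 * inner_d d x y, 1:] ^ ((a + b) div 2)) a else 0)"
proof -
  define m where "m = a + b"
  define \<rho> where "\<rho> = inner_d d x y"
  define E where "E = (\<lambda>a b. \<integral>z. inner_d d x z ^ a * inner_d d y z ^ b \<partial>uniform_sphere d)"
  define p1 where "p1 = (\<Sum>i\<le>m. monom (real (m choose i) * E i (m - i)) i)"
  define p2 where "p2 = smult (sphere_moment d m) (if even m then [:1, 2 * \<rho>, 1:] ^ (m div 2) else 0)"
  have "poly p1 s = poly p2 s" for s
  proof -
    have "poly p1 s = (\<Sum>i\<le>m. real (m choose i) * s ^ i * E i (m - i))"
      by (simp add: p1_def poly_sum poly_monom mult_ac)
    also have "\<dots> = (\<integral>z. (\<Sum>i\<le>m. real (m choose i) * s ^ i * (inner_d d x z ^ i * inner_d d y z ^ (m - i))) \<partial>uniform_sphere d)"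
      unfolding E_def using integrable_sphere_inner_powers
      by (subst Bochner_Integration.integral_sum) auto
    also have "\<dots> = (\<integral>z. inner_d d (\<lambda>i. s * x i + 1 * y i) z ^ m \<partial>uniform_sphere d)"
      unfolding inner_d_add_left binomial_ring
      by (intro Bochner_Integration.integral_cong sum.cong refl) (simp add: power_mult_distrib mult_ac)
    also have "\<dots> = sphere_moment d m * sqrt (inner_d d (\<lambda>i. s * x i + 1 * y i) (\<lambda>i. s * x i + 1 * y i)) ^ m"
      by (rule sphere_inner_moment)
    also have "inner_d d (\<lambda>i. s * x i + 1 * y i) (\<lambda>i. s * x i + 1 * y i) = s\<^sup>2 + 2 * s * \<rho> + 1"
      unfolding inner_d_add_left inner_d_commute[of d x "\<lambda>i. s * x i + 1 * y i"]
        inner_d_commute[of d y "\<lambda>i. s * x i + 1 * y i"] x y \<rho>_def inner_d_commute[of d y x]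
      by (simp add: power2_eq_square algebra_simps)
    also have "sphere_moment d m * sqrt (s\<^sup>2 + 2 * s * \<rho> + 1) ^ m = poly p2 s"
    proof (cases "even m")
      case True
      have "0 \<le> inner_d d (\<lambda>i. s * x i + 1 * y i) (\<lambda>i. s * x i + 1 * y i)" by (rule inner_d_self_nonneg)
      then have nn: "0 \<le> s\<^sup>2 + 2 * s * \<rho> + 1"
        unfolding \<open>inner_d d (\<lambda>i. s * x i + 1 * y i) (\<lambda>i. s * x i + 1 * y i) = s\<^sup>2 + 2 * s * \<rho> + 1\<close> .
      obtain n where n: "m = 2 * n" using True by (elim evenE)
      have "sqrt (s\<^sup>2 + 2 * s * \<rho> + 1) ^ m = (s\<^sup>2 + 2 * s * \<rho> + 1) ^ n"
        unfolding n power_mult using nn by simp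
      also have "(s\<^sup>2 + 2 * s * \<rho> + 1) ^ n = poly [:1, 2 * \<rho>, 1:] s ^ n"
        by (simp add: algebra_simps power2_eq_square)
      finally have "sqrt (s\<^sup>2 + 2 * s * \<rho> + 1) ^ m = poly [:1, 2 * \<rho>, 1:] s ^ n" .
      moreover have "poly p2 s = sphere_moment d m * poly [:1, 2 * \<rho>, 1:] s ^ n"
        by (simp add: p2_def n del: poly_pCons)
      ultimately show ?thesis by (simp only:)
    next
      case False
      then show ?thesis by (simp add: p2_def sphere_moment_odd)
    qed
    finally show ?thesis .
  qed
  then have "p1 = p2" by (simp add: poly_eq_poly_eq_iff[symmetric] fun_eq_iff)
  then have "coeff p1 a = coeff p2 a" by simp
  moreover have "coeff p1 a = real (m choose a) * E a (m - a)"
  proof -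
    have "coeff p1 a = (\<Sum>i\<le>m. if i = a then real (m choose i) * E i (m - i) else 0)"
      unfolding p1_def by (simp add: coeff_sum)
    also have "\<dots> = real (m choose a) * E a (m - a)" by (simp add: m_def)
    finally show ?thesis .
  qed
  ultimately show ?thesis by (simp add: p2_def m_def E_def \<rho>_def)
qed

text \<open>The trinomial coefficient yields degree at most a; exchanging x and y yields degree at
  most b.\<close>

lemma sphere_bimoment_poly:
  "\<exists>P. degree P \<le> min a b \<and> (\<forall>x y. unit_d d x \<longrightarrow> unit_d d y \<longrightarrow>
     (\<integral>z. inner_d d x z ^ a * inner_d d y z ^ b \<partial>uniform_sphere d) = poly P (inner_d d x y))"
proof -
  have le: "\<exists>P. degree P \<le> a \<and> (\<forall>x y. unit_d d x \<longrightarrow> unit_d d y \<longrightarrow>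
     (\<integral>z. inner_d d x z ^ a * inner_d d y z ^ b \<partial>uniform_sphere d) = poly P (inner_d d x y))" for a b
  proof -
    obtain P where P: "degree P \<le> a" "\<And>\<rho>::real. poly P \<rho> = coeff ([:1, 2 * \<rho>, 1:] ^ ((a + b) div 2)) a"
      using trinomial_coeff_poly[of a "(a + b) div 2"] by auto
    define c where "c = (if even (a + b) then sphere_moment d (a + b) / real ((a + b) choose a) else 0)"
    have pos: "real ((a + b) choose a) > 0" by simp
    have "(\<integral>z. inner_d d x z ^ a * inner_d d y z ^ b \<partial>uniform_sphere d) = poly (smult c P) (inner_d d x y)"
      if "unit_d d x" "unit_d d y" for x y
    proof -
      have "(\<integral>z. inner_d d x z ^ a * inner_d d y z ^ b \<partial>uniform_sphere d) =
         sphere_moment d (a + b) * (if even (a + b) then coeff ([:1, 2 * inner_d d x y, 1:] ^ ((a + b) div 2)) a else 0)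
         / real ((a + b) choose a)"
        using sphere_bimoment[OF that, of a b] pos by (simp add: eq_divide_eq mult.commute)
      then show ?thesis by (simp add: c_def P(2))
    qed
    moreover have "degree (smult c P) \<le> a" using P(1) degree_smult_le order_trans by blast
    ultimately show ?thesis by blast
  qed
  show ?thesis
  proof (cases "a \<le> b")
    case True
    then show ?thesis using le[of a b] by (simp add: min_absorb1)
  next
    case False
    obtain P where P: "degree P \<le> b" "\<And>x y. unit_d d x \<Longrightarrow> unit_d d y \<Longrightarrow>
     (\<integral>z. inner_d d x z ^ b * inner_d d y z ^ a \<partial>uniform_sphere d) = poly P (inner_d d x y)"
      using le[of b a] by blast
    have "(\<integral>z. inner_d d x z ^ a * inner_d d y z ^ b \<partial>uniform_sphere d) = poly P (inner_d d x y)"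
      if "unit_d d x" "unit_d d y" for x y
      using P(2)[OF that(2,1)] by (simp add: mult.commute inner_d_commute)
    then show ?thesis using P(1) False by (intro exI[of _ P]) auto
  qed
qed

text \<open>Bilinear extension from monomials. The bound by the smaller degree is what later makes
  convolutions with polynomials of lower degree vanish.\<close>

lemma sphere_conv_poly:
  "\<exists>R. degree R \<le> min (degree p) (degree q) \<and> (\<forall>x y. unit_d d x \<longrightarrow> unit_d d y \<longrightarrow>
     (\<integral>z. poly p (inner_d d x z) * poly q (inner_d d y z) \<partial>uniform_sphere d) = poly R (inner_d d x y))"
proof -
  define ok where "ok = (\<lambda>a b P. degree P \<le> min a b \<and> (\<forall>x y. unit_d d x \<longrightarrow> unit_d d y \<longrightarrow>
     (\<integral>z. inner_d d x z ^ a * inner_d d y z ^ b \<partial>uniform_sphere d) = poly P (inner_d d x y)))"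
  define P where "P = (\<lambda>a b. SOME P. ok a b P)"
  have ok: "ok a b (P a b)" for a b
    unfolding P_def ok_def by (rule someI_ex[OF sphere_bimoment_poly])
  have P: "degree (P a b) \<le> min a b" "\<And>x y. unit_d d x \<Longrightarrow> unit_d d y \<Longrightarrow>
     (\<integral>z. inner_d d x z ^ a * inner_d d y z ^ b \<partial>uniform_sphere d) = poly (P a b) (inner_d d x y)" for a b
    using ok[of a b] unfolding ok_def by blast+
  define R where "R = (\<Sum>a\<le>degree p. \<Sum>b\<le>degree q. smult (coeff p a * coeff q b) (P a b))"
  have "degree R \<le> min (degree p) (degree q)"
    unfolding R_def
  proof (intro degree_sum_le)
    fix a b assume "a \<in> {..degree p}" "b \<in> {..degree q}"
    then have "min a b \<le> min (degree p) (degree q)" by auto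
    then show "degree (smult (coeff p a * coeff q b) (P a b)) \<le> min (degree p) (degree q)"
      by (rule order_trans[OF degree_smult_le order_trans[OF P(1)]])
  qed auto
  moreover have "(\<integral>z. poly p (inner_d d x z) * poly q (inner_d d y z) \<partial>uniform_sphere d) = poly R (inner_d d x y)"
    if "unit_d d x" "unit_d d y" for x y
  proof -
    have "(\<integral>z. poly p (inner_d d x z) * poly q (inner_d d y z) \<partial>uniform_sphere d) =
        (\<integral>z. (\<Sum>a\<le>degree p. \<Sum>b\<le>degree q. coeff p a * coeff q b * (inner_d d x z ^ a * inner_d d y z ^ b)) \<partial>uniform_sphere d)"
      by (intro Bochner_Integration.integral_cong refl)
         (simp add: poly_altdef sum_product mult_ac)
    also have "\<dots> = (\<Sum>a\<le>degree p. \<Sum>b\<le>degree q. coeff p a * coeff q b * (\<integral>z. inner_d d x z ^ a * inner_d d y z ^ b \<partial>uniform_sphere d))"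
      using integrable_sphere_inner_powers by (simp add: Bochner_Integration.integral_sum)
    also have "\<dots> = poly R (inner_d d x y)"
      by (simp add: R_def poly_sum P(2)[OF that])
    finally show ?thesis .
  qed
  ultimately show ?thesis by blast
qed

text \<open>The squared coordinates sum to 1, so the moment of order m splits into mixed moments of
  z_i^2 and z_0^m. For i > 0 such a moment is the bimoment at inner product 0: if m = 2 j, the
  trinomial coefficient is j + 1 and the binomial one is (j + 1) (m + 1), which leaves the moment of
  order m + 2 divided by m + 1.\<close>

lemma sphere_moment_rec:
  assumes d: "d \<ge> 1"
  shows "(real m + 1) * sphere_moment d m = (real m + 1 + real d) * sphere_moment d (m + 2)"
proof (cases "even m")
  case False
  then show ?thesis by (simp add: sphere_moment_odd)
next
  case True
  then obtain j where j: "m = 2 * j" by (elim evenE)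
  have c2: "coeff ([:1, 0, 1:] ^ n) 2 = (real n)" "coeff ([:1, 0, 1:] ^ n) 0 = (1 :: real)" for n
  proof -
    have 0: "coeff ([:1, 0, 1:] ^ n) 0 = (1 :: real)" for n
      by (induction n) auto
    show "coeff ([:1, 0, 1:] ^ n) 2 = (real n)"
      by (induction n) (auto simp: coeff_pCons numeral_2_eq_2 0 split: nat.splits)
    show "coeff ([:1, 0, 1:] ^ n) 0 = (1 :: real)" by (rule 0)
  qed
  have off: "(real m + 1) * (\<integral>z. (z i)\<^sup>2 * (z 0) ^ m \<partial>uniform_sphere d) = sphere_moment d (m + 2)"
    if i: "i \<noteq> 0" "i \<le> d" for i
  proof -
    have "real ((2 + m) choose 2) * (\<integral>z. (z i)\<^sup>2 * (z 0) ^ m \<partial>uniform_sphere d) = sphere_moment d (2 + m) * real (Suc j)"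
      using sphere_bimoment[of d "basis_vec d i" "basis_vec d 0" 2 m] i basis_vec_unit[of _ d]
        basis_vec_orth[of i d 0] c2(1)[of "Suc j"] True
      by (simp add: inner_basis_vec j)
    moreover have "real ((2 + m) choose 2) = real (Suc j) * (real m + 1)"
      by (subst choose_two) (simp add: j algebra_simps)
    ultimately have "real (Suc j) * ((real m + 1) * (\<integral>z. (z i)\<^sup>2 * (z 0) ^ m \<partial>uniform_sphere d)) = real (Suc j) * sphere_moment d (m + 2)"
      by (simp only: mult_ac add.commute)
    then show ?thesis by (simp only: mult_cancel_left of_nat_eq_0_iff nat.distinct simp_thms)
  qed
  have int: "integrable (uniform_sphere d) (\<lambda>z. (z i)\<^sup>2 * (z 0) ^ m)" if "i \<le> d" for i
    using integrable_sphere_inner_powers[of d "basis_vec d i" 2 "basis_vec d 0" m] that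
    by (simp add: inner_basis_vec)
  have "sphere_moment d m = (\<integral>z. (\<Sum>i\<le>d. (z i)\<^sup>2 * (z 0) ^ m) \<partial>uniform_sphere d)"
    unfolding sphere_moment_def
  proof (rule integral_cong_AE)
    show "AE z in uniform_sphere d. z 0 ^ m = (\<Sum>i\<le>d. (z i)\<^sup>2 * z 0 ^ m)"
      by (rule eventually_mono[OF AE_uniform_sphere_unit])
         (simp add: sum_distrib_right[symmetric] inner_d_def power2_eq_square)
    show "(\<lambda>z. z 0 ^ m) \<in> borel_measurable (uniform_sphere d)"
      using component_meas[of 0 d] by simp
    show "(\<lambda>z. \<Sum>i\<le>d. (z i)\<^sup>2 * z 0 ^ m) \<in> borel_measurable (uniform_sphere d)"
      using int by (intro borel_measurable_sum) auto
  qed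
  also have "\<dots> = (\<Sum>i\<le>d. \<integral>z. (z i)\<^sup>2 * (z 0) ^ m \<partial>uniform_sphere d)"
    using int by (intro Bochner_Integration.integral_sum) auto
  also have "\<dots> = (\<integral>z. (z 0)\<^sup>2 * (z 0) ^ m \<partial>uniform_sphere d) + (\<Sum>i\<in>{1..d}. \<integral>z. (z i)\<^sup>2 * (z 0) ^ m \<partial>uniform_sphere d)"
    by (simp add: atMost_atLeast0 sum.atLeast_Suc_atMost)
  also have "(\<integral>z. (z 0)\<^sup>2 * (z 0) ^ m \<partial>uniform_sphere d) = sphere_moment d (m + 2)"
    by (simp add: sphere_moment_def power_add power2_eq_square mult_ac)
  finally have "(real m + 1) * sphere_moment d m = (real m + 1) * sphere_moment d (m + 2)
      + (\<Sum>i\<in>{1..d}. (real m + 1) * (\<integral>z. (z i)\<^sup>2 * (z 0) ^ m \<partial>uniform_sphere d))"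
    by (simp add: distrib_left sum_distrib_left)
  also have "(\<Sum>i\<in>{1..d}. (real m + 1) * (\<integral>z. (z i)\<^sup>2 * (z 0) ^ m \<partial>uniform_sphere d)) = real d * sphere_moment d (m + 2)"
    by (subst sum.cong[OF refl off]) auto
  finally show ?thesis by (simp add: algebra_simps)
qed

text \<open>Integration by parts with q = x^(m+1) gives the weight the recursion of
  \<open>sphere_moment_rec\<close>; orders 0 and 1 start it.\<close>

lemma sphere_moment_eq_Lam:
  assumes d: "d \<ge> 3"
  shows "sphere_moment d m = Lam d (monom 1 m)"
proof (induction m rule: nat_induct2)
  case 0
  interpret U: prob_space "uniform_sphere d" by (rule prob_space_uniform_sphere)
  show ?case using Lam_1[OF d] U.prob_space by (simp add: sphere_moment_def monom_0 one_pCons)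
next
  case 1
  have "Lam d ([:1, 0, -1:] * pderiv 1 - smult (real d) ([:0, 1:] * 1)) = 0"
    by (rule Lam_integration_by_parts[OF d])
  moreover have "[:1, 0, -1:] * pderiv 1 - smult (real d) ([:0, 1:] * 1) = smult (- real d) (monom 1 1)"
    by (simp add: pderiv_1 monom_altdef)
  ultimately have "Lam d (smult (- real d) (monom 1 1)) = 0" by (simp only:)
  then have "- real d * Lam d (monom 1 1) = 0" by (simp only: Lam_smult)
  then show ?case using d by (simp add: sphere_moment_odd)
next
  case (step m)
  have "[:1, 0, -1:] * pderiv (monom 1 (m + 1)) - smult (real d) ([:0, 1:] * monom 1 (m + 1)) =
      smult (real m + 1) (monom 1 m) - smult (real m + 1 + real d) (monom 1 (m + 2))"
  proof (rule poly_eq_poly_eq_iff[THEN iffD1], rule ext)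
    fix x :: real
    show "poly ([:1, 0, -1:] * pderiv (monom 1 (m + 1)) - smult (real d) ([:0, 1:] * monom 1 (m + 1))) x =
      poly (smult (real m + 1) (monom 1 m) - smult (real m + 1 + real d) (monom 1 (m + 2))) x"
      by (simp add: pderiv_monom poly_monom algebra_simps)
  qed
  with Lam_integration_by_parts[OF d, of "monom 1 (m + 1)"]
  have "(real m + 1) * Lam d (monom 1 m) = (real m + 1 + real d) * Lam d (monom 1 (m + 2))"
    by (simp only: Lam_diff[OF d] Lam_smult)
  with sphere_moment_rec[of d m] d step
  have "(real m + 1 + real d) * sphere_moment d (m + 2) = (real m + 1 + real d) * Lam d (monom 1 (m + 2))" by simp
  then show ?case by (simp add: add_nonneg_eq_0_iff)
qed

text \<open>The Taylor polynomials of a characteristic function involve only the moments, and on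
  [-1, 1] the remainder is at most 2 |t|^n / n!, so equal moments force equal characteristic
  functions.\<close>

lemma bounded_moments_unique:
  assumes A: "real_distribution A" and B: "real_distribution B"
    and bA: "AE x in A. \<bar>x\<bar> \<le> 1" and bB: "AE x in B. \<bar>x\<bar> \<le> 1"
    and eq: "\<And>k. (\<integral>x. x ^ k \<partial>A) = (\<integral>x. x ^ k \<partial>B)"
  shows "A = B"
proof -
  have approx: "cmod (char M t - (\<Sum>k\<le>n. ((\<i> * t) ^ k / fact k) * (\<integral>x. x ^ k \<partial>M))) \<le> 2 * \<bar>t\<bar> ^ n / fact n"
    if M: "real_distribution M" and b: "AE x in M. \<bar>x\<bar> \<le> 1" for M t n
  proof -
    interpret M: real_distribution M by fact
    have b': "AE x in M. \<bar>x\<bar> ^ k \<le> 1" for k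
      by (rule eventually_mono[OF b]) (simp add: power_le_one)
    have int: "integrable M (\<lambda>x. x ^ k)" for k
      by (rule M.integrable_const_bound[where B=1]) (use b'[of k] in \<open>auto simp: power_abs\<close>)
    have "M.expectation (\<lambda>x. \<bar>x\<bar> ^ n) \<le> M.expectation (\<lambda>x. 1)"
      using int[of n] b'[of n] by (intro integral_mono_AE) (auto simp: power_abs[symmetric])
    then have "(2 * \<bar>t\<bar> ^ n / fact n) * M.expectation (\<lambda>x. \<bar>x\<bar> ^ n) \<le> (2 * \<bar>t\<bar> ^ n / fact n) * 1"
      by (intro mult_left_mono) (auto simp: M.prob_space[unfolded M.space_eq_univ])
    with M.char_approx1[of n t, OF int] show ?thesis by linarith
  qed
  have "char A t = char B t" for t
  proof -
    let ?S = "\<lambda>n. \<Sum>k\<le>n. ((\<i> * t) ^ k / fact k) * (\<integral>x. x ^ k \<partial>A)"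
    have "(\<lambda>n. inverse (fact n) * \<bar>t\<bar> ^ n) \<longlonglongrightarrow> 0"
      by (rule summable_LIMSEQ_zero[OF summable_exp])
    from tendsto_mult_right_zero[OF this, of 2]
    have lim: "(\<lambda>n. 2 * \<bar>t\<bar> ^ n / fact n) \<longlonglongrightarrow> 0"
      by (simp add: divide_inverse mult_ac)
    have "(\<lambda>n. char A t - ?S n) \<longlonglongrightarrow> 0"
      by (rule Lim_null_comparison[OF always_eventually lim]) (use approx[OF A bA, of t] in blast)
    moreover have "(\<lambda>n. char B t - ?S n) \<longlonglongrightarrow> 0"
      by (rule Lim_null_comparison[OF always_eventually lim]) (use approx[OF B bB, of t] in \<open>unfold eq, blast\<close>)
    ultimately have "(\<lambda>n. (char A t - ?S n) - (char B t - ?S n)) \<longlonglongrightarrow> 0 - 0" by (rule tendsto_diff)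
    then have "(\<lambda>n. char A t - char B t) \<longlonglongrightarrow> 0" by simp
    then show ?thesis by (simp add: LIMSEQ_const_iff)
  qed
  then show ?thesis by (intro Levy_uniqueness A B ext)
qed

section \<open>The reproducing property of zonal polynomials\<close>

text \<open>Both laws live on [-1, 1] and have equal moments. From here on, integrals over the
  sphere of functions of x . z are one-dimensional integrals against the Gegenbauer weight.\<close>

lemma distr_sphere_inner:
  assumes d: "d \<ge> 3" and x: "unit_d d x"
  shows "distr (uniform_sphere d) borel (inner_d d x) = geg_measure d"
proof (rule bounded_moments_unique)
  interpret U: prob_space "uniform_sphere d" by (rule prob_space_uniform_sphere)
  show "real_distribution (distr (uniform_sphere d) borel (inner_d d x))"
    by (intro U.real_distribution_distr) measurable
  show "real_distribution (geg_measure d)" by (rule real_distribution_geg_measure[OF d])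
  have "AE z in uniform_sphere d. \<bar>inner_d d x z\<bar> \<le> 1"
    by (rule eventually_mono[OF AE_uniform_sphere_unit]) (use abs_inner_d_le[of d _ x] x in simp)
  then show "AE t in distr (uniform_sphere d) borel (inner_d d x). \<bar>t\<bar> \<le> 1"
    by (subst AE_distr_iff) auto
  show "AE t in geg_measure d. \<bar>t\<bar> \<le> 1"
    by (rule eventually_mono[OF AE_geg_measure]) (auto simp: abs_le_iff)
  fix m
  have "(\<integral>t. t ^ m \<partial>distr (uniform_sphere d) borel (inner_d d x)) = (\<integral>z. inner_d d x z ^ m \<partial>uniform_sphere d)"
    by (subst integral_distr) auto
  also have "\<dots> = sphere_moment d m" using x by (simp add: sphere_inner_moment)
  also have "\<dots> = (\<integral>t. t ^ m \<partial>geg_measure d)"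
    unfolding sphere_moment_eq_Lam[OF d] Lam_def
    by (intro Bochner_Integration.integral_cong) (simp_all add: poly_monom)
  finally show "(\<integral>t. t ^ m \<partial>distr (uniform_sphere d) borel (inner_d d x)) = (\<integral>t. t ^ m \<partial>geg_measure d)" .
qed

lemma
  fixes f :: "real \<Rightarrow> real"
  assumes d: "d \<ge> 3" and x: "unit_d d x" and f: "f \<in> borel_measurable borel"
  shows sphere_integral_inner: "(\<integral>z. f (inner_d d x z) \<partial>uniform_sphere d) = (\<integral>t. f t \<partial>geg_measure d)"
    and sphere_integrable_inner: "integrable (uniform_sphere d) (\<lambda>z. f (inner_d d x z)) \<longleftrightarrow> integrable (geg_measure d) f"
    and sphere_nn_integral_inner: "(\<integral>\<^sup>+z. ennreal (f (inner_d d x z)) \<partial>uniform_sphere d) = (\<integral>\<^sup>+t. ennreal (f t) \<partial>geg_measure d)"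
  unfolding distr_sphere_inner[OF d x, symmetric] using f
  by (auto simp: integral_distr integrable_distr_eq nn_integral_distr)

text \<open>With l = (d - 1) / 2 the factor (k + l) / l is the 1 + 2 k / (d - 1) of the series. In
  this normalisation the polynomial reproduces itself under convolution, and its value at 1 is the
  dimension of the harmonics of degree k.\<close>

definition zonal :: "nat \<Rightarrow> nat \<Rightarrow> real poly" where
  "zonal d k = smult ((real k + (real d - 1) / 2) / ((real d - 1) / 2)) (geg_poly ((real d - 1) / 2) k)"

text \<open>The convolution of two functions of the inner product, as a polynomial in x . y, so that
  arguments by degree and orthogonality apply to it.\<close>

definition conv_poly :: "nat \<Rightarrow> real poly \<Rightarrow> real poly \<Rightarrow> real poly" where
  "conv_poly d p q = (SOME R. degree R \<le> min (degree p) (degree q) \<and> (\<forall>x y. unit_d d x \<longrightarrow> unit_d d y \<longrightarrow>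
     (\<integral>z. poly p (inner_d d x z) * poly q (inner_d d y z) \<partial>uniform_sphere d) = poly R (inner_d d x y)))"

lemma
  shows degree_conv_poly: "degree (conv_poly d p q) \<le> min (degree p) (degree q)"
    and conv_poly: "\<And>x y. unit_d d x \<Longrightarrow> unit_d d y \<Longrightarrow>
     (\<integral>z. poly p (inner_d d x z) * poly q (inner_d d y z) \<partial>uniform_sphere d) = poly (conv_poly d p q) (inner_d d x y)"
  using someI_ex[OF sphere_conv_poly[of p q d]] unfolding conv_poly_def[symmetric] by blast+

lemma poly_bounded_unit:
  obtains B where "\<And>t. \<bar>t\<bar> \<le> 1 \<Longrightarrow> \<bar>poly (p :: real poly) t\<bar> \<le> B"
proof -
  have "compact (poly p ` {-1..1})" by (intro compact_continuous_image continuous_intros) auto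
  then obtain B where "\<forall>t\<in>poly p ` {-1..1}. norm t \<le> B" using compact_imp_bounded bounded_iff by blast
  then show ?thesis by (intro that[of B]) (auto simp: abs_le_iff)
qed

lemma abs_inner_unit_le: "unit_d d x \<Longrightarrow> unit_d d y \<Longrightarrow> \<bar>inner_d d x y\<bar> \<le> 1"
  using abs_inner_d_le[of d y x] by simp

lemma unit_basis_vec: "unit_d d (basis_vec d 0)"
  by (rule basis_vec_unit) simp

text \<open>The double integral of p(x . z) q(z . y) r(x . y) over y and z is evaluated in both
  orders: convolution with q is self-adjoint for the inner product given by
  \<open>Lam\<close>.\<close>

lemma Lam_conv_poly_adjoint:
  assumes d: "d \<ge> 3"
  shows "Lam d (p * conv_poly d q r) = Lam d (conv_poly d p q * r)"
proof -
  interpret U: prob_space "uniform_sphere d" by (rule prob_space_uniform_sphere)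
  interpret UU: pair_prob_space "uniform_sphere d" "uniform_sphere d" ..
  define x where "x = basis_vec d 0"
  have x: "unit_d d x" by (simp add: x_def unit_basis_vec)
  have pm: "(\<lambda>w. poly p (f w)) \<in> borel_measurable N" if "f \<in> borel_measurable N" for f and N :: "'z measure" and p :: "real poly"
    using measurable_compose[OF that borel_measurable_poly] .
  define F where "F = (\<lambda>y z. poly p (inner_d d x z) * poly q (inner_d d z y) * poly r (inner_d d x y))"
  have F_meas: "(\<lambda>(y, z). F y z) \<in> borel_measurable (uniform_sphere d \<Otimes>\<^sub>M uniform_sphere d)"
    unfolding F_def split_def by (intro borel_measurable_times pm) measurable
  obtain Bp Bq Br where B: "\<And>t. \<bar>t\<bar> \<le> 1 \<Longrightarrow> \<bar>poly p t\<bar> \<le> Bp" "\<And>t. \<bar>t\<bar> \<le> 1 \<Longrightarrow> \<bar>poly q t\<bar> \<le> Bq" "\<And>t. \<bar>t\<bar> \<le> 1 \<Longrightarrow> \<bar>poly r t\<bar> \<le> Br"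
    using poly_bounded_unit by metis
  have Bnn: "0 \<le> Bp" "0 \<le> Bq" "0 \<le> Br" using B[of 0] by (auto intro: order_trans[OF abs_ge_zero])
  have "integrable (uniform_sphere d \<Otimes>\<^sub>M uniform_sphere d) (\<lambda>(y, z). F y z)"
  proof (rule UU.integrable_const_bound[OF _ F_meas])
    have "AE y in uniform_sphere d. AE z in uniform_sphere d. norm (case (y, z) of (y, z) \<Rightarrow> F y z) \<le> Bp * Bq * Br"
    proof (rule eventually_mono[OF AE_uniform_sphere_unit])
      fix y assume y: "unit_d d y"
      show "AE z in uniform_sphere d. norm (case (y, z) of (y, z) \<Rightarrow> F y z) \<le> Bp * Bq * Br"
      proof (rule eventually_mono[OF AE_uniform_sphere_unit])
        fix z assume z: "unit_d d z"
        show "norm (case (y, z) of (y, z) \<Rightarrow> F y z) \<le> Bp * Bq * Br"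
          unfolding F_def split real_norm_def abs_mult using x y z Bnn
          by (intro mult_mono B abs_inner_unit_le) auto
      qed
    qed
    then show "AE p in uniform_sphere d \<Otimes>\<^sub>M uniform_sphere d. norm (case p of (y, z) \<Rightarrow> F y z) \<le> Bp * Bq * Br"
      by (intro UU.AE_pair_measure) (use F_meas in measurable)
  qed
  note i = this
  have "(\<integral>y. \<integral>z. F y z \<partial>uniform_sphere d \<partial>uniform_sphere d) = (\<integral>y. poly (conv_poly d p q * r) (inner_d d x y) \<partial>uniform_sphere d)"
  proof (rule integral_cong_AE)
    show "AE y in uniform_sphere d. (\<integral>z. F y z \<partial>uniform_sphere d) = poly (conv_poly d p q * r) (inner_d d x y)"
    proof (rule eventually_mono[OF AE_uniform_sphere_unit])
      fix y assume y: "unit_d d y"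
      have "(\<integral>z. F y z \<partial>uniform_sphere d) = (\<integral>z. poly p (inner_d d x z) * poly q (inner_d d y z) \<partial>uniform_sphere d) * poly r (inner_d d x y)"
        unfolding F_def by (simp add: inner_d_commute[of d _ y])
      then show "(\<integral>z. F y z \<partial>uniform_sphere d) = poly (conv_poly d p q * r) (inner_d d x y)"
        by (simp add: conv_poly[OF x y])
    qed
    show "(\<lambda>y. \<integral>z. F y z \<partial>uniform_sphere d) \<in> borel_measurable (uniform_sphere d)"
      using UU.integrable_fst[OF i] by (rule borel_measurable_integrable)
    show "(\<lambda>y. poly (conv_poly d p q * r) (inner_d d x y)) \<in> borel_measurable (uniform_sphere d)"
      by (intro pm) measurable
  qed
  also have "\<dots> = Lam d (conv_poly d p q * r)"
    unfolding Lam_def by (rule sphere_integral_inner[OF d x borel_measurable_poly])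
  finally have 1: "(\<integral>y. \<integral>z. F y z \<partial>uniform_sphere d \<partial>uniform_sphere d) = Lam d (conv_poly d p q * r)" .
  have "(\<integral>z. \<integral>y. F y z \<partial>uniform_sphere d \<partial>uniform_sphere d) = (\<integral>z. poly (p * conv_poly d q r) (inner_d d x z) \<partial>uniform_sphere d)"
  proof (rule integral_cong_AE)
    show "AE z in uniform_sphere d. (\<integral>y. F y z \<partial>uniform_sphere d) = poly (p * conv_poly d q r) (inner_d d x z)"
    proof (rule eventually_mono[OF AE_uniform_sphere_unit])
      fix z assume z: "unit_d d z"
      have "(\<integral>y. F y z \<partial>uniform_sphere d) = poly p (inner_d d x z) * (\<integral>y. poly q (inner_d d z y) * poly r (inner_d d x y) \<partial>uniform_sphere d)"
        unfolding F_def by (simp add: mult.assoc)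
      then show "(\<integral>y. F y z \<partial>uniform_sphere d) = poly (p * conv_poly d q r) (inner_d d x z)"
        by (simp add: conv_poly[OF z x] inner_d_commute[of d z x])
    qed
    show "(\<lambda>z. \<integral>y. F y z \<partial>uniform_sphere d) \<in> borel_measurable (uniform_sphere d)"
      using UU.integrable_snd[OF i] by (rule borel_measurable_integrable)
    show "(\<lambda>y. poly (p * conv_poly d q r) (inner_d d x y)) \<in> borel_measurable (uniform_sphere d)"
      by (intro pm) measurable
  qed
  also have "\<dots> = Lam d (p * conv_poly d q r)"
    unfolding Lam_def by (rule sphere_integral_inner[OF d x borel_measurable_poly])
  finally have 2: "(\<integral>z. \<integral>y. F y z \<partial>uniform_sphere d \<partial>uniform_sphere d) = Lam d (p * conv_poly d q r)" .
  show ?thesis using 1 2 UU.integral_fst[OF i] UU.integral_snd[OF i] by simp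
qed

text \<open>By adjointness the squared norm of the convolution R pairs C_k with the convolution of q
  and R, whose degree is at most that of q and thus below k.\<close>

lemma conv_geg_lower_degree:
  assumes d: "d \<ge> 3" and l: "l = (real d - 1) / 2" and q: "degree q < k"
  shows "conv_poly d (geg_poly l k) q = 0"
proof -
  define R where "R = conv_poly d (geg_poly l k) q"
  have "Lam d (R * R) = Lam d (geg_poly l k * conv_poly d q R)"
    unfolding R_def by (rule Lam_conv_poly_adjoint[OF d, symmetric])
  also have "\<dots> = 0"
    using degree_conv_poly[of d q R] q by (intro Lam_geg_lower_degree[OF d l]) auto
  finally show ?thesis unfolding R_def by (rule Lam_square_eq_0[OF d])
qed

text \<open>By adjointness and \<open>conv_geg_lower_degree\<close> the convolution is orthogonal to
  all lower degrees, hence a multiple of C_k. At y = x the integral is the squared norm of C_k,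
  which fixes the factor.\<close>

lemma conv_geg_self:
  assumes d: "d \<ge> 3" and l: "l = (real d - 1) / 2"
  shows "conv_poly d (geg_poly l k) (geg_poly l k) = smult (l / (real k + l)) (geg_poly l k)"
proof -
  have lpos: "l > 0" using d by (simp add: l)
  define R where "R = conv_poly d (geg_poly l k) (geg_poly l k)"
  have "degree R \<le> k"
    using degree_conv_poly[of d "geg_poly l k" "geg_poly l k"] degree_geg_poly[OF lpos, of k] unfolding R_def by simp
  moreover have "Lam d (R * r) = 0" if "degree r < k" for r
    unfolding R_def Lam_conv_poly_adjoint[OF d, symmetric] conv_geg_lower_degree[OF d l that] by (simp add: Lam_def)
  ultimately obtain c where c: "R = smult c (geg_poly l k)" using geg_poly_unique[OF d l] by blast
  have x: "unit_d d (basis_vec d 0)" by (rule unit_basis_vec)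
  have "poly R 1 = (\<integral>z. poly (geg_poly l k * geg_poly l k) (inner_d d (basis_vec d 0) z) \<partial>uniform_sphere d)"
    using conv_poly[OF x x, of "geg_poly l k" "geg_poly l k"] x by (simp add: R_def)
  also have "\<dots> = Lam d (geg_poly l k * geg_poly l k)"
    unfolding Lam_def by (rule sphere_integral_inner[OF d x borel_measurable_poly])
  also have "\<dots> = l / (real k + l) * poly (geg_poly l k) 1" by (rule Lam_geg_norm[OF d l])
  finally have "c * poly (geg_poly l k) 1 = l / (real k + l) * poly (geg_poly l k) 1" by (simp add: c)
  moreover have "poly (geg_poly l k) 1 > 0" unfolding geg_poly_at_1[OF d l] by simp
  ultimately have "c = l / (real k + l)" by (simp only: mult_cancel_right less_irrefl) auto
  then show ?thesis using c unfolding R_def by simp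
qed

theorem zonal_reproducing:
  assumes d: "d \<ge> 3" and x: "unit_d d x" and y: "unit_d d y"
  shows "(\<integral>z. poly (zonal d j) (inner_d d x z) * poly (zonal d k) (inner_d d y z) \<partial>uniform_sphere d) =
    (if j = k then poly (zonal d k) (inner_d d x y) else 0)"
proof -
  define l where "l = (real d - 1) / 2"
  have lpos: "l > 0" using d by (simp add: l_def)
  define c where "c = (\<lambda>k. (real k + l) / l)"
  have zon: "zonal d k = smult (c k) (geg_poly l k)" for k by (simp add: zonal_def c_def l_def)
  have pull: "(\<integral>z. poly (zonal d j) (inner_d d x z) * poly (zonal d k) (inner_d d y z) \<partial>uniform_sphere d) =
      c j * c k * (\<integral>z. poly (geg_poly l j) (inner_d d x z) * poly (geg_poly l k) (inner_d d y z) \<partial>uniform_sphere d)"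
    if "unit_d d x" "unit_d d y" for x y j k
  proof -
    have "(\<integral>z. poly (zonal d j) (inner_d d x z) * poly (zonal d k) (inner_d d y z) \<partial>uniform_sphere d) =
      (\<integral>z. c j * c k * (poly (geg_poly l j) (inner_d d x z) * poly (geg_poly l k) (inner_d d y z)) \<partial>uniform_sphere d)"
      by (simp add: zon mult_ac)
    then show ?thesis by simp
  qed
  have dk: "degree (geg_poly l i) \<le> i" for i using degree_geg_poly[OF lpos, of i] by simp
  have less: "(\<integral>z. poly (geg_poly l j) (inner_d d x z) * poly (geg_poly l k) (inner_d d y z) \<partial>uniform_sphere d) = 0"
    if "unit_d d x" "unit_d d y" "k < j" for x y j k
    unfolding conv_poly[OF that(1,2)]
    using conv_geg_lower_degree[OF d l_def le_less_trans[OF dk that(3)]] by simp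
  consider "j = k" | "k < j" | "j < k" by linarith
  then show ?thesis
  proof cases
    case 1
    \<comment> \<open>The factor l / (k + l) of the convolution cancels one of the two normalising
      constants.\<close>
    have "c k * c k * (l / (real k + l)) = c k" using lpos by (simp add: c_def)
    then show ?thesis
      unfolding 1 pull[OF x y] conv_poly[OF x y] conv_geg_self[OF d l_def] poly_smult
      unfolding zon poly_smult by (simp only: if_True refl mult.assoc[symmetric])
  next
    case 2
    then show ?thesis unfolding pull[OF x y] less[OF x y 2] by simp
  next
    case 3
    have "(\<integral>z. poly (geg_poly l j) (inner_d d x z) * poly (geg_poly l k) (inner_d d y z) \<partial>uniform_sphere d) = 0"
      using less[OF y x 3] by (simp add: mult.commute)
    then show ?thesis unfolding pull[OF x y] using 3 by simp
  qed
qed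

lemma zonal_at_1: "d \<ge> 3 \<Longrightarrow> k \<ge> 1 \<Longrightarrow> poly (zonal d k) 1 = dim_harm k d"
  unfolding zonal_def by (simp add: dim_harm_eq[OF _ refl])

lemma dim_harm_nonneg: "0 \<le> dim_harm k d"
  by (simp add: dim_harm_def)

lemma psi_partial_zonal:
  assumes "d \<ge> 3"
  shows "psi_partial v d N t = (\<Sum>k=1..N. (v k d)\<^sup>2 * poly (zonal d k) t)"
  unfolding psi_partial_def using assms
  by (auto intro!: sum.cong simp: zonal_def poly_geg_poly field_simps)

lemma zonal_series_conv:
  assumes d: "d \<ge> 3" and x: "unit_d d x" and y: "unit_d d y"
  shows "(\<integral>z. (\<Sum>k=1..N. a k * poly (zonal d k) (inner_d d x z)) * (\<Sum>k=1..N. b k * poly (zonal d k) (inner_d d y z)) \<partial>uniform_sphere d)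
    = (\<Sum>k=1..N. a k * b k * poly (zonal d k) (inner_d d x y))"
proof -
  have pm: "(\<lambda>w. poly p (inner_d d x w)) \<in> borel_measurable (uniform_sphere d)" for x and p :: "real poly"
    by (rule measurable_compose[OF _ borel_measurable_poly]) measurable
  have int: "integrable (uniform_sphere d) (\<lambda>z. poly (zonal d j) (inner_d d x z) * poly (zonal d k) (inner_d d y z))" for j k
  proof -
    obtain Bj Bk where B: "\<And>t. \<bar>t\<bar> \<le> 1 \<Longrightarrow> \<bar>poly (zonal d j) t\<bar> \<le> Bj" "\<And>t. \<bar>t\<bar> \<le> 1 \<Longrightarrow> \<bar>poly (zonal d k) t\<bar> \<le> Bk"
      using poly_bounded_unit by metis
    have Bnn: "0 \<le> Bj" "0 \<le> Bk" using B[of 0] by (auto intro: order_trans[OF abs_ge_zero])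
    show ?thesis
      by (rule integrable_sphere_bounded[where B="Bj * Bk"])
         (use pm x y Bnn in \<open>auto simp: abs_mult intro!: mult_mono B abs_inner_unit_le\<close>)
  qed
  have "(\<integral>z. (\<Sum>k=1..N. a k * poly (zonal d k) (inner_d d x z)) * (\<Sum>k=1..N. b k * poly (zonal d k) (inner_d d y z)) \<partial>uniform_sphere d)
    = (\<integral>z. (\<Sum>j=1..N. \<Sum>k=1..N. a j * b k * (poly (zonal d j) (inner_d d x z) * poly (zonal d k) (inner_d d y z))) \<partial>uniform_sphere d)"
    by (simp add: sum_product mult_ac)
  also have "\<dots> = (\<Sum>j=1..N. \<Sum>k=1..N. a j * b k * (\<integral>z. poly (zonal d j) (inner_d d x z) * poly (zonal d k) (inner_d d y z) \<partial>uniform_sphere d))"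
    using int by (simp add: Bochner_Integration.integral_sum)
  also have "\<dots> = (\<Sum>j=1..N. \<Sum>k=1..N. if j = k then a j * b j * poly (zonal d j) (inner_d d x y) else 0)"
    unfolding zonal_reproducing[OF d x y] by (intro sum.cong) auto
  also have "\<dots> = (\<Sum>k=1..N. a k * b k * poly (zonal d k) (inner_d d x y))"
    by (intro sum.cong refl) simp
  finally show ?thesis .
qed

section \<open>The kernel of the statistic\<close>

text \<open>F G - f g = (F - f) (G - g) + (F - f) g + f (G - g), and Cauchy-Schwarz controls each
  term.\<close>

lemma L2_inner_tendsto:
  fixes F G :: "nat \<Rightarrow> 'a \<Rightarrow> real"
  assumes [measurable]: "\<And>n. F n \<in> borel_measurable M" "\<And>n. G n \<in> borel_measurable M"
      "f \<in> borel_measurable M" "g \<in> borel_measurable M"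
    and F: "\<And>n. integrable M (\<lambda>x. (F n x)\<^sup>2)" and G: "\<And>n. integrable M (\<lambda>x. (G n x)\<^sup>2)"
    and f: "integrable M (\<lambda>x. (f x)\<^sup>2)" and g: "integrable M (\<lambda>x. (g x)\<^sup>2)"
    and limF: "(\<lambda>n. \<integral>x. (F n x - f x)\<^sup>2 \<partial>M) \<longlonglongrightarrow> 0"
    and limG: "(\<lambda>n. \<integral>x. (G n x - g x)\<^sup>2 \<partial>M) \<longlonglongrightarrow> 0"
  shows "(\<lambda>n. \<integral>x. F n x * G n x \<partial>M) \<longlonglongrightarrow> (\<integral>x. f x * g x \<partial>M)"
proof -
  define DF where "DF = (\<lambda>n. sqrt (\<integral>x. (F n x - f x)\<^sup>2 \<partial>M))"
  define DG where "DG = (\<lambda>n. sqrt (\<integral>x. (G n x - g x)\<^sup>2 \<partial>M))"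
  define nf where "nf = sqrt (\<integral>x. (f x)\<^sup>2 \<partial>M)"
  define ng where "ng = sqrt (\<integral>x. (g x)\<^sup>2 \<partial>M)"
  have DF: "DF \<longlonglongrightarrow> 0" using tendsto_real_sqrt[OF limF] by (simp add: DF_def)
  have DG: "DG \<longlonglongrightarrow> 0" using tendsto_real_sqrt[OF limG] by (simp add: DG_def)
  have iF: "integrable M (\<lambda>x. (F n x - f x)\<^sup>2)" for n
    using F[of n] f integral_Cauchy_Schwarz(1)[OF _ _ F[of n] f]
    by (simp add: power2_diff mult.assoc)
  have iG: "integrable M (\<lambda>x. (G n x - g x)\<^sup>2)" for n
    using G[of n] g integral_Cauchy_Schwarz(1)[OF _ _ G[of n] g]
    by (simp add: power2_diff mult.assoc)
  have bound: "norm ((\<integral>x. F n x * G n x \<partial>M) - (\<integral>x. f x * g x \<partial>M)) \<le> DF n * DG n + DF n * ng + nf * DG n" for n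
  proof -
    note c1 = integral_Cauchy_Schwarz[OF _ _ iF[of n] iG[of n]]
    note c2 = integral_Cauchy_Schwarz[OF _ _ iF[of n] g]
    note c3 = integral_Cauchy_Schwarz[OF _ _ f iG[of n]]
    have "(\<integral>x. F n x * G n x \<partial>M) - (\<integral>x. f x * g x \<partial>M) = (\<integral>x. F n x * G n x - f x * g x \<partial>M)"
      using integral_Cauchy_Schwarz(1)[OF _ _ F[of n] G[of n]] integral_Cauchy_Schwarz(1)[OF _ _ f g] by simp
    also have "\<dots> = (\<integral>x. (F n x - f x) * (G n x - g x) + (F n x - f x) * g x + f x * (G n x - g x) \<partial>M)"
      by (intro Bochner_Integration.integral_cong) (auto simp: algebra_simps)
    also have "\<dots> = (\<integral>x. (F n x - f x) * (G n x - g x) \<partial>M) + (\<integral>x. (F n x - f x) * g x \<partial>M) + (\<integral>x. f x * (G n x - g x) \<partial>M)"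
    proof -
      have a: "integrable M (\<lambda>x. (F n x - f x) * (G n x - g x))" by (rule c1(1)) measurable
      have b: "integrable M (\<lambda>x. (F n x - f x) * g x)" by (rule c2(1)) measurable
      have c: "integrable M (\<lambda>x. f x * (G n x - g x))" by (rule c3(1)) measurable
      show ?thesis
        using Bochner_Integration.integral_add[OF Bochner_Integration.integrable_add[OF a b] c]
          Bochner_Integration.integral_add[OF a b] by simp
    qed
    finally have eq: "(\<integral>x. F n x * G n x \<partial>M) - (\<integral>x. f x * g x \<partial>M) = \<dots>" .
    have "\<bar>\<integral>x. (F n x - f x) * (G n x - g x) \<partial>M\<bar> \<le> DF n * DG n" unfolding DF_def DG_def by (rule c1(2)) measurable
    moreover have "\<bar>\<integral>x. (F n x - f x) * g x \<partial>M\<bar> \<le> DF n * ng" unfolding DF_def ng_def by (rule c2(2)) measurable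
    moreover have "\<bar>\<integral>x. f x * (G n x - g x) \<partial>M\<bar> \<le> nf * DG n" unfolding nf_def DG_def by (rule c3(2)) measurable
    ultimately show ?thesis unfolding eq real_norm_def by linarith
  qed
  have lim: "(\<lambda>n. DF n * DG n + DF n * ng + nf * DG n) \<longlonglongrightarrow> 0 * 0 + 0 * ng + nf * 0"
    by (intro tendsto_intros DF DG)
  have "(\<lambda>n. (\<integral>x. F n x * G n x \<partial>M) - (\<integral>x. f x * g x \<partial>M)) \<longlonglongrightarrow> 0"
    by (rule Lim_null_comparison[OF always_eventually]) (use bound lim in auto)
  then show ?thesis by (rule LIM_zero_cancel)
qed

text \<open>Points off the sphere, a null set, are replaced by a fixed unit vector: the kernel then satisfies the
  hypotheses of the central limit theorem at every point and not just almost everywhere.\<close>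

definition rho :: "nat \<Rightarrow> (nat \<Rightarrow> real) \<Rightarrow> nat \<Rightarrow> real" where
  "rho d x = (if unit_d d x then x else basis_vec d 0)"

lemma rho_unit: "unit_d d (rho d x)"
  by (simp add: rho_def unit_basis_vec)

lemma basis_vec_space: "basis_vec d j \<in> space (eucl_space d)"
  by (simp add: basis_vec_def space_eucl_space)

lemma rho_meas [measurable]: "rho d \<in> measurable (eucl_space d) (eucl_space d)"
  unfolding rho_def by (rule measurable_If) (use basis_vec_space in measurable)

locale psi_kernel =
  fixes d :: nat and v :: "nat \<Rightarrow> nat \<Rightarrow> real" and f :: "real \<Rightarrow> real"
  assumes d: "d \<ge> 3" and psi: "is_psi v d f"
    and summ: "summable (\<lambda>k. v (Suc k) d ^ 4 * dim_harm (Suc k) d)"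
begin

abbreviation \<mu> :: "(nat \<Rightarrow> real) measure" where "\<mu> \<equiv> uniform_sphere d"
abbreviation \<nu> :: "real measure" where "\<nu> \<equiv> geg_measure d"
abbreviation pn :: "nat \<Rightarrow> real \<Rightarrow> real" where "pn \<equiv> psi_partial v d"

text \<open>The variance of one kernel value, hence half of the squared normalisation in the
  theorem.\<close>

definition tau :: real where "tau = (\<Sum>k. v (Suc k) d ^ 4 * dim_harm (Suc k) d)"
definition eta :: real where "eta = (\<Sum>k. v (Suc k) d ^ 8 * dim_harm (Suc k) d)"

sublocale U: prob_space \<mu> by (rule prob_space_uniform_sphere)
sublocale V: prob_space \<nu> by (rule prob_space_geg_measure[OF d])

lemma f_meas [measurable]: "f \<in> borel_measurable borel"
  using psi by (simp add: is_psi_def)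

lemma pn_eq: "pn N t = (\<Sum>k=1..N. (v k d)\<^sup>2 * poly (zonal d k) t)"
  by (rule psi_partial_zonal[OF d])

lemma continuous_pn: "continuous_on UNIV (pn N)"
  unfolding pn_eq by (intro continuous_intros)

lemma pn_meas [measurable]: "pn N \<in> borel_measurable borel"
  by (rule borel_measurable_continuous_onI[OF continuous_pn])

lemma integrable_pn_square: "integrable \<nu> (\<lambda>t. (pn N t)\<^sup>2)"
  by (intro integrable_geg_measure_continuous[OF d] continuous_intros continuous_pn)

text \<open>The weighted integral in \<open>is_psi\<close> is not normalised; dividing by the total
  mass makes it an expectation.\<close>

lemma nn_L2_limit: "(\<lambda>N. \<integral>\<^sup>+t. ennreal ((pn N t - f t)\<^sup>2) \<partial>\<nu>) \<longlonglongrightarrow> 0"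
proof -
  have mp: "geg_mass d > 0" by (rule geg_mass_pos[OF d])
  have "(\<integral>\<^sup>+t. ennreal ((pn N t - f t)\<^sup>2) \<partial>\<nu>) = ennreal (1 / geg_mass d) *
      (\<integral>\<^sup>+ x\<in>{-1..1}. ennreal ((psi_partial v d N x - f x)\<^sup>2 * geg_weight d x) \<partial>lborel)" for N
    using mp by (subst nn_integral_geg_measure[OF d])
      (auto simp: divide_ennreal_def inverse_ennreal mult.commute inverse_eq_divide)
  moreover have "(\<lambda>N. ennreal (1 / geg_mass d) *
      (\<integral>\<^sup>+ x\<in>{-1..1}. ennreal ((psi_partial v d N x - f x)\<^sup>2 * geg_weight d x) \<partial>lborel)) \<longlonglongrightarrow> ennreal (1 / geg_mass d) * 0"
    using psi unfolding is_psi_def by (intro ennreal_tendsto_cmult) auto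
  ultimately show ?thesis by simp
qed

text \<open>One partial sum at squared distance below 1 suffices, since it is itself square
  integrable.\<close>

lemma integrable_f_square: "integrable \<nu> (\<lambda>t. (f t)\<^sup>2)"
proof -
  have "eventually (\<lambda>N. (\<integral>\<^sup>+t. ennreal ((pn N t - f t)\<^sup>2) \<partial>\<nu>) < 1) sequentially"
    using nn_L2_limit by (rule order_tendstoD) simp
  then obtain N where N: "(\<integral>\<^sup>+t. ennreal ((pn N t - f t)\<^sup>2) \<partial>\<nu>) < 1"
    by (auto simp: eventually_sequentially)
  have i: "integrable \<nu> (\<lambda>t. (pn N t - f t)\<^sup>2)"
    using N by (intro integrableI_bounded) (auto intro: less_trans simp: less_top[symmetric])
  show ?thesis
  proof (rule Bochner_Integration.integrable_bound)
    show "integrable \<nu> (\<lambda>t. 2 * (pn N t - f t)\<^sup>2 + 2 * (pn N t)\<^sup>2)"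
      using i integrable_pn_square[of N] by simp
    have "b\<^sup>2 \<le> 2 * (a - b)\<^sup>2 + 2 * a\<^sup>2" for a b :: real
      using zero_le_power2[of "2 * a - b"] by (simp add: power2_eq_square algebra_simps)
    then show "AE t in \<nu>. norm ((f t)\<^sup>2) \<le> norm (2 * (pn N t - f t)\<^sup>2 + 2 * (pn N t)\<^sup>2)" by simp
  qed measurable
qed

lemma L2_limit: "(\<lambda>N. \<integral>t. (pn N t - f t)\<^sup>2 \<partial>\<nu>) \<longlonglongrightarrow> 0"
proof -
  have "(\<integral>t. (pn N t - f t)\<^sup>2 \<partial>\<nu>) = enn2real (\<integral>\<^sup>+t. ennreal ((pn N t - f t)\<^sup>2) \<partial>\<nu>)" for N
    by (subst integral_eq_nn_integral) auto
  then show ?thesis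
    using tendsto_enn2real[of "\<lambda>N. \<integral>\<^sup>+t. ennreal ((pn N t - f t)\<^sup>2) \<partial>\<nu>" 0 sequentially] nn_L2_limit by simp
qed

text \<open>Pairing with the constant 1 is continuous in L^2, and the series starts at k = 1, so
  every partial sum is centred.\<close>

lemma f_mean: "(\<integral>t. f t \<partial>\<nu>) = 0"
proof -
  have "(\<lambda>N. \<integral>t. pn N t * 1 \<partial>\<nu>) \<longlonglongrightarrow> (\<integral>t. f t * 1 \<partial>\<nu>)"
    by (rule L2_inner_tendsto) (use integrable_pn_square integrable_f_square L2_limit in auto)
  moreover have "(\<integral>t. pn N t \<partial>\<nu>) = 0" for N
  proof -
    have "(\<integral>t. poly (zonal d k) t \<partial>\<nu>) = 0" if "k \<ge> 1" for k
      using Lam_geg_poly_eq_0[OF d that refl] by (simp add: zonal_def Lam_def)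
    then show ?thesis
      unfolding pn_eq using integrable_poly_geg[OF d]
      by (subst Bochner_Integration.integral_sum) auto
  qed
  ultimately show ?thesis by (simp add: LIMSEQ_const_iff)
qed

text \<open>The iterated kernel is an inner product of two L^2 functions, so its series converges at
  every pair of unit vectors. The reproducing property turns products of squared weights into fourth
  powers.\<close>

lemma conv_limit:
  assumes x: "unit_d d x" and y: "unit_d d y"
  shows "(\<lambda>N. \<Sum>k=1..N. v k d ^ 4 * poly (zonal d k) (inner_d d x y)) \<longlonglongrightarrow> (\<integral>z. f (inner_d d x z) * f (inner_d d y z) \<partial>\<mu>)"
proof -
  have sq: "integrable \<mu> (\<lambda>z. (pn N (inner_d d x z))\<^sup>2)" "integrable \<mu> (\<lambda>z. (f (inner_d d x z))\<^sup>2)"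
    "(\<lambda>N. \<integral>z. (pn N (inner_d d x z) - f (inner_d d x z))\<^sup>2 \<partial>\<mu>) \<longlonglongrightarrow> 0" if "unit_d d x" for x N
  proof -
    show "integrable \<mu> (\<lambda>z. (pn N (inner_d d x z))\<^sup>2)"
      using sphere_integrable_inner[OF d that, of "\<lambda>t. (pn N t)\<^sup>2"] integrable_pn_square by simp
    show "integrable \<mu> (\<lambda>z. (f (inner_d d x z))\<^sup>2)"
      using sphere_integrable_inner[OF d that, of "\<lambda>t. (f t)\<^sup>2"] integrable_f_square by simp
    have "(\<integral>z. (pn N (inner_d d x z) - f (inner_d d x z))\<^sup>2 \<partial>\<mu>) = (\<integral>t. (pn N t - f t)\<^sup>2 \<partial>\<nu>)" for N
      using sphere_integral_inner[OF d that, of "\<lambda>t. (pn N t - f t)\<^sup>2"] by simp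
    then show "(\<lambda>N. \<integral>z. (pn N (inner_d d x z) - f (inner_d d x z))\<^sup>2 \<partial>\<mu>) \<longlonglongrightarrow> 0"
      using L2_limit by simp
  qed
  have "(\<lambda>N. \<integral>z. pn N (inner_d d x z) * pn N (inner_d d y z) \<partial>\<mu>) \<longlonglongrightarrow> (\<integral>z. f (inner_d d x z) * f (inner_d d y z) \<partial>\<mu>)"
    by (rule L2_inner_tendsto[OF _ _ _ _ sq(1)[OF x] sq(1)[OF y] sq(2)[OF x] sq(2)[OF y] sq(3)[OF x] sq(3)[OF y]]) measurable
  moreover have "(\<integral>z. pn N (inner_d d x z) * pn N (inner_d d y z) \<partial>\<mu>) = (\<Sum>k=1..N. v k d ^ 4 * poly (zonal d k) (inner_d d x y))" for N
    unfolding pn_eq zonal_series_conv[OF d x y]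
    by (intro sum.cong refl) (simp add: power2_eq_square power4_eq_xxxx)
  ultimately show ?thesis by simp
qed

lemma sum_1_eq: "(\<Sum>k=1..N. g k) = (\<Sum>k<N. g (Suc k))" for g :: "nat \<Rightarrow> real"
  by (simp add: sum.atLeast1_atMost_eq)

text \<open>Parseval's identity, as the case y = x of \<open>conv_limit\<close>; the values at 1
  supply the dimensions.\<close>

lemma f_square: "(\<integral>t. (f t)\<^sup>2 \<partial>\<nu>) = tau"
proof -
  have x: "unit_d d (basis_vec d 0)" by (rule unit_basis_vec)
  have "(\<lambda>N. \<Sum>k=1..N. v k d ^ 4 * poly (zonal d k) 1) \<longlonglongrightarrow> (\<integral>t. (f t)\<^sup>2 \<partial>\<nu>)"
    using conv_limit[OF x x] sphere_integral_inner[OF d x, of "\<lambda>t. (f t)\<^sup>2"] x by (simp add: power2_eq_square)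
  also have "(\<lambda>N. \<Sum>k=1..N. v k d ^ 4 * poly (zonal d k) 1) = (\<lambda>N. \<Sum>k<N. v (Suc k) d ^ 4 * dim_harm (Suc k) d)"
    unfolding sum_1_eq by (intro ext sum.cong) (auto simp: zonal_at_1[OF d])
  finally have "(\<lambda>k. v (Suc k) d ^ 4 * dim_harm (Suc k) d) sums (\<integral>t. (f t)\<^sup>2 \<partial>\<nu>)" by (simp add: sums_def)
  then show ?thesis by (simp add: tau_def sums_iff)
qed

lemma dim_harm_ge_1: "dim_harm (Suc k) d \<ge> 1"
proof -
  have "(d + Suc k - 1) choose (d - 1) \<ge> 1" using d by (simp add: Suc_le_eq)
  then show ?thesis unfolding dim_harm_def by linarith
qed

text \<open>Dimensions are at least 1, so each v_k^4 is at most \<open>tau\<close>, and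
  \<open>tau\<close> times the fourth-power series dominates.\<close>

lemma summable_eta: "summable (\<lambda>k. v (Suc k) d ^ 8 * dim_harm (Suc k) d)"
proof (rule summable_comparison_test)
  show "summable (\<lambda>k. tau * (v (Suc k) d ^ 4 * dim_harm (Suc k) d))" using summ by (rule summable_mult)
  have "norm (v (Suc k) d ^ 8 * dim_harm (Suc k) d) \<le> tau * (v (Suc k) d ^ 4 * dim_harm (Suc k) d)" for k
  proof -
    define b where "b = v (Suc k) d ^ 4"
    have b0: "b \<ge> 0" by (simp add: b_def)
    have "b \<le> b * dim_harm (Suc k) d" using b0 dim_harm_ge_1[of k] by (simp add: mult_le_cancel_left1)
    also have "\<dots> = (\<Sum>i\<in>{k}. v (Suc i) d ^ 4 * dim_harm (Suc i) d)" by (simp add: b_def)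
    also have "\<dots> \<le> tau" unfolding tau_def
      using summ dim_harm_nonneg by (intro sum_le_suminf) auto
    finally have "b * (b * dim_harm (Suc k) d) \<le> tau * (b * dim_harm (Suc k) d)"
      using b0 dim_harm_nonneg by (intro mult_right_mono) auto
    moreover have "v (Suc k) d ^ 8 = b * b" unfolding b_def by (simp flip: power_add)
    then have "norm (v (Suc k) d ^ 8 * dim_harm (Suc k) d) = b * (b * dim_harm (Suc k) d)"
      using b0 dim_harm_nonneg[of "Suc k" d] by (simp only: real_norm_def abs_mult abs_of_nonneg mult.assoc)
    ultimately show ?thesis unfolding b_def[symmetric] by (simp only:)
  qed
  then show "\<exists>N. \<forall>n\<ge>N. norm (v (Suc n) d ^ 8 * dim_harm (Suc n) d) \<le> tau * (v (Suc n) d ^ 4 * dim_harm (Suc n) d)" by blast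
qed

lemma eta_nonneg: "0 \<le> eta"
  unfolding eta_def using summable_eta dim_harm_nonneg by (intro suminf_nonneg) auto

text \<open>Fatou's lemma for the partial sums of the iterated kernel, whose second moments are
  partial sums of \<open>eta\<close>. As only an upper bound is wanted, pointwise convergence
  suffices.\<close>

lemma correlation_bound:
  assumes x: "unit_d d x"
  shows "(\<integral>\<^sup>+y. ennreal ((\<integral>z. f (inner_d d x z) * f (inner_d d y z) \<partial>\<mu>)\<^sup>2) \<partial>\<mu>) \<le> ennreal eta"
proof -
  define S where "S = (\<lambda>N y. \<Sum>k=1..N. v k d ^ 4 * poly (zonal d k) (inner_d d x y))"
  have S_meas [measurable]: "S N \<in> borel_measurable \<mu>" for N
    unfolding S_def
    by (intro borel_measurable_sum borel_measurable_times measurable_compose[OF _ borel_measurable_poly]) measurable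
  have SS: "(\<integral>\<^sup>+y. ennreal ((S N y)\<^sup>2) \<partial>\<mu>) \<le> ennreal eta" for N
  proof -
    have p2: "continuous_on UNIV (\<lambda>t. (\<Sum>k=1..N. v k d ^ 4 * poly (zonal d k) t)\<^sup>2)"
      by (intro continuous_intros)
    have i: "integrable \<mu> (\<lambda>y. (S N y)\<^sup>2)"
      unfolding S_def
      using sphere_integrable_inner[OF d x borel_measurable_continuous_onI[OF p2]] integrable_geg_measure_continuous[OF d p2] by simp
    have "(\<integral>y. (S N y)\<^sup>2 \<partial>\<mu>) = (\<Sum>k=1..N. v k d ^ 4 * v k d ^ 4 * poly (zonal d k) (inner_d d x x))"
      unfolding S_def power2_eq_square by (rule zonal_series_conv[OF d x x])
    also have "\<dots> = (\<Sum>k<N. v (Suc k) d ^ 8 * dim_harm (Suc k) d)"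
      unfolding sum_1_eq using x by (intro sum.cong) (auto simp: zonal_at_1[OF d] simp flip: power_add)
    also have "\<dots> \<le> eta" unfolding eta_def
      using summable_eta dim_harm_nonneg by (intro sum_le_suminf) auto
    finally show ?thesis using i by (subst nn_integral_eq_integral) (auto intro: ennreal_leI)
  qed
  have "(\<integral>\<^sup>+y. ennreal ((\<integral>z. f (inner_d d x z) * f (inner_d d y z) \<partial>\<mu>)\<^sup>2) \<partial>\<mu>) = (\<integral>\<^sup>+y. liminf (\<lambda>N. ennreal ((S N y)\<^sup>2)) \<partial>\<mu>)"
  proof (rule nn_integral_cong_AE, rule eventually_mono[OF AE_uniform_sphere_unit])
    fix y assume y: "unit_d d y"
    have "(\<lambda>N. ennreal ((S N y)\<^sup>2)) \<longlonglongrightarrow> ennreal ((\<integral>z. f (inner_d d x z) * f (inner_d d y z) \<partial>\<mu>)\<^sup>2)"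
      unfolding S_def by (intro tendsto_ennrealI tendsto_power conv_limit[OF x y])
    from lim_imp_Liminf[OF trivial_limit_sequentially this]
    show "ennreal ((\<integral>z. f (inner_d d x z) * f (inner_d d y z) \<partial>\<mu>)\<^sup>2) = liminf (\<lambda>N. ennreal ((S N y)\<^sup>2))"
      by (simp only:)
  qed
  also have "\<dots> \<le> liminf (\<lambda>N. \<integral>\<^sup>+y. ennreal ((S N y)\<^sup>2) \<partial>\<mu>)" by (rule nn_integral_liminf) measurable
  also have "\<dots> \<le> ennreal eta"
    using SS by (intro Liminf_le) auto
  finally show ?thesis .
qed

end

context psi_kernel begin

definition kern :: "(nat \<Rightarrow> real) \<Rightarrow> (nat \<Rightarrow> real) \<Rightarrow> real" where
  "kern x y = f (inner_d d (rho d x) (rho d y)) / sqrt tau"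

lemma kern_meas [measurable (raw)]:
  assumes [measurable]: "g \<in> measurable N (eucl_space d)" "h \<in> measurable N (eucl_space d)"
  shows "(\<lambda>w. kern (g w) (h w)) \<in> borel_measurable N"
  unfolding kern_def by measurable

lemma AE_rho: "AE z in \<mu>. rho d z = z"
  by (rule eventually_mono[OF AE_uniform_sphere_unit]) (simp add: rho_def)

lemma
  fixes h :: "real \<Rightarrow> real"
  assumes [measurable]: "h \<in> borel_measurable borel"
  shows integral_rho: "(\<integral>z. h (inner_d d (rho d x) (rho d z)) \<partial>\<mu>) = (\<integral>t. h t \<partial>\<nu>)"
    and integrable_rho: "integrable \<nu> h \<Longrightarrow> integrable \<mu> (\<lambda>z. h (inner_d d (rho d x) (rho d z)))"
proof -
  have m: "(\<lambda>z. h (inner_d d (rho d x) z)) \<in> borel_measurable \<mu>"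
      "(\<lambda>z. h (inner_d d (rho d x) (rho d z))) \<in> borel_measurable \<mu>" by measurable
  have ae: "AE z in \<mu>. h (inner_d d (rho d x) (rho d z)) = h (inner_d d (rho d x) z)"
    by (rule eventually_mono[OF AE_rho]) simp
  show "(\<integral>z. h (inner_d d (rho d x) (rho d z)) \<partial>\<mu>) = (\<integral>t. h t \<partial>\<nu>)"
    using integral_cong_AE[OF m(2,1) ae] sphere_integral_inner[OF d rho_unit assms, of x] by simp
  show "integrable \<mu> (\<lambda>z. h (inner_d d (rho d x) (rho d z)))" if "integrable \<nu> h"
    using integrable_cong_AE[OF m(2,1) ae] sphere_integrable_inner[OF d rho_unit assms, of x] that by simp
qed

text \<open>The law of the inner product of a unit vector with a uniform point does not depend on
  that vector, so each pointwise moment condition reduces to a moment of f under the Gegenbauer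
  measure. The iterated kernel of \<open>kern\<close> is that of f divided by \<open>tau\<close>,
  which explains the bound \<open>eta\<close> / \<open>tau\<close>^2.\<close>

lemma degenerate_kernel_kern:
  assumes tau: "tau > 0" and f4: "integrable \<nu> (\<lambda>t. f t ^ 4)" and C: "(\<integral>t. f t ^ 4 \<partial>\<nu>) \<le> C * tau\<^sup>2"
  shows "degenerate_kernel \<mu> kern C (sqrt eta / tau)"
proof
  have st: "sqrt tau ^ 4 = tau\<^sup>2"
  proof -
    have "sqrt tau ^ 4 = ((sqrt tau)\<^sup>2)\<^sup>2" by (simp flip: power_mult)
    then show ?thesis using tau by simp
  qed
  have k4: "kern x z ^ 4 = f (inner_d d (rho d x) (rho d z)) ^ 4 / tau\<^sup>2" for x z
    by (simp add: kern_def power_divide st)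
  have k2: "(kern x z)\<^sup>2 = (f (inner_d d (rho d x) (rho d z)))\<^sup>2 / tau" for x z
    using tau by (simp add: kern_def power_divide)
  show "(\<lambda>(x, y). kern x y) \<in> borel_measurable (\<mu> \<Otimes>\<^sub>M \<mu>)" unfolding split_def by measurable
  show "kern x y = kern y x" for x y by (simp add: kern_def inner_d_commute[of d "rho d x"])
  show "integrable \<mu> (\<lambda>z. kern x z ^ 4)" for x
    unfolding k4 using integrable_rho[of "\<lambda>t. f t ^ 4" x] f4 by simp
  show "U.expectation (kern x) = 0" for x
    using integral_rho[of f x] f_mean unfolding kern_def by simp
  show "U.expectation (\<lambda>z. (kern x z)\<^sup>2) = 1" for x
    unfolding k2 using integral_rho[of "\<lambda>t. (f t)\<^sup>2" x] f_square tau by simp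
  show "U.expectation (\<lambda>z. kern x z ^ 4) \<le> C" for x
    unfolding k4 using integral_rho[of "\<lambda>t. f t ^ 4" x] C tau by (simp add: divide_le_eq)
  show "0 \<le> sqrt eta / tau" using eta_nonneg tau by simp
  fix x
  define x' where "x' = rho d x"
  have x': "unit_d d x'" by (simp add: x'_def rho_unit)
  have Gm: "(\<lambda>y. U.expectation (\<lambda>z. kern x z * kern y z)) \<in> borel_measurable \<mu>"
    unfolding kern_def by measurable
  show "U.expectation (\<lambda>y. (U.expectation (\<lambda>z. kern x z * kern y z))\<^sup>2) \<le> (sqrt eta / tau)\<^sup>2"
  proof -
    have inner: "U.expectation (\<lambda>z. kern x z * kern y z) = (\<integral>z. f (inner_d d x' z) * f (inner_d d (rho d y) z) \<partial>\<mu>) / tau" for y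
    proof -
      have "U.expectation (\<lambda>z. kern x z * kern y z) = (\<integral>z. f (inner_d d x' z) * f (inner_d d (rho d y) z) / tau \<partial>\<mu>)"
      proof (rule integral_cong_AE)
        show "AE z in \<mu>. kern x z * kern y z = f (inner_d d x' z) * f (inner_d d (rho d y) z) / tau"
          by (rule eventually_mono[OF AE_rho]) (use tau in \<open>simp add: kern_def x'_def\<close>)
        show "(\<lambda>z. kern x z * kern y z) \<in> borel_measurable \<mu>"
          unfolding kern_def by measurable
      qed measurable
      then show ?thesis by simp
    qed
    have "(\<integral>\<^sup>+y. ennreal ((U.expectation (\<lambda>z. kern x z * kern y z))\<^sup>2) \<partial>\<mu>) =
        (\<integral>\<^sup>+y. ennreal (1 / tau\<^sup>2) * ennreal ((\<integral>z. f (inner_d d x' z) * f (inner_d d y z) \<partial>\<mu>)\<^sup>2) \<partial>\<mu>)"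
      by (rule nn_integral_cong_AE, rule eventually_mono[OF AE_rho])
         (simp add: inner power_divide ennreal_mult[symmetric])
    also have "\<dots> = ennreal (1 / tau\<^sup>2) * (\<integral>\<^sup>+y. ennreal ((\<integral>z. f (inner_d d x' z) * f (inner_d d y z) \<partial>\<mu>)\<^sup>2) \<partial>\<mu>)"
      by (rule nn_integral_cmult) measurable
    also have "\<dots> \<le> ennreal (1 / tau\<^sup>2) * ennreal eta"
      by (intro mult_left_mono correlation_bound x') simp
    also have "\<dots> = ennreal ((sqrt eta / tau)\<^sup>2)"
      using eta_nonneg by (simp add: ennreal_mult[symmetric] power_divide)
    finally have "enn2real (\<integral>\<^sup>+y. ennreal ((U.expectation (\<lambda>z. kern x z * kern y z))\<^sup>2) \<partial>\<mu>) \<le> (sqrt eta / tau)\<^sup>2"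
      by (intro enn2real_leI) auto
    then show ?thesis
      using Gm by (subst integral_eq_nn_integral) auto
  qed
qed

end

section \<open>From the sample to the product measure\<close>

lemma sum_pairs_reindex:
  fixes g :: "nat \<Rightarrow> nat \<Rightarrow> real"
  shows "(\<Sum>(i, j) \<in> {(i, j). 1 \<le> i \<and> i < j \<and> j \<le> n}. g i j) = (\<Sum>i'<n. \<Sum>i<i'. g (Suc i) (Suc i'))"
proof -
  have "(\<Sum>i'<n. \<Sum>i<i'. g (Suc i) (Suc i')) = (\<Sum>(i', i)\<in>Sigma {..<n} (\<lambda>i'. {..<i'}). g (Suc i) (Suc i'))"
    by (rule sum.Sigma) auto
  also have "\<dots> = (\<Sum>(i, j) \<in> {(i, j). 1 \<le> i \<and> i < j \<and> j \<le> n}. g i j)"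
    by (rule sum.reindex_bij_witness[where j="\<lambda>(i', i). (Suc i, Suc i')" and i="\<lambda>(i, j). (j - 1, i - 1)"]) auto
  finally show ?thesis by simp
qed

text \<open>Independence makes the law of the sample a product measure, and the shift of indices
  from 1..n to 0..n-1 fits the order in which points are added. The factor sqrt 2 / n arises from 2
  / sqrt (2 \<open>tau\<close>) = sqrt 2 / sqrt \<open>tau\<close>.\<close>

lemma char_T_stat:
  fixes X :: "nat \<Rightarrow> 'a \<Rightarrow> nat \<Rightarrow> real" and n :: nat
  assumes k: "psi_kernel d v f" and P: "prob_space M" and n: "n \<ge> 1"
    and meas: "\<And>i. i \<in> {1..n} \<Longrightarrow> X i \<in> measurable M (eucl_space d)"
    and unif: "\<And>i. i \<in> {1..n} \<Longrightarrow> distr M (eucl_space d) (X i) = uniform_sphere d"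
    and indep: "prob_space.indep_vars M (\<lambda>_. eucl_space d) X {1..n}"
    and s2: "s2 = 2 * psi_kernel.tau d v" "s2 > 0"
  shows "(\<lambda>\<omega>. T_stat n d f X \<omega> / sqrt s2) \<in> borel_measurable M"
    and "char (distr M borel (\<lambda>\<omega>. T_stat n d f X \<omega> / sqrt s2)) t =
      (\<integral>w. iexp (t * (sqrt 2 / n * (\<Sum>i'<n. \<Sum>i<i'. psi_kernel.kern d v f (w i) (w i')))) \<partial>PiM {..<n} (\<lambda>_. uniform_sphere d))"
proof -
  interpret M: prob_space M by fact
  interpret psi_kernel d v f by fact
  have tau: "tau > 0" using s2 by simp
  have Xm: "X (Suc i) \<in> measurable M (eucl_space d)" if "i < n" for i using meas[of "Suc i"] that by simp
  have Xm' [measurable]: "X (Suc i) \<in> measurable M \<mu>" if "i < n" for i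
    using Xm[OF that] by (simp cong: measurable_cong_sets)
  have T: "T_stat n d f X \<omega> = 2 / n * (\<Sum>i'<n. \<Sum>i<i'. f (inner_d d (X (Suc i) \<omega>) (X (Suc i') \<omega>)))" for \<omega>
    unfolding T_stat_def sum_pairs_reindex ..
  have fm: "(\<lambda>\<omega>. f (inner_d d (X (Suc i) \<omega>) (X (Suc i') \<omega>))) \<in> borel_measurable M" if "i < i'" "i' < n" for i i'
    by (rule measurable_compose[OF inner_d_meas f_meas]) (use that Xm in auto)
  show Tm: "(\<lambda>\<omega>. T_stat n d f X \<omega> / sqrt s2) \<in> borel_measurable M"
    unfolding T using fm by (intro borel_measurable_divide borel_measurable_times borel_measurable_sum borel_measurable_const) auto
  define Z where "Z = (\<lambda>\<omega>. \<lambda>i\<in>{..<n}. X (Suc i) \<omega>)"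
  define W where "W = (\<lambda>\<omega>. \<lambda>i\<in>{1..n}. X i \<omega>)"
  have Wm: "W \<in> measurable M (PiM {1..n} (\<lambda>_. eucl_space d))"
    unfolding W_def using meas by (intro measurable_restrict) auto
  have "distr M (PiM {1..n} (\<lambda>_. eucl_space d)) W = PiM {1..n} (\<lambda>i. distr M (eucl_space d) (X i))"
    unfolding W_def using n meas indep by (subst (asm) M.indep_vars_iff_distr_eq_PiM') auto
  also have "\<dots> = PiM {1..n} (\<lambda>_. \<mu>)" using unif by (intro PiM_cong) auto
  finally have lawW: "distr M (PiM {1..n} (\<lambda>_. eucl_space d)) W = PiM {1..n} (\<lambda>_. \<mu>)" .
  have Sm': "(\<lambda>w. \<lambda>i\<in>{..<n}. w (Suc i)) \<in> measurable (PiM {1..n} (\<lambda>_. eucl_space d)) (PiM {..<n} (\<lambda>_. eucl_space d))"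
    by (intro measurable_restrict measurable_component_singleton) auto
  have setsP: "sets (PiM J (\<lambda>_. \<mu>)) = sets (PiM J (\<lambda>_. eucl_space d))" for J :: "nat set"
    by (intro sets_PiM_cong) auto
  have "distr M (PiM {..<n} (\<lambda>_. eucl_space d)) Z =
      distr (distr M (PiM {1..n} (\<lambda>_. eucl_space d)) W) (PiM {..<n} (\<lambda>_. eucl_space d)) (\<lambda>w. \<lambda>i\<in>{..<n}. w (Suc i))"
    using Wm Sm' by (subst distr_distr) (auto simp: Z_def W_def comp_def fun_eq_iff restrict_def intro!: distr_cong)
  also have "\<dots> = distr (PiM {1..n} (\<lambda>_. \<mu>)) (PiM {..<n} (\<lambda>_. \<mu>)) (\<lambda>w. \<lambda>i\<in>{..<n}. w (Suc i))"
    unfolding lawW by (intro distr_cong) (simp_all add: setsP)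
  also have "\<dots> = PiM {..<n} (\<lambda>_. \<mu>)"
    using distr_PiM_reindex[of "{1..n}" "\<lambda>_. \<mu>" Suc "{..<n}"] U.prob_space_axioms by auto
  finally have law: "distr M (PiM {..<n} (\<lambda>_. eucl_space d)) Z = PiM {..<n} (\<lambda>_. \<mu>)" .
  have Zm: "Z \<in> measurable M (PiM {..<n} (\<lambda>_. eucl_space d))"
    unfolding Z_def using Xm by (intro measurable_restrict) auto
  define S where "S = (\<lambda>w. \<Sum>i'<n. \<Sum>i<i'. kern (w i) (w i'))"
  have Sm: "S \<in> borel_measurable (PiM {..<n} (\<lambda>_. eucl_space d))"
    unfolding S_def by measurable
  have "AE \<omega> in M. \<forall>i\<in>{..<n}. unit_d d (X (Suc i) \<omega>)"
  proof (rule AE_finite_allI)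
    fix i assume i: "i \<in> {..<n}"
    have "AE z in distr M (eucl_space d) (X (Suc i)). unit_d d z"
      using i AE_uniform_sphere_unit by (subst unif) auto
    then show "AE \<omega> in M. unit_d d (X (Suc i) \<omega>)"
      using i Xm by (intro AE_distrD[of "X (Suc i)" M "eucl_space d"]) auto
  qed simp
  \<comment> \<open>The equality is only almost sure, because \<open>kern\<close> replaces points
    off the sphere.\<close>
  then have eq: "AE \<omega> in M. T_stat n d f X \<omega> / sqrt s2 = sqrt 2 / n * S (Z \<omega>)"
  proof (rule eventually_mono)
    fix \<omega> assume u: "\<forall>i\<in>{..<n}. unit_d d (X (Suc i) \<omega>)"
    have "S (Z \<omega>) = (\<Sum>i'<n. \<Sum>i<i'. f (inner_d d (X (Suc i) \<omega>) (X (Suc i') \<omega>)) / sqrt tau)"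
      unfolding S_def Z_def using u by (intro sum.cong refl) (auto simp: kern_def rho_def)
    also have "\<dots> = (\<Sum>i'<n. \<Sum>i<i'. f (inner_d d (X (Suc i) \<omega>) (X (Suc i') \<omega>))) / sqrt tau"
      by (simp add: sum_divide_distrib)
    finally have S: "S (Z \<omega>) = (\<Sum>i'<n. \<Sum>i<i'. f (inner_d d (X (Suc i) \<omega>) (X (Suc i') \<omega>))) / sqrt tau" .
    define A where "A = (\<Sum>i'<n. \<Sum>i<i'. f (inner_d d (X (Suc i) \<omega>) (X (Suc i') \<omega>)))"
    have ss: "sqrt s2 = sqrt 2 * sqrt tau" by (simp add: s2 real_sqrt_mult)
    have h: "2 / (sqrt 2 * sqrt tau) = sqrt 2 / sqrt tau"
      using tau by (simp add: field_simps)
    have "2 / n * A / sqrt s2 = A / n * (2 / (sqrt 2 * sqrt tau))" by (simp add: ss)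
    also have "\<dots> = sqrt 2 / n * (A / sqrt tau)" unfolding h by simp
    finally show "T_stat n d f X \<omega> / sqrt s2 = sqrt 2 / n * S (Z \<omega>)"
      unfolding T S A_def .
  qed
  have "char (distr M borel (\<lambda>\<omega>. T_stat n d f X \<omega> / sqrt s2)) t = (\<integral>\<omega>. iexp (t * (T_stat n d f X \<omega> / sqrt s2)) \<partial>M)"
    unfolding char_def using Tm by (subst integral_distr) auto
  also have "\<dots> = (\<integral>\<omega>. iexp (t * (sqrt 2 / n * S (Z \<omega>))) \<partial>M)"
  proof (rule integral_cong_AE)
    show "AE \<omega> in M. iexp (t * (T_stat n d f X \<omega> / sqrt s2)) = iexp (t * (sqrt 2 / n * S (Z \<omega>)))"
      using eq by (rule eventually_mono) (simp only:)
    have "(\<lambda>x. iexp (t * x)) \<in> borel_measurable borel" by measurable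
    from measurable_compose[OF Tm this] show "(\<lambda>\<omega>. iexp (t * (T_stat n d f X \<omega> / sqrt s2))) \<in> borel_measurable M" .
    have "(\<lambda>x. iexp (t * (sqrt 2 / n * x))) \<in> borel_measurable borel" by measurable
    from measurable_compose[OF measurable_compose[OF Zm Sm] this]
    show "(\<lambda>\<omega>. iexp (t * (sqrt 2 / n * S (Z \<omega>)))) \<in> borel_measurable M" .
  qed
  also have "\<dots> = (\<integral>w. iexp (t * (sqrt 2 / n * S w)) \<partial>distr M (PiM {..<n} (\<lambda>_. eucl_space d)) Z)"
    using Zm Sm by (subst integral_distr) auto
  also have "\<dots> = (\<integral>w. iexp (t * (sqrt 2 / n * S w)) \<partial>PiM {..<n} (\<lambda>_. \<mu>))" unfolding law ..
  finally show "char (distr M borel (\<lambda>\<omega>. T_stat n d f X \<omega> / sqrt s2)) t =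
      (\<integral>w. iexp (t * (sqrt 2 / n * (\<Sum>i'<n. \<Sum>i<i'. kern (w i) (w i')))) \<partial>PiM {..<n} (\<lambda>_. \<mu>))"
    unfolding S_def .
qed

text \<open>Given the first point, its inner product with the second has the Gegenbauer law whatever
  that point is; the moment condition on the sample thus becomes one on f.\<close>

lemma pair_fourth_moment:
  fixes X :: "nat \<Rightarrow> 'a \<Rightarrow> nat \<Rightarrow> real" and n :: nat
  assumes k: "psi_kernel d v f" and P: "prob_space M" and n: "n \<ge> 2"
    and meas: "\<And>i. i \<in> {1..n} \<Longrightarrow> X i \<in> measurable M (eucl_space d)"
    and unif: "\<And>i. i \<in> {1..n} \<Longrightarrow> distr M (eucl_space d) (X i) = uniform_sphere d"
    and indep: "prob_space.indep_vars M (\<lambda>_. eucl_space d) X {1..n}"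
  shows "(\<integral>\<^sup>+ \<omega>. ennreal (f (inner_d d (X 1 \<omega>) (X 2 \<omega>)) ^ 4) \<partial>M) = (\<integral>\<^sup>+t. ennreal (f t ^ 4) \<partial>geg_measure d)"
proof -
  interpret M: prob_space M by fact
  interpret psi_kernel d v f by fact
  interpret PP: product_sigma_finite "\<lambda>_::nat. \<mu>"
    unfolding product_sigma_finite_def using U.sigma_finite_measure_axioms by simp
  define I where "I = {1, 2 :: nat}"
  have I: "I \<subseteq> {1..n}" using n by (auto simp: I_def)
  define Z where "Z = (\<lambda>\<omega>. \<lambda>i\<in>I. X i \<omega>)"
  have Zm: "Z \<in> measurable M (PiM I (\<lambda>_. eucl_space d))"
    unfolding Z_def using meas I by (intro measurable_restrict) auto
  have "M.indep_vars (\<lambda>_. eucl_space d) X I" using M.indep_vars_subset[OF indep I] .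
  then have "distr M (PiM I (\<lambda>_. eucl_space d)) Z = PiM I (\<lambda>i. distr M (eucl_space d) (X i))"
    unfolding Z_def using meas I by (subst (asm) M.indep_vars_iff_distr_eq_PiM') (auto simp: I_def)
  also have "\<dots> = PiM I (\<lambda>_. \<mu>)" using unif I by (intro PiM_cong) auto
  finally have law: "distr M (PiM I (\<lambda>_. eucl_space d)) Z = PiM I (\<lambda>_. \<mu>)" .
  have gm: "(\<lambda>w. ennreal (f (inner_d d (w 1) (w 2)) ^ 4)) \<in> borel_measurable (PiM I (\<lambda>_. eucl_space d))"
    unfolding I_def by measurable
  have "(\<integral>\<^sup>+ \<omega>. ennreal (f (inner_d d (X 1 \<omega>) (X 2 \<omega>)) ^ 4) \<partial>M) = (\<integral>\<^sup>+ \<omega>. ennreal (f (inner_d d (Z \<omega> 1) (Z \<omega> 2)) ^ 4) \<partial>M)"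
    by (simp add: Z_def I_def)
  also have "\<dots> = (\<integral>\<^sup>+w. ennreal (f (inner_d d (w 1) (w 2)) ^ 4) \<partial>PiM I (\<lambda>_. \<mu>))"
    unfolding law[symmetric] using Zm gm by (subst nn_integral_distr) auto
  also have "\<dots> = (\<integral>\<^sup>+p. ennreal (f (inner_d d (fst p) (snd p)) ^ 4) \<partial>(\<mu> \<Otimes>\<^sub>M \<mu>))"
    unfolding I_def
    by (rule PP.product_nn_integral_pair[of "\<lambda>x y. ennreal (f (inner_d d x y) ^ 4)"]) (simp_all add: split_def)
  also have "\<dots> = (\<integral>\<^sup>+x. \<integral>\<^sup>+y. ennreal (f (inner_d d x y) ^ 4) \<partial>\<mu> \<partial>\<mu>)"
    by (subst U.nn_integral_fst[symmetric]) auto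
  also have "\<dots> = (\<integral>\<^sup>+x. (\<integral>\<^sup>+t. ennreal (f t ^ 4) \<partial>\<nu>) \<partial>\<mu>)"
  proof (rule nn_integral_cong_AE, rule eventually_mono[OF AE_uniform_sphere_unit])
    fix x assume "unit_d d x"
    then show "(\<integral>\<^sup>+y. ennreal (f (inner_d d x y) ^ 4) \<partial>\<mu>) = (\<integral>\<^sup>+t. ennreal (f t ^ 4) \<partial>\<nu>)"
      by (intro sphere_nn_integral_inner[OF d, of x "\<lambda>t. f t ^ 4"]) measurable
  qed
  also have "\<dots> = (\<integral>\<^sup>+t. ennreal (f t ^ 4) \<partial>\<nu>)" by (simp add: U.emeasure_space_1[simplified])
  finally show ?thesis .
qed

section \<open>The limit theorem\<close>

theorem theorem1:
  fixes d :: "nat \<Rightarrow> nat"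
    and v :: "nat \<Rightarrow> nat \<Rightarrow> real"
    and M :: "nat \<Rightarrow> 'a measure"
    and X :: "nat \<Rightarrow> nat \<Rightarrow> 'a \<Rightarrow> nat \<Rightarrow> real"
    and psi :: "nat \<Rightarrow> real \<Rightarrow> real"
    and sigma2 :: "nat \<Rightarrow> real"
  assumes d_pos: "\<And>n. n \<ge> 1 \<Longrightarrow> d n \<ge> 1"
    and d_lim: "filterlim d at_top sequentially"
    and prob: "\<And>n. n \<ge> 1 \<Longrightarrow> prob_space (M n)"
    and meas: "\<And>n i. n \<ge> 1 \<Longrightarrow> i \<in> {1..n} \<Longrightarrow>
                  X n i \<in> measurable (M n) (eucl_space (d n))"
    and unif: "\<And>n i. n \<ge> 1 \<Longrightarrow> i \<in> {1..n} \<Longrightarrow>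
                  distr (M n) (eucl_space (d n)) (X n i) = uniform_sphere (d n)"
    and indep: "\<And>n. n \<ge> 1 \<Longrightarrow>
                  prob_space.indep_vars (M n) (\<lambda>_. eucl_space (d n)) (X n) {1..n}"
    and psi_def: "\<And>n. n \<ge> 1 \<Longrightarrow> is_psi v (d n) (psi n)"
    and summ: "\<And>n. n \<ge> 1 \<Longrightarrow> summable (\<lambda>k. (v (Suc k) (d n)) ^ 4 * dim_harm (Suc k) (d n))"
    and sigma2_def: "\<And>n. sigma2 n = 2 * (\<Sum>k. (v (Suc k) (d n)) ^ 4 * dim_harm (Suc k) (d n))"
    and sigma_pos: "\<And>n. n \<ge> 1 \<Longrightarrow> sigma2 n > 0"
    and cond_o: "(\<lambda>n. (\<Sum>k. (v (Suc k) (d n)) ^ 8 * dim_harm (Suc k) (d n)) / (sigma2 n)\<^sup>2)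
                   \<longlonglongrightarrow> 0"
    and cond_O: "\<exists>C. \<forall>\<^sub>F n in sequentially.
                   (\<integral>\<^sup>+ \<omega>. ennreal ((psi n (inner_d (d n) (X n 1 \<omega>) (X n 2 \<omega>))) ^ 4) \<partial>M n)
                     \<le> ennreal (C * (sigma2 n)\<^sup>2)"
  shows "weak_conv_m
           (\<lambda>n. distr (M n) borel (\<lambda>\<omega>. T_stat n (d n) (psi n) (X n) \<omega> / sqrt (sigma2 n)))
           (density lborel std_normal_density)"
proof -
  obtain C0 where C0: "\<forall>\<^sub>F n in sequentially.
      (\<integral>\<^sup>+ \<omega>. ennreal ((psi n (inner_d (d n) (X n 1 \<omega>) (X n 2 \<omega>))) ^ 4) \<partial>M n) \<le> ennreal (C0 * (sigma2 n)\<^sup>2)"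
    using cond_O by blast
  \<comment> \<open>The 4 comes from sigma^4 = 4 tau^2, and the absolute value makes the constant
    nonnegative.\<close>
  define C where "C = 4 * \<bar>C0\<bar>"
  define s where "s = (\<lambda>n \<omega>. T_stat n (d n) (psi n) (X n) \<omega> / sqrt (sigma2 n))"
  define D where "D = (\<lambda>n. distr (M n) borel (s n))"
  define \<eta> where "\<eta> = (\<lambda>n. \<Sum>k. (v (Suc k) (d n)) ^ 8 * dim_harm (Suc k) (d n))"
  \<comment> \<open>Since sigma^2 = 2 tau, this equals sqrt eta / tau, the correlation parameter of
    the kernel.\<close>
  define \<epsilon> where "\<epsilon> = (\<lambda>n. 2 * sqrt (\<eta> n / (sigma2 n)\<^sup>2))"
  define bd where "bd = (\<lambda>t n. 2 * t\<^sup>2 * \<epsilon> n + (t\<^sup>2 + 2 * t ^ 4 * (C + 3)) / (6 * sqrt (real n)) + t ^ 4 / (2 * real n))"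
  have \<epsilon>_lim: "\<epsilon> \<longlonglongrightarrow> 0"
    using tendsto_mult_right_zero[OF tendsto_real_sqrt[OF cond_o, unfolded real_sqrt_zero], of 2]
    unfolding \<epsilon>_def \<eta>_def .
  have s_meas: "s n \<in> borel_measurable (M n)" if n: "n \<ge> 1" for n
  proof -
    have f: "psi n \<in> borel_measurable borel" using psi_def[OF n] by (simp add: is_psi_def)
    have "(\<lambda>\<omega>. psi n (inner_d (d n) (X n (Suc i) \<omega>) (X n (Suc i') \<omega>))) \<in> borel_measurable (M n)"
      if "i < i'" "i' < n" for i i'
      by (rule measurable_compose[OF inner_d_meas f]) (use that n in \<open>auto intro!: meas\<close>)
    then show ?thesis
      unfolding s_def T_stat_def sum_pairs_reindex
      by (intro borel_measurable_divide borel_measurable_times borel_measurable_sum borel_measurable_const) auto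
  qed
  have D: "real_distribution (D n)" if n: "n \<ge> 1" for n
    unfolding D_def using prob_space.real_distribution_distr[OF prob[OF n] s_meas[OF n]] .
  have bound: "\<forall>\<^sub>F n in sequentially. cmod (char (D n) t - of_real (exp (- (t\<^sup>2 * (1 - 1 / n) / 2)))) \<le> bd t n" for t
  proof -
    \<comment> \<open>The dimension tends to infinity, so it is eventually at least 3; n \<ge> 2,
      required below, puts both points 1 and 2 into the sample.\<close>
    have d3: "\<forall>\<^sub>F n in sequentially. d n \<ge> 3"
      using d_lim by (simp add: filterlim_at_top)
    show ?thesis
      using C0 d3 eventually_ge_at_top[of 2]
    proof eventually_elim
      case (elim n)
      have n: "n \<ge> 1" "n \<ge> 2" using elim by auto
      interpret K: psi_kernel "d n" v "psi n"
        by unfold_locales (use elim psi_def[OF n(1)] summ[OF n(1)] in auto)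
      have s2: "sigma2 n = 2 * K.tau" unfolding K.tau_def by (rule sigma2_def)
      have tau: "K.tau > 0" using sigma_pos[OF n(1)] s2 by simp
      have eta: "K.eta = \<eta> n" by (simp add: K.eta_def \<eta>_def)
      have nn4: "(\<integral>\<^sup>+t. ennreal (psi n t ^ 4) \<partial>geg_measure (d n)) \<le> ennreal (C * K.tau\<^sup>2)"
      proof -
        have "(\<integral>\<^sup>+t. ennreal (psi n t ^ 4) \<partial>geg_measure (d n)) =
            (\<integral>\<^sup>+ \<omega>. ennreal ((psi n (inner_d (d n) (X n 1 \<omega>) (X n 2 \<omega>))) ^ 4) \<partial>M n)"
          using pair_fourth_moment[OF K.psi_kernel_axioms prob[OF n(1)] n(2) meas[OF n(1)] unif[OF n(1)] indep[OF n(1)]]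
          by simp
        also have "\<dots> \<le> ennreal (C0 * (sigma2 n)\<^sup>2)" by (rule elim(1))
        also have "\<dots> \<le> ennreal (C * K.tau\<^sup>2)"
        proof (rule ennreal_leI)
          have "C0 * (sigma2 n)\<^sup>2 \<le> \<bar>C0\<bar> * (sigma2 n)\<^sup>2" by (intro mult_right_mono) auto
          then show "C0 * (sigma2 n)\<^sup>2 \<le> C * K.tau\<^sup>2" by (simp add: C_def s2 power_mult_distrib)
        qed
        finally show ?thesis .
      qed
      have f4: "integrable (geg_measure (d n)) (\<lambda>t. psi n t ^ 4)"
        using nn4 by (intro integrableI_bounded) (auto intro: le_less_trans)
      have f4': "(\<integral>t. psi n t ^ 4 \<partial>geg_measure (d n)) \<le> C * K.tau\<^sup>2"
        using nn4 f4 by (subst integral_eq_nn_integral) (auto intro!: enn2real_leI simp: C_def)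
      interpret H: degenerate_kernel "uniform_sphere (d n)" K.kern C "sqrt K.eta / K.tau"
        by (rule K.degenerate_kernel_kern[OF tau f4 f4'])
      have "char (D n) t = (\<integral>w. iexp (t * (sqrt 2 / n * (\<Sum>i'<n. \<Sum>i<i'. K.kern (w i) (w i')))) \<partial>PiM {..<n} (\<lambda>_. uniform_sphere (d n)))"
        unfolding D_def s_def
        by (rule char_T_stat(2)[OF K.psi_kernel_axioms prob[OF n(1)] n(1) meas[OF n(1)] unif[OF n(1)] indep[OF n(1)] s2 sigma_pos[OF n(1)]])
      moreover have "sqrt K.eta / K.tau = \<epsilon> n"
        using tau K.eta_nonneg unfolding \<epsilon>_def eta s2 by (simp add: real_sqrt_divide real_sqrt_mult)
      ultimately show ?case
        using H.char_degenerate_U_statistic[OF n(1), of t] unfolding bd_def by simp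
    qed
  qed
  have conv: "(\<lambda>n. char (D n) t) \<longlonglongrightarrow> char std_normal_distribution t" for t
  proof -
    have inv: "(\<lambda>n. 1 / real n) \<longlonglongrightarrow> 0" by (rule lim_1_over_n)
    have invs: "(\<lambda>n. 1 / sqrt (real n)) \<longlonglongrightarrow> 0"
      using tendsto_real_sqrt[OF inv] by (simp add: real_sqrt_divide)
    have "(\<lambda>n. 2 * t\<^sup>2 * \<epsilon> n + (t\<^sup>2 + 2 * t ^ 4 * (C + 3)) / 6 * (1 / sqrt (real n)) + t ^ 4 / 2 * (1 / real n))
        \<longlonglongrightarrow> 2 * t\<^sup>2 * 0 + (t\<^sup>2 + 2 * t ^ 4 * (C + 3)) / 6 * 0 + t ^ 4 / 2 * 0"
      by (intro tendsto_intros \<epsilon>_lim inv invs)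
    then have bd: "bd t \<longlonglongrightarrow> 0" unfolding bd_def by simp
    have "(\<lambda>n. char (D n) t - of_real (exp (- (t\<^sup>2 * (1 - 1 / n) / 2)))) \<longlonglongrightarrow> 0"
      by (rule Lim_null_comparison[OF bound bd])
    moreover have "(\<lambda>n. complex_of_real (exp (- (t\<^sup>2 * (1 - 1 / n) / 2)))) \<longlonglongrightarrow> of_real (exp (- (t\<^sup>2 * (1 - 0) / 2)))"
      by (intro tendsto_intros inv) simp
    ultimately have "(\<lambda>n. (char (D n) t - of_real (exp (- (t\<^sup>2 * (1 - 1 / n) / 2)))) + complex_of_real (exp (- (t\<^sup>2 * (1 - 1 / n) / 2))))
        \<longlonglongrightarrow> 0 + of_real (exp (- (t\<^sup>2 * (1 - 0) / 2)))"
      by (rule tendsto_add)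
    then show ?thesis by (simp add: char_std_normal_distribution)
  qed
  \<comment> \<open>Index 0 lies outside the hypotheses, so the sequence is shifted by one for
    Levy's theorem and shifted back at the level of distribution functions.\<close>
  have Suc: "weak_conv_m (\<lambda>n. D (Suc n)) std_normal_distribution"
  proof (rule levy_continuity)
    show "real_distribution (D (Suc n))" for n by (rule D) simp
    show "real_distribution std_normal_distribution" by (rule real_dist_normal_dist)
    show "(\<lambda>n. char (D (Suc n)) t) \<longlonglongrightarrow> char std_normal_distribution t" for t
      using LIMSEQ_Suc[OF conv] .
  qed
  have "weak_conv_m D std_normal_distribution"
    unfolding weak_conv_m_def weak_conv_def
  proof (intro allI impI)
    fix x assume "isCont (cdf std_normal_distribution) x"
    then have "(\<lambda>n. cdf (D (Suc n)) x) \<longlonglongrightarrow> cdf std_normal_distribution x"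
      using Suc unfolding weak_conv_m_def weak_conv_def by blast
    then show "(\<lambda>n. cdf (D n) x) \<longlonglongrightarrow> cdf std_normal_distribution x"
      by (rule LIMSEQ_imp_Suc)
  qed
  then show ?thesis unfolding D_def s_def .
qed

end
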